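(* Let $s\in(0,1)$, let $k>0$ be a quadrature spacing, let $N^-,N^+$ be positive integers, and let $c$ be the constant in the decay estimate given in the context. Assume $M>2(s+1)/c$. Then there is a positive constant $C$ not depending on $M$ nor $k$ such that $$|a^k(\eta,\theta)-a^{k,M}(\eta,\theta)|\le Ce^{-cM}\|\eta\|_{L^2(D)}\|\theta\|_{L^2(D)}\qquad\text{for all }\eta,\theta\in L^2(D).$$
   Context: $D\subset\mathbb R^d$ is a bounded polygonal domain with Lipschitz boundary; $\widetilde\eta$ is the extension by zero of $\eta$ outside $D$; $(\cdot,\cdot)_\omega$ is the $L^2(\omega)$ inner product and $(\cdot,\cdot)=(\cdot,\cdot)_{\mathbb R^d}$; $d_\omega(\eta,\phi)=\int_\omega\nabla\eta\cdot\nabla\phi\,dx$ and $d(\cdot,\cdot)=d_{\mathbb R^d}(\cdot,\cdot)$. Truncated domains: $\Omega$ is a convex bounded domain of diameter $1$ containing $D$ and the origin. For $M>0$, $t>0$, $\Omega^M(t)=\{(1+t(1+M))x:x\in\Omega\}$ if $t\ge1$ and $\Omega^M(t)=\{(2+M)x:x\in\Omega\}$ if $t<1$. Set $B^M(t)=\{x\in\Omega^M(t):\operatorname{dist}(x,\partial\Omega^M(t))<t\}$. For $\eta\in L^2(D)$, $t>0$: $v(\widetilde\eta,t)\in H^1(\mathbb R^d)$ solves $(v,\phi)+t^2d(v,\phi)=-(\widetilde\eta,\phi)$ for all $\phi\in H^1(\mathbb R^d)$, and $w(\widetilde\eta,t)=\widetilde\eta+v(\widetilde\eta,t)$. Similarly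 $v^M(\widetilde\eta,t)\in H^1_0(\Omega^M(t))$ solves $(v^M,\phi)_{\Omega^M(t)}+t^2d_{\Omega^M(t)}(v^M,\phi)=-(\eta,\phi)_D$ for all $\phi\in H^1_0(\Omega^M(t))$, and $w^M(\widetilde\eta,t)=\widetilde\eta|_{\Omega^M(t)}+v^M(\widetilde\eta,t)$. Decay estimate (known): there are universal positive constants $c$ and $C$ with $$t\|\nabla v(\widetilde\eta,t)\|_{L^2(B^M(t))}+\|v(\widetilde\eta,t)\|_{L^2(B^M(t))}\le Ce^{-\max(1,t)cM/t}\|\eta\|_{L^2(D)}\quad\text{for all }\eta\in L^2(D).$$ With $c_s=2\sin(\pi s)/\pi$, $y_j=jk$, $t_j=e^{-y_j/2}$: $$a^k(\eta,\theta)=\frac{c_sk}2\sum_{j=-N^-}^{N^+}e^{sy_j}(w(\widetilde\eta,t_j),\theta)_D,\qquad a^{k,M}(\eta,\theta)=\frac{c_sk}2\sum_{j=-N^-}^{N^+}e^{sy_j}(w^M(\widetilde\eta,t_j),\theta)_D.$$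
   Formalization: The quadrature spacing is restricted to 0 < k ≤ k0 with k0 > 0 arbitrary, and C may depend on k0; uniformity over all k > 0 is false, since for η = θ = 1_D and fixed M, N^± the j = 0 term grows linearly in k. *)

theory Defs
  imports "HOL-Analysis.Analysis"
begin

text \<open>
  Near each boundary point, after a rotation making \<open>e\<close> the vertical direction, the set is the
  strict epigraph of a Lipschitz function of the component orthogonal to \<open>e\<close>. By Lipschitz
  extension it is no restriction to take \<open>g\<close> globally defined.
\<close>

definition lipschitz_boundary :: "'a::euclidean_space set \<Rightarrow> bool" where
  "lipschitz_boundary D \<longleftrightarrow>
    (\<forall>x0 \<in> frontier D. \<exists>U e g L.
        open U \<and> x0 \<in> U \<and> norm e = 1 \<and> L-lipschitz_on UNIV (g :: 'a \<Rightarrow> real) \<and>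
        D \<inter> U = {x \<in> U. g (x - (x \<bullet> e) *\<^sub>R e) < x \<bullet> e})"

definition polygonal_domain :: "'a::euclidean_space set \<Rightarrow> bool" where
  "polygonal_domain D \<longleftrightarrow>
    open D \<and> connected D \<and> D \<noteq> {} \<and>
    (\<exists>\<P>. finite \<P> \<and> (\<forall>P \<in> \<P>. polytope P) \<and> closure D = \<Union>\<P>)"

definition trunc_domain :: "'a::euclidean_space set \<Rightarrow> real \<Rightarrow> real \<Rightarrow> 'a set" where
  "trunc_domain \<Omega> M t =
    (if t \<ge> 1 then (\<lambda>x. (1 + t * (1 + M)) *\<^sub>R x) ` \<Omega> else (\<lambda>x. (2 + M) *\<^sub>R x) ` \<Omega>)"

definition boundary_layer :: "'a::euclidean_space set \<Rightarrow> real \<Rightarrow> real \<Rightarrow> 'a set" where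
  "boundary_layer \<Omega> M t =
    {x \<in> trunc_domain \<Omega> M t. infdist x (frontier (trunc_domain \<Omega> M t)) < t}"

text \<open>
  Functions on \<open>S\<close> are represented by total functions whose values outside \<open>S\<close> are irrelevant;
  elements of the spaces below are representatives, not classes modulo null sets.
\<close>

definition L2_space :: "'a::euclidean_space set \<Rightarrow> ('a \<Rightarrow> 'b::euclidean_space) set" where
  "L2_space S =
    {f \<in> borel_measurable (lebesgue_on S). integrable (lebesgue_on S) (\<lambda>x. (norm (f x))\<^sup>2)}"

definition L2_inner ::
    "'a::euclidean_space set \<Rightarrow> ('a \<Rightarrow> 'b::euclidean_space) \<Rightarrow> ('a \<Rightarrow> 'b) \<Rightarrow> real" where
  "L2_inner S f g = (\<integral>x. f x \<bullet> g x \<partial>(lebesgue_on S))"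

definition norm_L2 :: "'a::euclidean_space set \<Rightarrow> ('a \<Rightarrow> 'b::euclidean_space) \<Rightarrow> real" where
  "norm_L2 S f = sqrt (L2_inner S f f)"

primrec Ck :: "nat \<Rightarrow> ('a::euclidean_space \<Rightarrow> real) \<Rightarrow> bool" where
  "Ck 0 f \<longleftrightarrow> continuous_on UNIV f"
| "Ck (Suc n) f \<longleftrightarrow>
    (\<forall>x. f differentiable (at x)) \<and> (\<forall>i \<in> Basis. Ck n (\<lambda>x. frechet_derivative f (at x) i))"

definition test_functions :: "'a::euclidean_space set \<Rightarrow> ('a \<Rightarrow> real) set" where
  "test_functions U =
    {\<phi>. (\<forall>n. Ck n \<phi>) \<and> compact (closure {x. \<phi> x \<noteq> 0}) \<and> closure {x. \<phi> x \<noteq> 0} \<subseteq> U}"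

definition has_weak_gradient ::
    "'a::euclidean_space set \<Rightarrow> ('a \<Rightarrow> real) \<Rightarrow> ('a \<Rightarrow> 'a) \<Rightarrow> bool" where
  "has_weak_gradient U u G \<longleftrightarrow>
    (\<forall>\<phi> \<in> test_functions U. \<forall>i \<in> Basis.
      (\<integral>x. u x * frechet_derivative \<phi> (at x) i \<partial>(lebesgue_on U)) =
      - (\<integral>x. (G x \<bullet> i) * \<phi> x \<partial>(lebesgue_on U)))"

definition H1 :: "'a::euclidean_space set \<Rightarrow> ('a \<Rightarrow> real) set" where
  "H1 U = {u \<in> L2_space U. \<exists>G \<in> L2_space U. has_weak_gradient U u G}"

text \<open>For open \<open>U\<close> and \<open>u\<close> in \<open>H1 U\<close> the choice is unique up to null sets.\<close>

definition weak_gradient :: "'a::euclidean_space set \<Rightarrow> ('a \<Rightarrow> real) \<Rightarrow> ('a \<Rightarrow> 'a)" where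
  "weak_gradient U u = (SOME G. G \<in> L2_space U \<and> has_weak_gradient U u G)"

definition dirichlet_form ::
    "'a::euclidean_space set \<Rightarrow> ('a \<Rightarrow> real) \<Rightarrow> ('a \<Rightarrow> real) \<Rightarrow> real" where
  "dirichlet_form U u \<phi> = L2_inner U (weak_gradient U u) (weak_gradient U \<phi>)"

definition norm_H1 :: "'a::euclidean_space set \<Rightarrow> ('a \<Rightarrow> real) \<Rightarrow> real" where
  "norm_H1 U u = sqrt ((norm_L2 U u)\<^sup>2 + (norm_L2 U (weak_gradient U u))\<^sup>2)"

definition H10 :: "'a::euclidean_space set \<Rightarrow> ('a \<Rightarrow> real) set" where
  "H10 U = {u \<in> H1 U. \<forall>\<epsilon>>0. \<exists>\<phi> \<in> test_functions U. norm_H1 U (\<lambda>x. u x - \<phi> x) < \<epsilon>}"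

definition ext0 :: "'a set \<Rightarrow> ('a \<Rightarrow> real) \<Rightarrow> 'a \<Rightarrow> real" where
  "ext0 D \<eta> = (\<lambda>x. if x \<in> D then \<eta> x else 0)"

definition solves_full ::
    "'a::euclidean_space set \<Rightarrow> ('a \<Rightarrow> real) \<Rightarrow> real \<Rightarrow> ('a \<Rightarrow> real) \<Rightarrow> bool" where
  "solves_full D \<eta> t u \<longleftrightarrow>
    u \<in> H1 UNIV \<and>
    (\<forall>\<phi> \<in> H1 UNIV.
      L2_inner UNIV u \<phi> + t\<^sup>2 * dirichlet_form UNIV u \<phi> = - L2_inner UNIV (ext0 D \<eta>) \<phi>)"

definition solves_trunc ::
    "'a::euclidean_space set \<Rightarrow> 'a set \<Rightarrow> real \<Rightarrow> ('a \<Rightarrow> real) \<Rightarrow> real \<Rightarrow> ('a \<Rightarrow> real) \<Rightarrow> bool"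
  where
  "solves_trunc D \<Omega> M \<eta> t u \<longleftrightarrow>
    u \<in> H10 (trunc_domain \<Omega> M t) \<and>
    (\<forall>\<phi> \<in> H10 (trunc_domain \<Omega> M t).
      L2_inner (trunc_domain \<Omega> M t) u \<phi> + t\<^sup>2 * dirichlet_form (trunc_domain \<Omega> M t) u \<phi> =
      - L2_inner D \<eta> \<phi>)"

text \<open>
  The forms \<open>a^k\<close> and \<open>a^{k,M}\<close> differ only in the solution operator, so both are instances of
  \<open>quad_form\<close>: with \<open>v\<close> for the former and with \<open>v\<^sup>M\<close> for the latter. An operator \<open>v\<close> takes the
  zero extension of the datum and the parameter \<open>t\<close>.
\<close>

definition w_op ::
    "'a set \<Rightarrow> (('a \<Rightarrow> real) \<Rightarrow> real \<Rightarrow> 'a \<Rightarrow> real) \<Rightarrow> ('a \<Rightarrow> real) \<Rightarrow> real \<Rightarrow> 'a \<Rightarrow> real" where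
  "w_op D v \<eta> t = (\<lambda>x. ext0 D \<eta> x + v (ext0 D \<eta>) t x)"

definition quad_form ::
    "'a::euclidean_space set \<Rightarrow> (('a \<Rightarrow> real) \<Rightarrow> real \<Rightarrow> 'a \<Rightarrow> real) \<Rightarrow>
     real \<Rightarrow> real \<Rightarrow> nat \<Rightarrow> nat \<Rightarrow> ('a \<Rightarrow> real) \<Rightarrow> ('a \<Rightarrow> real) \<Rightarrow> real" where
  "quad_form D v s k Nm Np \<eta> \<theta> =
    (let c\<^sub>s = 2 * sin (pi * s) / pi;
         y = (\<lambda>j::int. of_int j * k);
         \<tau> = (\<lambda>j. exp (- y j / 2))
     in c\<^sub>s * k / 2 * (\<Sum>j = - int Nm..int Np. exp (s * y j) * L2_inner D (w_op D v \<eta> (\<tau> j)) \<theta>))"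

definition decay_estimate ::
    "'a::euclidean_space set \<Rightarrow> 'a set \<Rightarrow> (('a \<Rightarrow> real) \<Rightarrow> real \<Rightarrow> 'a \<Rightarrow> real) \<Rightarrow>
     real \<Rightarrow> real \<Rightarrow> bool" where
  "decay_estimate D \<Omega> v c C \<longleftrightarrow>
    (\<forall>M>0. \<forall>t>0. \<forall>\<eta> \<in> L2_space D.
      t * norm_L2 (boundary_layer \<Omega> M t) (weak_gradient UNIV (v (ext0 D \<eta>) t))
        + norm_L2 (boundary_layer \<Omega> M t) (v (ext0 D \<eta>) t)
      \<le> C * exp (- (max 1 t * c * M / t)) * norm_L2 D \<eta>)"

end

(*
  Fix eta and t, put U = Omega^M(t), and let e = v - v^M on U. Both equations hold for test functions
  supported in U, so e is orthogonal to them for the form (e,phi)_U + t^2 d_U(e,phi), hence to v^M and,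
  by mollification, to zeta v for a smooth cutoff zeta with compact support in U, equal to 1 off the
  boundary layer B^M(t) and with gradient at most 4/t. Hence the energy of e is at most that of
  (1 - zeta) v, which lives in B^M(t) and is controlled by the decay estimate. With
  exp(y/2) >= 1 + y/2 and c M > 2 (s + 1), the j-th quadrature weight times the decay factor is at most
  exp(-c M) exp(-s |y_j|), which sums to O(1/k) exp(-c M).

  Only weak convergence of the mollifications is needed, because the limit is taken against the fixed e.
*)

theory Submission
  imports Defs
begin

section \<open>The spaces $L^2(S)$\<close>

text \<open>The obstacle is that \<zeta> v, although it vanishes near the boundary of U, is not
  visibly a member of \<open>H10 U\<close>, which is a norm closure of test functions. Orthogonality
  of e is therefore shown against test functions only and extended in two different ways: by
  density, straight from the definition of \<open>H10\<close>, for v^M, and by weak limits for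
  \<zeta> v. The weak limits rest on L1 convergence for bounded supports together with a uniform L2
  bound, which is cheaper than L2 convergence of mollifications.

  A second obstacle is that \<open>weak_gradient\<close> is an arbitrary choice among
  representatives. Each explicit gradient (of a test function, of a difference) has to be matched
  with the chosen one almost everywhere, so uniqueness of weak gradients is needed; mollification
  supplies that as well.

  The gradient weight t^2 in the energy is what makes a cutoff with slope of order 1/t affordable: t
  times that slope is a fixed number, so the constant in the error bound depends neither on t nor on
  the domain.\<close>

lemma L2_measurable: "f \<in> L2_space S \<Longrightarrow> f \<in> borel_measurable (lebesgue_on S)"
  by (simp add: L2_space_def)

lemma L2_norm_integrable:
  "f \<in> L2_space S \<Longrightarrow> integrable (lebesgue_on S) (\<lambda>x. (norm (f x))\<^sup>2)"
  by (simp add: L2_space_def)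

lemma L2_inner_integrable:
  assumes "f \<in> L2_space S" "g \<in> L2_space S"
  shows "integrable (lebesgue_on S) (\<lambda>x. f x \<bullet> g x)"
proof (rule Bochner_Integration.integrable_bound)
  show "integrable (lebesgue_on S) (\<lambda>x. (norm (f x))\<^sup>2 + (norm (g x))\<^sup>2)"
    using assms by (simp add: L2_norm_integrable)
  show "(\<lambda>x. f x \<bullet> g x) \<in> borel_measurable (lebesgue_on S)"
    using assms by (intro borel_measurable_inner L2_measurable)
  have "norm (f x \<bullet> g x) \<le> norm ((norm (f x))\<^sup>2 + (norm (g x))\<^sup>2)" for x
  proof -
    have "norm (f x \<bullet> g x) \<le> norm (f x) * norm (g x)"
      by (simp add: Cauchy_Schwarz_ineq2)
    also have "\<dots> \<le> (norm (f x))\<^sup>2 + (norm (g x))\<^sup>2"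
      using sum_squares_bound[of "norm (f x)" "norm (g x)"]
        mult_nonneg_nonneg[of "norm (f x)" "norm (g x)"] norm_ge_zero[of "f x"] norm_ge_zero[of "g x"]
      by linarith
    finally show ?thesis by simp
  qed
  then show "AE x in lebesgue_on S. norm (f x \<bullet> g x) \<le> norm ((norm (f x))\<^sup>2 + (norm (g x))\<^sup>2)"
    by simp
qed

text \<open>The working criterion for membership: most closure properties below only have to supply
  measurability and an integrable majorant of the squared norm.\<close>

lemma L2_bounded_by:
  assumes "f \<in> borel_measurable (lebesgue_on S)" "integrable (lebesgue_on S) h"
    "\<And>x. (norm (f x))\<^sup>2 \<le> h x"
  shows "f \<in> L2_space S"
proof -
  have "integrable (lebesgue_on S) (\<lambda>x. (norm (f x))\<^sup>2)"
    by (rule Bochner_Integration.integrable_bound[OF assms(2)])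
      (use assms in \<open>auto intro!: AE_I2 order_trans[OF assms(3)]\<close>)
  then show ?thesis using assms by (simp add: L2_space_def)
qed

lemma L2_scaleR: "f \<in> L2_space S \<Longrightarrow> (\<lambda>x. (c::real) *\<^sub>R f x) \<in> L2_space S"
  by (auto simp: L2_space_def power_mult_distrib)

lemma L2_add:
  assumes "f \<in> L2_space S" "g \<in> L2_space S"
  shows "(\<lambda>x. f x + g x) \<in> L2_space S"
proof (rule L2_bounded_by)
  show "(\<lambda>x. f x + g x) \<in> borel_measurable (lebesgue_on S)"
    using assms by (intro borel_measurable_add L2_measurable)
  show "integrable (lebesgue_on S) (\<lambda>x. 2 * (norm (f x))\<^sup>2 + 2 * (norm (g x))\<^sup>2)"
    using assms by (simp add: L2_norm_integrable)
  show "(norm (f x + g x))\<^sup>2 \<le> 2 * (norm (f x))\<^sup>2 + 2 * (norm (g x))\<^sup>2" for x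
  proof -
    have "(norm (f x + g x))\<^sup>2 \<le> (norm (f x) + norm (g x))\<^sup>2"
      by (intro power_mono norm_triangle_ineq) simp
    also have "\<dots> \<le> 2 * (norm (f x))\<^sup>2 + 2 * (norm (g x))\<^sup>2"
      using sum_squares_bound[of "norm (f x)" "norm (g x)"] by (simp add: power2_sum)
    finally show ?thesis .
  qed
qed

lemma L2_diff:
  assumes "f \<in> L2_space S" "g \<in> L2_space S"
  shows "(\<lambda>x. f x - g x) \<in> L2_space S"
  using L2_add[OF assms(1) L2_scaleR[OF assms(2), of "-1"]] by simp

lemma L2_bounded_mult:
  fixes f :: "'a::euclidean_space \<Rightarrow> 'b::euclidean_space"
  assumes "f \<in> L2_space S" "a \<in> borel_measurable (lebesgue_on S)" "\<And>x. \<bar>a x\<bar> \<le> B"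
  shows "(\<lambda>x. a x *\<^sub>R f x) \<in> L2_space S"
proof (rule L2_bounded_by)
  show "(\<lambda>x. a x *\<^sub>R f x) \<in> borel_measurable (lebesgue_on S)"
    using assms by (simp add: borel_measurable_scaleR L2_measurable)
  show "integrable (lebesgue_on S) (\<lambda>x. B\<^sup>2 * (norm (f x))\<^sup>2)"
    using assms by (simp add: L2_norm_integrable)
  show "(norm (a x *\<^sub>R f x))\<^sup>2 \<le> B\<^sup>2 * (norm (f x))\<^sup>2" for x
    using assms(3)[of x] abs_le_square_iff[of "a x" B]
    by (auto simp: power_mult_distrib intro!: mult_right_mono)
qed

text \<open>Counterpart of \<open>L2_bounded_mult\<close> with the roles exchanged: here the bounded
  factor is the vector. The product rule needs both forms, one for \<open>\<zeta>\<close> times a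
  gradient and one for a function times \<open>grad \<zeta>\<close>.\<close>

lemma L2_mult_bounded:
  fixes f :: "'a::euclidean_space \<Rightarrow> real" and b :: "'a \<Rightarrow> 'b::euclidean_space"
  assumes "f \<in> L2_space S" "b \<in> borel_measurable (lebesgue_on S)" "\<And>x. norm (b x) \<le> B"
  shows "(\<lambda>x. f x *\<^sub>R b x) \<in> L2_space S"
proof (rule L2_bounded_by)
  show "(\<lambda>x. f x *\<^sub>R b x) \<in> borel_measurable (lebesgue_on S)"
    using assms by (simp add: borel_measurable_scaleR L2_measurable)
  show "integrable (lebesgue_on S) (\<lambda>x. B\<^sup>2 * (norm (f x))\<^sup>2)"
    using L2_norm_integrable[OF assms(1)] by (rule integrable_mult_right)
  show "(norm (f x *\<^sub>R b x))\<^sup>2 \<le> B\<^sup>2 * (norm (f x))\<^sup>2" for x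
    using power_mono[OF assms(3)[of x], of 2]
    by (simp add: power_mult_distrib mult.commute[of "(f x)\<^sup>2"] mult_right_mono)
qed

lemma L2_component:
  assumes "f \<in> L2_space S"
  shows "(\<lambda>x. f x \<bullet> i) \<in> L2_space S"
proof (rule L2_bounded_by)
  show "(\<lambda>x. f x \<bullet> i) \<in> borel_measurable (lebesgue_on S)"
    using assms by (intro borel_measurable_inner L2_measurable borel_measurable_const)
  show "integrable (lebesgue_on S) (\<lambda>x. (norm i)\<^sup>2 * (norm (f x))\<^sup>2)"
    using assms by (simp add: L2_norm_integrable)
  show "(norm (f x \<bullet> i))\<^sup>2 \<le> (norm i)\<^sup>2 * (norm (f x))\<^sup>2" for x
    using power_mono[OF Cauchy_Schwarz_ineq2[of "f x" i], of 2]
    by (simp add: power_mult_distrib mult.commute)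
qed

lemma L2_restrict:
  assumes "f \<in> L2_space T" "S \<subseteq> T" "S \<in> sets lebesgue" "T \<in> sets lebesgue"
  shows "f \<in> L2_space S"
proof -
  have m: "f \<in> borel_measurable (lebesgue_on S)"
    using assms by (auto simp: L2_space_def intro: measurable_restrict_mono)
  have "integrable lebesgue (\<lambda>x. indicator T x *\<^sub>R (norm (f x))\<^sup>2)"
    using L2_norm_integrable[OF assms(1)] assms(4) by (subst (asm) integrable_restrict_space) auto
  then have "integrable lebesgue (\<lambda>x. indicator S x *\<^sub>R (indicator T x *\<^sub>R (norm (f x))\<^sup>2))"
    by (rule integrable_mult_indicator[OF assms(3)])
  also have "(\<lambda>x. indicator S x *\<^sub>R (indicator T x *\<^sub>R (norm (f x))\<^sup>2)) =
      (\<lambda>x. indicator S x *\<^sub>R (norm (f x))\<^sup>2)"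
    using assms(2) by (auto simp: indicator_def fun_eq_iff)
  finally show ?thesis using m assms by (simp add: L2_space_def integrable_restrict_space)
qed

lemma L2_inner_commute: "L2_inner S f g = L2_inner S g f"
  by (simp add: L2_inner_def inner_commute)

lemma L2_inner_self_nonneg: "0 \<le> L2_inner S f f"
  by (simp add: L2_inner_def)

lemma norm_L2_nonneg [simp]: "0 \<le> norm_L2 S f"
  by (simp add: norm_L2_def L2_inner_self_nonneg)

lemma norm_L2_sq: "(norm_L2 S f)\<^sup>2 = L2_inner S f f"
  by (simp add: norm_L2_def L2_inner_self_nonneg)

lemma L2_inner_diff_left:
  assumes "f \<in> L2_space S" "g \<in> L2_space S" "h \<in> L2_space S"
  shows "L2_inner S (\<lambda>x. f x - g x) h = L2_inner S f h - L2_inner S g h"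
  using assms unfolding L2_inner_def
  by (simp add: inner_diff_left L2_inner_integrable)

lemma L2_inner_diff_right:
  assumes "f \<in> L2_space S" "g \<in> L2_space S" "h \<in> L2_space S"
  shows "L2_inner S h (\<lambda>x. f x - g x) = L2_inner S h f - L2_inner S h g"
  using L2_inner_diff_left[OF assms] by (simp add: L2_inner_commute)

lemma L2_inner_add_left:
  assumes "f \<in> L2_space S" "g \<in> L2_space S" "h \<in> L2_space S"
  shows "L2_inner S (\<lambda>x. f x + g x) h = L2_inner S f h + L2_inner S g h"
  using assms unfolding L2_inner_def
  by (simp add: inner_add_left L2_inner_integrable)

text \<open>Gradients chosen by \<open>SOME\<close> are determined only up to null sets; this is how
  an explicit gradient replaces the chosen one inside an inner product.\<close>

lemma L2_inner_cong_AE: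
  assumes "AE x in lebesgue_on S. f x = f' x" "AE x in lebesgue_on S. g x = g' x"
    "f \<in> L2_space S" "f' \<in> L2_space S" "g \<in> L2_space S" "g' \<in> L2_space S"
  shows "L2_inner S f g = L2_inner S f' g'"
  unfolding L2_inner_def
proof (rule integral_cong_AE)
  show "(\<lambda>x. f x \<bullet> g x) \<in> borel_measurable (lebesgue_on S)"
    "(\<lambda>x. f' x \<bullet> g' x) \<in> borel_measurable (lebesgue_on S)"
    using assms by (simp_all add: borel_measurable_inner L2_measurable)
  show "AE x in lebesgue_on S. f x \<bullet> g x = f' x \<bullet> g' x"
    using assms(1,2) by eventually_elim simp
qed

lemma L2_inner_indicator:
  assumes "S \<in> sets lebesgue"
  shows "L2_inner S f g = (\<integral>x. indicator S x * (f x \<bullet> g x) \<partial>lebesgue)"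
  unfolding L2_inner_def by (subst integral_restrict_space) (use assms in auto)

lemma L2_inner_mono_set:
  assumes "f \<in> L2_space T" "S \<subseteq> T" "S \<in> sets lebesgue" "T \<in> sets lebesgue"
  shows "L2_inner S f f \<le> L2_inner T f f"
proof -
  have "f \<in> L2_space S" using assms by (rule L2_restrict)
  then show ?thesis
    using assms unfolding L2_inner_indicator[OF assms(3)] L2_inner_indicator[OF assms(4)]
    by (intro integral_mono)
      (auto simp: L2_space_def integrable_restrict_space power2_norm_eq_inner indicator_def)
qed

lemma norm_L2_mono_set:
  assumes "f \<in> L2_space T" "S \<subseteq> T" "S \<in> sets lebesgue" "T \<in> sets lebesgue"
  shows "norm_L2 S f \<le> norm_L2 T f"
  using L2_inner_mono_set[OF assms] by (simp add: norm_L2_def)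

text \<open>The quadratic polynomial in \<open>r\<close> given by the square norm of
  \<open>f - r g\<close> is nonnegative. As \<open>L2_inner\<close> is only positive semidefinite on
  representatives, \<open>?B = 0\<close> does not mean \<open>g = 0\<close> and is a case of its
  own.\<close>

lemma L2_Cauchy_Schwarz:
  assumes f: "f \<in> L2_space S" and g: "g \<in> L2_space S"
  shows "\<bar>L2_inner S f g\<bar> \<le> norm_L2 S f * norm_L2 S g"
proof -
  let ?A = "L2_inner S f f" and ?B = "L2_inner S g g" and ?I = "L2_inner S f g"
  have q: "0 \<le> ?A - 2 * r * ?I + r\<^sup>2 * ?B" for r
  proof -
    have rg: "(\<lambda>x. r *\<^sub>R g x) \<in> L2_space S" by (rule L2_scaleR[OF g])
    have fr: "(\<lambda>x. f x - r *\<^sub>R g x) \<in> L2_space S" by (rule L2_diff[OF f rg])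
    have "0 \<le> L2_inner S (\<lambda>x. f x - r *\<^sub>R g x) (\<lambda>x. f x - r *\<^sub>R g x)"
      by (rule L2_inner_self_nonneg)
    also have "\<dots> = ?A - 2 * r * ?I + r\<^sup>2 * ?B"
    proof -
      have [simp]: "L2_inner S (\<lambda>x. r *\<^sub>R g x) h = r * L2_inner S g h" for h
        by (simp add: L2_inner_def)
      have [simp]: "L2_inner S h (\<lambda>x. r *\<^sub>R g x) = r * L2_inner S g h" for h
        by (subst L2_inner_commute) simp
      show ?thesis
        by (simp add: L2_inner_diff_left L2_inner_diff_right f g rg fr L2_inner_commute[of S g f]
            power2_eq_square algebra_simps)
    qed
    finally show ?thesis .
  qed
  have "?I\<^sup>2 \<le> ?A * ?B"
  proof (cases "?B = 0")
    case True
    have "?I = 0"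
    proof (rule ccontr)
      assume "?I \<noteq> 0"
      \<comment> \<open>With \<open>?B = 0\<close> the polynomial is affine in \<open>r\<close>, and
        this \<open>r\<close> gives it the value -1.\<close>
      then show False using q[of "(?A + 1) / (2 * ?I)"] True by simp
    qed
    then show ?thesis using True by simp
  next
    case False
    then have "?B > 0" using L2_inner_self_nonneg[of S g] by simp
    \<comment> \<open>The minimiser of the polynomial.\<close>
    then show ?thesis using q[of "?I / ?B"]
      by (simp add: power2_eq_square field_simps)
  qed
  also have "\<dots> = (norm_L2 S f * norm_L2 S g)\<^sup>2"
    by (simp add: power_mult_distrib norm_L2_sq)
  finally have "\<bar>?I\<bar>\<^sup>2 \<le> (norm_L2 S f * norm_L2 S g)\<^sup>2" by simp
  then show ?thesis by (rule power2_le_imp_le) simp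
qed

section \<open>Smooth functions\<close>

definition pd :: "'a::euclidean_space \<Rightarrow> ('a \<Rightarrow> real) \<Rightarrow> 'a \<Rightarrow> real" where
  "pd i f = (\<lambda>x. frechet_derivative f (at x) i)"

definition smooth :: "('a::euclidean_space \<Rightarrow> real) \<Rightarrow> bool" where
  "smooth f \<longleftrightarrow> (\<forall>n. Ck n f)"

lemma pd_eqI: "(f has_derivative f') (at x) \<Longrightarrow> pd i f x = f' i"
  by (metis frechet_derivative_at pd_def)

lemma smooth_differentiable: "smooth f \<Longrightarrow> f differentiable (at x)"
  unfolding smooth_def by (metis Ck.simps(2))

lemma smooth_pd: "smooth f \<Longrightarrow> i \<in> Basis \<Longrightarrow> smooth (pd i f)"
  unfolding smooth_def pd_def by (metis Ck.simps(2))

lemma smooth_continuous: "smooth f \<Longrightarrow> continuous_on S f"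
  unfolding smooth_def by (metis Ck.simps(1) continuous_on_subset subset_UNIV)

lemma smooth_has_derivative: "smooth f \<Longrightarrow> (f has_derivative (\<lambda>h. \<Sum>i\<in>Basis. (h \<bullet> i) * pd i f x)) (at x)"
proof -
  assume "smooth f"
  then have d: "(f has_derivative frechet_derivative f (at x)) (at x)"
    using smooth_differentiable frechet_derivative_works by blast
  interpret linear "frechet_derivative f (at x)" using d by (rule has_derivative_linear)
  have "frechet_derivative f (at x) = (\<lambda>h. \<Sum>i\<in>Basis. (h \<bullet> i) * pd i f x)"
  proof
    fix h :: 'a
    have "frechet_derivative f (at x) h = frechet_derivative f (at x) (\<Sum>i\<in>Basis. (h \<bullet> i) *\<^sub>R i)"
      by (simp only: euclidean_representation)
    then show "frechet_derivative f (at x) h = (\<Sum>i\<in>Basis. (h \<bullet> i) * pd i f x)"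
      by (simp add: sum scale pd_def)
  qed
  then show ?thesis using d by simp
qed

text \<open>A coinduction principle. The induction on the order leaves \<open>f\<close> arbitrary in
  \<open>F\<close>, because order \<open>Suc n\<close> of \<open>f\<close> asks for order
  \<open>n\<close> of its partial derivatives, which are other members of \<open>F\<close>.\<close>

lemma smoothI:
  assumes "f \<in> F" "\<And>f x. f \<in> F \<Longrightarrow> f differentiable (at x)" "\<And>f i. f \<in> F \<Longrightarrow> i \<in> Basis \<Longrightarrow> pd i f \<in> F"
  shows "smooth f"
proof -
  have "Ck n f" for n
    using assms(1)
  proof (induction n arbitrary: f)
    case 0
    then show ?case using assms(2)
      by (auto intro!: differentiable_imp_continuous_on simp: differentiable_on_def differentiable_at_withinI)
  next
    case (Suc n)
    then show ?case using assms(2,3) by (auto simp flip: pd_def)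
  qed
  then show ?thesis by (simp add: smooth_def)
qed

text \<open>The algebra generated by \<open>G\<close> and the constants. It is the smallest class in
  which the product rule can be iterated without computing higher derivatives.\<close>

inductive_set function_algebra :: "('a \<Rightarrow> real) set \<Rightarrow> ('a \<Rightarrow> real) set" for G where
  gen: "g \<in> G \<Longrightarrow> g \<in> function_algebra G"
| const: "(\<lambda>x. c) \<in> function_algebra G"
| add: "f \<in> function_algebra G \<Longrightarrow> g \<in> function_algebra G \<Longrightarrow> (\<lambda>x. f x + g x) \<in> function_algebra G"
| mult: "f \<in> function_algebra G \<Longrightarrow> g \<in> function_algebra G \<Longrightarrow> (\<lambda>x. f x * g x) \<in> function_algebra G"

lemma pd_add:
  assumes "f differentiable (at x)" "g differentiable (at x)"
  shows "pd i (\<lambda>x. f x + g x) x = pd i f x + pd i g x"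
  unfolding pd_def[of i f] pd_def[of i g]
  by (rule pd_eqI) (intro has_derivative_add assms[unfolded frechet_derivative_works])

lemma pd_mult:
  assumes "f differentiable (at x)" "g differentiable (at x)"
  shows "pd i (\<lambda>x. f x * g x) x = f x * pd i g x + pd i f x * g x"
  unfolding pd_def[of i f] pd_def[of i g]
  by (rule pd_eqI) (intro has_derivative_mult assms[unfolded frechet_derivative_works])

text \<open>By the sum and product rules only generators need to be checked. Their partial
  derivatives may leave \<open>G\<close> as long as they stay in the algebra; this is the freedom
  that the bump function uses.\<close>

lemma function_algebra_smooth:
  assumes G: "\<And>g x. g \<in> G \<Longrightarrow> g differentiable (at x)"
    "\<And>g i. g \<in> G \<Longrightarrow> i \<in> Basis \<Longrightarrow> pd i g \<in> function_algebra G"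
    and f: "f \<in> function_algebra G"
  shows "smooth f"
proof (rule smoothI[OF f])
  show d: "f differentiable (at x)" if "f \<in> function_algebra G" for f x
    using that by induction (auto intro: G)
  show "pd i f \<in> function_algebra G" if "f \<in> function_algebra G" and i: "i \<in> Basis" for f i
    using that(1)
  proof induction
    case (const c)
    have "pd i (\<lambda>x. c) = (\<lambda>x. 0)" by (rule ext, rule pd_eqI) simp
    then show ?case by (simp add: function_algebra.const)
  next
    case (add f g)
    then have "pd i (\<lambda>x. f x + g x) = (\<lambda>x. pd i f x + pd i g x)"
      by (intro ext pd_add d)
    then show ?case using add by (simp add: function_algebra.add)
  next
    case (mult f g)
    then have "pd i (\<lambda>x. f x * g x) = (\<lambda>x. f x * pd i g x + pd i f x * g x)"
      by (intro ext pd_mult d)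
    then show ?case using mult by (simp add: function_algebra.add function_algebra.mult)
  qed (use G i in auto)
qed

lemma smooth_algebra: "f \<in> function_algebra {g. smooth g} \<Longrightarrow> smooth f"
  by (rule function_algebra_smooth[of "{g. smooth g}"])
    (auto intro: smooth_differentiable smooth_pd function_algebra.gen)

lemma smooth_const: "smooth (\<lambda>x. c)"
  by (intro smooth_algebra function_algebra.const)

lemma smooth_mult: "smooth f \<Longrightarrow> smooth g \<Longrightarrow> smooth (\<lambda>x. f x * g x)"
  by (intro smooth_algebra function_algebra.mult function_algebra.gen) auto

section \<open>The flat exponential and smooth bumps\<close>

definition flat :: "nat \<Rightarrow> real \<Rightarrow> real" where
  "flat n s = (if s > 0 then exp (- 1 / s) / s ^ n else 0)"

lemma flat_nonneg: "0 \<le> flat n s"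
  by (simp add: flat_def)

text \<open>A single term of the exponential series, that of order \<open>n + 2\<close>, bounds
  \<open>exp (1/s)\<close> from below. After division by \<open>s ^ n\<close> two powers of
  \<open>s\<close> remain: one for the difference quotient at 0 and one to make it tend to
  0.\<close>

lemma flat_le: "\<bar>flat n s\<bar> \<le> fact (n + 2) * s\<^sup>2"
proof (cases "s > 0")
  case True
  have "(1/s) ^ (n+2) / fact (n+2) \<le> exp (1/s)"
  proof -
    have "(\<Sum>k\<in>{n+2}. (1/s)^k /\<^sub>R fact k) \<le> (\<Sum>k. (1/s)^k /\<^sub>R fact k)"
      using True by (intro sum_le_suminf summable_exp_generic) auto
    then show ?thesis by (simp add: exp_def divide_inverse mult.commute)
  qed
  then have "inverse (exp (1/s)) \<le> inverse ((1/s) ^ (n+2) / fact (n+2))"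
    using True by (intro le_imp_inverse_le) (auto simp del: fact_Suc power_Suc)
  then have "exp (- 1 / s) \<le> fact (n+2) * s ^ (n+2)"
    by (simp add: exp_minus power_one_over mult.commute del: fact_Suc power_Suc)
  also have "fact (n+2) * s ^ (n+2) = (fact (n+2) * s\<^sup>2) * s ^ n"
    by (simp only: power_add mult_ac)
  finally have "exp (- 1 / s) / s ^ n \<le> fact (n+2) * s\<^sup>2"
    using True by (simp only: pos_divide_le_eq zero_less_power)
  then show ?thesis using True by (simp add: flat_def del: fact_Suc)
qed (simp add: flat_def del: fact_Suc)

text \<open>The powers of \<open>s\<close> in the denominator are part of \<open>flat\<close>
  because differentiating \<open>exp (- 1 / s) / s ^ n\<close> raises them by two and by one; with
  them the family is closed under differentiation up to linear combinations. At 0 the quadratic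
  bound \<open>flat_le\<close> makes the difference quotient vanish in the limit.\<close>

lemma flat_has_derivative:
  "(flat n has_real_derivative (flat (n + 2) s - real n * flat (n + 1) s)) (at s)"
proof -
  consider "s > 0" | "s < 0" | "s = 0" by linarith
  then show ?thesis
  proof cases
    case 1
    have e: "((\<lambda>s. exp (- inverse s)) has_real_derivative exp (- inverse s) * (inverse s)\<^sup>2) (at s)"
      using 1 by (auto intro!: derivative_eq_intros simp: power2_eq_square)
    have "((\<lambda>s. inverse s ^ n) has_real_derivative - (real n * inverse s ^ (n + 1))) (at s)"
    proof (cases n)
      case (Suc m)
      from DERIV_power_Suc[OF DERIV_inverse[of s UNIV], of m] 1 show ?thesis
        by (simp add: Suc algebra_simps)
    qed simp
    from DERIV_mult[OF e this]
    have "((\<lambda>s. exp (- 1 / s) / s ^ n) has_real_derivative (flat (n + 2) s - real n * flat (n + 1) s)) (at s)"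
      using 1 by (simp add: flat_def divide_inverse power_inverse power2_eq_square algebra_simps)
    then show ?thesis
      by (rule has_field_derivative_transform_within_open[where S="{0<..}"]) (use 1 in \<open>auto simp: flat_def\<close>)
  next
    case 2
    have "((\<lambda>s. 0) has_real_derivative (flat (n + 2) s - real n * flat (n + 1) s)) (at s)"
      using 2 by (simp add: flat_def)
    then show ?thesis
      by (rule has_field_derivative_transform_within_open[where S="{..<0}"]) (use 2 in \<open>auto simp: flat_def\<close>)
  next
    case 3
    have "(\<lambda>h. flat n h / h) \<midarrow>0\<rightarrow> 0"
    proof (rule Lim_null_comparison)
      show "\<forall>\<^sub>F h in at 0. norm (flat n h / h) \<le> fact (n + 2) * \<bar>h\<bar>"
      proof (rule eventually_at_filter[THEN iffD2], rule always_eventually, safe)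
        fix h :: real assume "h \<noteq> 0"
        then show "norm (flat n h / h) \<le> fact (n + 2) * \<bar>h\<bar>"
          using flat_le[of n h] power2_abs[of h]
          by (simp add: divide_le_eq power2_eq_square mult_ac del: fact_Suc)
      qed
      show "(\<lambda>h. fact (n + 2) * \<bar>h\<bar>) \<midarrow>0\<rightarrow> (0::real)"
        by (auto intro!: tendsto_eq_intros)
    qed
    then show ?thesis using 3 by (simp add: DERIV_def flat_def)
  qed
qed

lemma bump_smooth:
  fixes r :: real
  shows "smooth (\<lambda>x::'a::euclidean_space. flat 0 (r - x \<bullet> x))"
proof -
  \<comment> \<open>The coordinate functions join the generators because the chain rule brings out
    the inner derivative \<open>- 2 * (x \<bullet> i)\<close>.\<close>
  define G :: "('a \<Rightarrow> real) set" where
    "G = range (\<lambda>n x. flat n (r - x \<bullet> x)) \<union> range (\<lambda>i x. x \<bullet> i)"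
  have d1: "((\<lambda>x. flat n (r - x \<bullet> x)) has_derivative
      (\<lambda>h. - (flat (n + 2) (r - x \<bullet> x) - real n * flat (n + 1) (r - x \<bullet> x)) * (2 * (x \<bullet> h)))) (at x)"
    for n and x :: 'a
  proof -
    have "((\<lambda>x. r - x \<bullet> x) has_derivative (\<lambda>h. - (2 * (x \<bullet> h)))) (at x)"
      by (auto intro!: derivative_eq_intros simp: inner_commute)
    from has_derivative_compose[OF this flat_has_derivative[of n, unfolded has_field_derivative_def]]
    show ?thesis by (simp add: algebra_simps)
  qed
  have d2: "((\<lambda>x. x \<bullet> i) has_derivative (\<lambda>h. h \<bullet> i)) (at x)" for i x :: 'a
    by (auto intro!: derivative_eq_intros)
  show ?thesis
  proof (rule function_algebra_smooth[of G])
    show "g differentiable (at x)" if "g \<in> G" for g x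
      using that d1 by (auto simp: G_def differentiable_def intro: d2)
    show "pd i g \<in> function_algebra G" if "g \<in> G" "i \<in> Basis" for g i
    proof -
      have fl: "(\<lambda>x. flat n (r - x \<bullet> x)) \<in> function_algebra G" for n
        by (rule function_algebra.gen) (auto simp: G_def)
      have co: "(\<lambda>x. x \<bullet> i) \<in> function_algebra G" for i
        by (rule function_algebra.gen) (auto simp: G_def)
      from \<open>g \<in> G\<close> consider n where "g = (\<lambda>x. flat n (r - x \<bullet> x))" | j where "g = (\<lambda>x. x \<bullet> j)"
        by (auto simp: G_def)
      then show ?thesis
      proof cases
        case 1
        have "pd i g = (\<lambda>x. (flat (n + 2) (r - x \<bullet> x) + (- real n) * flat (n + 1) (r - x \<bullet> x)) * ((- 2) * (x \<bullet> i)))"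
        proof
          fix x
          show "pd i g x = (flat (n + 2) (r - x \<bullet> x) + (- real n) * flat (n + 1) (r - x \<bullet> x)) * ((- 2) * (x \<bullet> i))"
            using pd_eqI[OF d1[of n x], of i] by (simp add: 1 algebra_simps)
        qed
        then show ?thesis
          by (simp only:) (intro function_algebra.mult function_algebra.add function_algebra.const fl co)
      next
        case 2
        have "pd i g = (\<lambda>x. i \<bullet> j)" using pd_eqI[OF d2[of j], of i] by (simp add: 2 fun_eq_iff)
        then show ?thesis by (simp add: function_algebra.const)
      qed
    qed
    show "(\<lambda>x. flat 0 (r - x \<bullet> x)) \<in> function_algebra G"
      by (rule function_algebra.gen) (auto simp: G_def)
  qed
qed

section \<open>Mollifiers and convolution\<close>

lemma lborel_distr_reflect:
  fixes a :: "'a::euclidean_space"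
  shows "distr lborel borel (\<lambda>x. a - x) = lborel"
proof -
  have "lborel = density (distr lborel borel (\<lambda>x. a - x)) (\<lambda>_. 1)"
    using lborel_affine[of "-1" a] by simp
  then show ?thesis by (simp add: density_1)
qed

lemma lborel_distr_translate:
  fixes a :: "'a::euclidean_space"
  shows "distr lborel borel (\<lambda>x. x - a) = lborel"
proof -
  have "(\<lambda>x. x - a) = (+) (- a)" by (rule ext) simp
  then show ?thesis using lborel_distr_plus[of "- a"] by (simp only:)
qed

text \<open>For Borel functions the integrals over \<open>lebesgue\<close> and \<open>lborel\<close>
  coincide, so the affine change of variables with factor -1, whose Jacobian has modulus 1, can be
  made over \<open>lborel\<close>.\<close>

lemma integral_lebesgue_reflect:
  fixes f :: "'a::euclidean_space \<Rightarrow> real"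
  assumes [measurable]: "f \<in> borel_measurable borel"
  shows "(\<integral>x. f (a - x) \<partial>lebesgue) = (\<integral>x. f x \<partial>lebesgue)"
proof -
  have "(\<integral>x. f x \<partial>lborel) = (\<integral>x. f x \<partial>distr lborel borel (\<lambda>x. a - x))"
    by (simp add: lborel_distr_reflect)
  also have "\<dots> = (\<integral>x. f (a - x) \<partial>lborel)"
    by (subst integral_distr) auto
  finally show ?thesis by (simp add: integral_completion)
qed

lemma integrable_lebesgue_reflect:
  fixes f :: "'a::euclidean_space \<Rightarrow> real"
  assumes [measurable]: "f \<in> borel_measurable borel" and "integrable lebesgue f"
  shows "integrable lebesgue (\<lambda>x. f (a - x))"
proof -
  have "integrable (distr lborel borel (\<lambda>x. a - x)) f"
    using assms(2) by (simp add: lborel_distr_reflect integrable_completion)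
  then show ?thesis by (simp add: integrable_distr_eq integrable_completion)
qed

lemma bounded_subset_cball_0:
  fixes S :: "'a::real_normed_vector set"
  shows "bounded S \<Longrightarrow> \<exists>R. S \<subseteq> cball 0 R"
  by (fastforce simp: bounded_iff)

lemma support_subset_cball:
  fixes f :: "'a::real_normed_vector \<Rightarrow> real"
  shows "(\<And>x. r \<le> norm x \<Longrightarrow> f x = 0) \<Longrightarrow> {x. f x \<noteq> 0} \<subseteq> cball 0 r"
  by (auto intro: ccontr)

lemma integrable_bounded_support:
  fixes f :: "'a::euclidean_space \<Rightarrow> real"
  assumes "continuous_on UNIV f" "bounded {x. f x \<noteq> 0}"
  shows "integrable lebesgue f"
proof -
  obtain R where R: "{x. f x \<noteq> 0} \<subseteq> cball 0 R"
    using bounded_subset_cball_0[OF assms(2)] by blast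
  have "integrable lborel (\<lambda>x. indicator (cball 0 R) x *\<^sub>R f x)"
    using assms(1) by (intro borel_integrable_compact) (auto intro: continuous_on_subset)
  also have "(\<lambda>x. indicator (cball 0 R) x *\<^sub>R f x) = f"
    using R by (auto simp: indicator_def fun_eq_iff)
  finally show ?thesis
    using assms(1) by (simp add: integrable_completion borel_measurable_continuous_onI)
qed

lemma bounded_support_bounded:
  fixes f :: "'a::euclidean_space \<Rightarrow> real"
  assumes "continuous_on UNIV f" "bounded {x. f x \<noteq> 0}"
  obtains B where "B > 0" "\<And>x. \<bar>f x\<bar> \<le> B"
proof -
  have "compact (f ` closure {x. f x \<noteq> 0})"
    using assms by (intro compact_continuous_image) (auto intro: continuous_on_subset)
  then obtain B where B: "B > 0" "\<And>x. x \<in> f ` closure {x. f x \<noteq> 0} \<Longrightarrow> norm x \<le> B"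
    using compact_imp_bounded bounded_pos by metis
  have "\<bar>f x\<bar> \<le> B" for x
  proof (cases "f x = 0")
    case False
    then have "f x \<in> f ` closure {x. f x \<noteq> 0}" using closure_subset[of "{x. f x \<noteq> 0}"] by blast
    then show ?thesis using B(2) by force
  qed (use B in simp)
  then show ?thesis using B(1) that by blast
qed

lemma bounded_support_uniformly_continuous:
  fixes f :: "'a::euclidean_space \<Rightarrow> real"
  assumes "continuous_on UNIV f" "bounded {x. f x \<noteq> 0}"
  shows "uniformly_continuous_on UNIV f"
proof -
  obtain R where R: "{x. f x \<noteq> 0} \<subseteq> cball 0 R"
    using bounded_subset_cball_0[OF assms(2)] by blast
  have uc: "uniformly_continuous_on (cball 0 (R + 1)) f"
    using assms by (intro compact_uniformly_continuous) (auto intro: continuous_on_subset)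
  show ?thesis
    unfolding uniformly_continuous_on_def
  proof safe
    fix e :: real assume "e > 0"
    then obtain d where d: "d > 0" "\<And>x y. \<lbrakk>x \<in> cball 0 (R+1); y \<in> cball 0 (R+1); dist y x < d\<rbrakk> \<Longrightarrow> dist (f y) (f x) < e"
      using uc unfolding uniformly_continuous_on_def by metis
    \<comment> \<open>The cap 1 ensures that once one of the two points lies in the ball of radius
      \<open>R\<close>, both lie in the ball of radius \<open>R + 1\<close>, where compactness gives
      uniform continuity.\<close>
    have "dist (f y) (f x) < e" if "dist y x < min d 1" for x y
    proof (cases "x \<in> cball 0 R \<or> y \<in> cball 0 R")
      case True
      then have "x \<in> cball 0 (R+1)" "y \<in> cball 0 (R+1)"
        using that norm_triangle_sub[of x y] norm_triangle_sub[of y x]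
        by (auto simp: dist_norm norm_minus_commute)
      then show ?thesis using d that by auto
    next
      case False
      then have "f x = 0" "f y = 0" using R by auto
      then show ?thesis using \<open>e > 0\<close> by simp
    qed
    then show "\<exists>d>0. \<forall>x\<in>UNIV. \<forall>x'\<in>UNIV. dist x' x < d \<longrightarrow> dist (f x') (f x) < e"
      using d(1) by (intro exI[of _ "min d 1"]) auto
  qed
qed

text \<open>Off the closure, \<open>f\<close> vanishes on a whole neighbourhood. The closure is
  essential: at an isolated zero of \<open>f\<close> a derivative can be nonzero.\<close>

lemma pd_support: "{x. pd i f x \<noteq> 0} \<subseteq> closure {x. f x \<noteq> 0}"
proof
  fix x assume x: "x \<in> {x. pd i f x \<noteq> 0}"
  show "x \<in> closure {x. f x \<noteq> 0}"
  proof (rule ccontr)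
    assume "x \<notin> closure {x. f x \<noteq> 0}"
    then have "x \<in> - closure {x. f x \<noteq> 0}" by simp
    moreover have "open (- closure {x. f x \<noteq> 0})" by (simp add: open_Compl)
    moreover have "0 = f y" if "y \<in> - closure {x. f x \<noteq> 0}" for y
      using that closure_subset[of "{x. f x \<noteq> 0}"] by auto
    ultimately have "(f has_derivative (\<lambda>h. 0)) (at x)"
      using has_derivative_transform_within_open[OF has_derivative_const[of 0]] by blast
    then show False using x pd_eqI by fastforce
  qed
qed

lemma pd_bounded_support: "bounded {x. f x \<noteq> 0} \<Longrightarrow> bounded {x. pd i f x \<noteq> 0}"
  by (rule bounded_subset[OF bounded_closure pd_support])

text \<open>Kept as a property rather than one rescaled kernel: only smoothness, sign, support
  radius \<open>r\<close> and unit mass are ever used, and no scaling identities arise.\<close>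

definition mollifier :: "real \<Rightarrow> ('a::euclidean_space \<Rightarrow> real) \<Rightarrow> bool" where
  "mollifier r \<rho> \<longleftrightarrow> smooth \<rho> \<and> (\<forall>x. 0 \<le> \<rho> x) \<and> (\<forall>x. r \<le> norm x \<longrightarrow> \<rho> x = 0) \<and>
    (\<integral>x. \<rho> x \<partial>lebesgue) = 1"

lemma mollifier_bounded_support: "mollifier r \<rho> \<Longrightarrow> bounded {x. \<rho> x \<noteq> 0}"
  by (rule bounded_subset[of "cball 0 r"], rule bounded_cball, rule support_subset_cball, simp add: mollifier_def)

text \<open>The bump \<open>flat 0 (r\<^sup>2 - x \<bullet> x)\<close> divided by its integral. The
  integral is positive since the bump is positive on an open ball, which is not a null set.\<close>

lemma ex_mollifier:
  assumes "r > 0"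
  obtains \<rho> :: "'a::euclidean_space \<Rightarrow> real" where "mollifier r \<rho>"
proof -
  define f :: "'a \<Rightarrow> real" where "f x = flat 0 (r\<^sup>2 - x \<bullet> x)" for x
  have f: "smooth f" unfolding f_def by (rule bump_smooth)
  have f0: "0 \<le> f x" for x by (simp add: f_def flat_nonneg)
  have supp: "f x = 0" if "r \<le> norm x" for x
  proof -
    have "r\<^sup>2 \<le> x \<bullet> x" using that assms by (simp add: dot_square_norm power_mono)
    then show ?thesis by (simp add: f_def flat_def)
  qed
  have pos: "f x > 0" if "norm x < r" for x
  proof -
    have "x \<bullet> x < r\<^sup>2" using that assms by (simp add: dot_square_norm power_strict_mono)
    then show ?thesis by (simp add: f_def flat_def)
  qed
  have int: "integrable lebesgue f"
    by (rule integrable_bounded_support[OF smooth_continuous[OF f]],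
        rule bounded_subset[of "cball 0 r"], rule bounded_cball, rule support_subset_cball, rule supp)
  define I where "I = (\<integral>x. f x \<partial>lebesgue)"
  have "I \<noteq> 0"
  proof
    assume "I = 0"
    then have "AE x in lebesgue. f x = 0"
      using integral_nonneg_eq_0_iff_AE[OF int] f0 by (simp add: I_def)
    then have "AE x in lebesgue. x \<notin> ball (0::'a) r"
    proof (rule AE_mp, intro AE_I2 impI)
      show "x \<notin> ball (0::'a) r" if "f x = 0" for x
        using pos[of x] that by (auto simp: less_irrefl)
    qed
    then have "ball (0::'a) r \<in> null_sets lebesgue"
      by (subst AE_iff_null_sets) auto
    then have "negligible (ball (0::'a) r)" by (simp add: negligible_iff_null_sets)
    then show False using open_not_negligible[of "ball (0::'a) r"] assms by simp
  qed
  moreover have "0 \<le> I" unfolding I_def by (rule Bochner_Integration.integral_nonneg) (rule f0)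
  ultimately have "I > 0" by simp
  have "mollifier r (\<lambda>x. f x * (1 / I))"
    unfolding mollifier_def using smooth_mult[OF f smooth_const[of "1 / I"]] f0 supp \<open>I > 0\<close>
    by (simp add: I_def)
  then show ?thesis by (rule that)
qed

text \<open>The variable \<open>x\<close> sits in the second factor, so all derivatives fall on
  \<open>\<phi>\<close> and \<open>f\<close> need only be integrable.\<close>

definition conv :: "('a::euclidean_space \<Rightarrow> real) \<Rightarrow> ('a \<Rightarrow> real) \<Rightarrow> 'a \<Rightarrow> real" where
  "conv f \<phi> x = (\<integral>y. f y * \<phi> (x - y) \<partial>lebesgue)"

lemma conv_integrable:
  fixes f \<phi> :: "'a::euclidean_space \<Rightarrow> real"
  assumes f: "integrable lebesgue f" and "continuous_on UNIV \<phi>" "bounded {x. \<phi> x \<noteq> 0}"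
  shows "integrable lebesgue (\<lambda>y. f y * \<phi> (x - y))"
proof -
  obtain B where B: "\<And>x. \<bar>\<phi> x\<bar> \<le> B" using bounded_support_bounded assms(2,3) by metis
  have c: "continuous_on UNIV (\<lambda>y. \<phi> (x - y))"
    by (rule continuous_on_compose2[OF assms(2)]) (auto intro!: continuous_intros)
  then have m: "(\<lambda>y. \<phi> (x - y)) \<in> borel_measurable lebesgue"
    by (intro measurable_completion) (simp add: borel_measurable_continuous_onI)
  show ?thesis
  proof (rule Bochner_Integration.integrable_bound)
    show "integrable lebesgue (\<lambda>y. B * f y)" using f by simp
    show "(\<lambda>y. f y * \<phi> (x - y)) \<in> borel_measurable lebesgue"
      using f m by (simp add: borel_measurable_times borel_measurable_integrable)
    show "AE y in lebesgue. norm (f y * \<phi> (x - y)) \<le> norm (B * f y)"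
    proof (rule AE_I2)
      fix y
      have "\<bar>\<phi> (x - y)\<bar> \<le> \<bar>B\<bar>" using B[of "x - y"] by simp
      then show "norm (f y * \<phi> (x - y)) \<le> norm (B * f y)"
        by (simp add: abs_mult mult.commute[of "\<bar>B\<bar>"] mult_left_mono)
    qed
  qed
qed

text \<open>Bounded support makes the partial derivatives uniformly continuous, so the mean value
  inequality on a ball around \<open>x\<close> holds with a radius independent of \<open>x\<close>.
  That uniformity is what allows the linearization to be integrated.\<close>

lemma uniform_linearization:
  assumes s: "smooth (\<phi> :: 'a::euclidean_space \<Rightarrow> real)" and b: "bounded {x. \<phi> x \<noteq> 0}" and "e > 0"
  obtains d where "d > 0"
    "\<And>x h. norm h < d \<Longrightarrow> \<bar>\<phi> (x + h) - \<phi> x - (\<Sum>i\<in>Basis. (h \<bullet> i) * pd i \<phi> x)\<bar> \<le> norm h * e"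
proof -
  \<comment> \<open>The operator norm of a difference of derivatives is estimated by the sum over
    the \<open>DIM('a)\<close> coordinates.\<close>
  let ?e = "e / DIM('a)"
  have "\<exists>d>0. \<forall>x y. dist y x < d \<longrightarrow> dist (pd i \<phi> y) (pd i \<phi> x) < ?e" if "i \<in> Basis" for i
    using bounded_support_uniformly_continuous[OF smooth_continuous[OF smooth_pd[OF s that]] pd_bounded_support[OF b]]
      \<open>e > 0\<close> unfolding uniformly_continuous_on_def by auto
  then obtain d where d: "\<And>i. i \<in> Basis \<Longrightarrow> d i > 0"
    "\<And>i x y. i \<in> Basis \<Longrightarrow> dist y x < d i \<Longrightarrow> dist (pd i \<phi> y) (pd i \<phi> x) < ?e"
    by metis
  define D where "D = Min (d ` Basis)"
  have D: "D > 0" "\<And>i. i \<in> Basis \<Longrightarrow> D \<le> d i"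
    using d(1) by (auto simp: D_def)
  have "\<bar>\<phi> (x + h) - \<phi> x - (\<Sum>i\<in>Basis. (h \<bullet> i) * pd i \<phi> x)\<bar> \<le> norm h * e" if "norm h < D" for x h
  proof -
    have "norm (\<phi> (x + h) - \<phi> x - (\<Sum>i\<in>Basis. ((x + h - x) \<bullet> i) * pd i \<phi> x)) \<le> norm (x + h - x) * e"
    proof (rule differentiable_bound_linearization[where S="ball x D"])
      show "x + t *\<^sub>R (x + h - x) \<in> ball x D" if "t \<in> {0..1}" for t
        using that \<open>norm h < D\<close> mult_left_le_one_le[of "norm h" t] by (auto simp: dist_norm)
      show "(\<phi> has_derivative (\<lambda>h. \<Sum>i\<in>Basis. (h \<bullet> i) * pd i \<phi> z)) (at z within ball x D)" for z
        by (rule has_derivative_at_withinI[OF smooth_has_derivative[OF s]])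
      show "onorm ((\<lambda>h. \<Sum>i\<in>Basis. (h \<bullet> i) * pd i \<phi> z) - (\<lambda>h. \<Sum>i\<in>Basis. (h \<bullet> i) * pd i \<phi> x)) \<le> e"
        if "z \<in> ball x D" for z
      proof (rule onorm_le)
        fix k :: 'a
        have "norm ((\<Sum>i\<in>Basis. (k \<bullet> i) * pd i \<phi> z) - (\<Sum>i\<in>Basis. (k \<bullet> i) * pd i \<phi> x)) =
            \<bar>\<Sum>i\<in>Basis. (k \<bullet> i) * (pd i \<phi> z - pd i \<phi> x)\<bar>"
          by (simp add: sum_subtractf right_diff_distrib)
        also have "\<dots> \<le> (\<Sum>i\<in>Basis. \<bar>(k \<bullet> i) * (pd i \<phi> z - pd i \<phi> x)\<bar>)" by (rule sum_abs)
        also have "\<dots> \<le> (\<Sum>i\<in>(Basis::'a set). norm k * ?e)"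
        proof (rule sum_mono)
          fix i :: 'a assume i: "i \<in> Basis"
          have "dist z x < d i" using that D(2)[OF i] by (simp add: dist_commute)
          then have "\<bar>pd i \<phi> z - pd i \<phi> x\<bar> \<le> ?e" using d(2)[OF i] by (force simp: dist_real_def)
          then show "\<bar>(k \<bullet> i) * (pd i \<phi> z - pd i \<phi> x)\<bar> \<le> norm k * ?e"
            unfolding abs_mult by (intro mult_mono Basis_le_norm i) auto
        qed
        also have "\<dots> = e * norm k" by simp
        finally show "norm (((\<lambda>h. \<Sum>i\<in>Basis. (h \<bullet> i) * pd i \<phi> z) - (\<lambda>h. \<Sum>i\<in>Basis. (h \<bullet> i) * pd i \<phi> x)) k)
            \<le> e * norm k" by simp
      qed
      show "x \<in> ball x D" using D by simp
    qed
    then show ?thesis by simp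
  qed
  then show ?thesis using D(1) that by blast
qed

text \<open>The remainder of the linearization of \<open>\<phi>\<close> is small uniformly in the
  base point, so integrating it against \<open>f\<close> costs at most the factor \<open>F\<close>,
  the L1 norm of \<open>f\<close>.\<close>

lemma conv_has_derivative:
  assumes f: "integrable lebesgue f" and s: "smooth (\<phi> :: 'a::euclidean_space \<Rightarrow> real)" and b: "bounded {x. \<phi> x \<noteq> 0}"
  shows "(conv f \<phi> has_derivative (\<lambda>h. \<Sum>i\<in>Basis. (h \<bullet> i) * conv f (pd i \<phi>) x)) (at x)"
  unfolding has_derivative_at_alt
proof (intro conjI allI impI)
  show "bounded_linear (\<lambda>h. \<Sum>i\<in>Basis. (h \<bullet> i) * conv f (pd i \<phi>) x)"
    by (intro bounded_linear_sum bounded_linear_mult_const bounded_linear_inner_left)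
  fix e :: real assume "e > 0"
  define F where "F = (\<integral>y. \<bar>f y\<bar> \<partial>lebesgue)"
  have F: "F \<ge> 0" by (simp add: F_def)
  \<comment> \<open>\<open>F + 1\<close> instead of \<open>F\<close> covers the case where
    \<open>f\<close> vanishes almost everywhere.\<close>
  obtain d where d: "d > 0"
    "\<And>x h. norm h < d \<Longrightarrow> \<bar>\<phi> (x + h) - \<phi> x - (\<Sum>i\<in>Basis. (h \<bullet> i) * pd i \<phi> x)\<bar> \<le> norm h * (e / (F + 1))"
    using uniform_linearization[OF s b, of "e / (F + 1)"] F \<open>e > 0\<close> by auto
  have i1: "integrable lebesgue (\<lambda>y. f y * \<phi> (x - y))" for x
    by (rule conv_integrable[OF f smooth_continuous[OF s] b])
  have i2: "integrable lebesgue (\<lambda>y. f y * pd i \<phi> (x - y))" if "i \<in> Basis" for i x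
    by (rule conv_integrable[OF f smooth_continuous[OF smooth_pd[OF s that]] pd_bounded_support[OF b]])
  have "norm (conv f \<phi> z - conv f \<phi> x - (\<Sum>i\<in>Basis. ((z - x) \<bullet> i) * conv f (pd i \<phi>) x)) \<le> e * norm (z - x)"
    if "norm (z - x) < d" for z
  proof -
    let ?h = "z - x"
    let ?q = "\<lambda>y. f y * (\<phi> (z - y) - \<phi> (x - y) - (\<Sum>i\<in>Basis. (?h \<bullet> i) * pd i \<phi> (x - y)))"
    have q: "?q = (\<lambda>y. f y * \<phi> (z - y) - f y * \<phi> (x - y) - (\<Sum>i\<in>Basis. (?h \<bullet> i) * (f y * pd i \<phi> (x - y))))"
      by (rule ext) (simp add: right_diff_distrib sum_distrib_left mult.left_commute)
    have iq: "integrable lebesgue ?q"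
      unfolding q using i1 i2 by (intro Bochner_Integration.integrable_diff Bochner_Integration.integrable_sum integrable_mult_right) auto
    have lin: "conv f \<phi> z - conv f \<phi> x - (\<Sum>i\<in>Basis. (?h \<bullet> i) * conv f (pd i \<phi>) x) = (\<integral>y. ?q y \<partial>lebesgue)"
      unfolding q conv_def
      by (subst Bochner_Integration.integral_diff, use i1 i2 in force, use i1 i2 in force)+
        (simp add: Bochner_Integration.integral_sum i2)
    have "norm (\<integral>y. ?q y \<partial>lebesgue) \<le> (\<integral>y. norm (?q y) \<partial>lebesgue)" by (rule integral_norm_bound)
    also have "\<dots> \<le> (\<integral>y. \<bar>f y\<bar> * (norm ?h * (e / (F + 1))) \<partial>lebesgue)"
    proof (rule Bochner_Integration.integral_mono)
      show "integrable lebesgue (\<lambda>y. norm (?q y))" using iq by (rule integrable_norm)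
      show "integrable lebesgue (\<lambda>y. \<bar>f y\<bar> * (norm ?h * (e / (F + 1))))" using f by simp
      show "norm (?q y) \<le> \<bar>f y\<bar> * (norm ?h * (e / (F + 1)))" for y
      proof -
        have eq: "x - y + ?h = z - y" by simp
        show ?thesis using d(2)[OF that, of "x - y"]
          unfolding real_norm_def abs_mult eq by (rule mult_left_mono) (rule abs_ge_zero)
      qed
    qed
    also have "\<dots> = F * (norm ?h * (e / (F + 1)))" by (simp add: F_def)
    also have "\<dots> = norm ?h * e * (F / (F + 1))" by simp
    also have "\<dots> \<le> norm ?h * e * 1"
      using F \<open>e > 0\<close> by (intro mult_left_mono) (auto simp: divide_le_eq)
    finally show ?thesis unfolding lin by (simp only: mult.commute[of e] mult_1_right)
  qed
  then show "\<exists>d>0. \<forall>z. norm (z - x) < d \<longrightarrow>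
      norm (conv f \<phi> z - conv f \<phi> x - (\<Sum>i\<in>Basis. ((z - x) \<bullet> i) * conv f (pd i \<phi>) x)) \<le> e * norm (z - x)"
    using d(1) by blast
qed

lemma pd_conv:
  assumes "integrable lebesgue f" "smooth \<phi>" "bounded {x. \<phi> x \<noteq> 0}" "i \<in> Basis"
  shows "pd i (conv f \<phi>) = conv f (pd i \<phi>)"
proof
  fix x
  have "pd i (conv f \<phi>) x = (\<Sum>j\<in>Basis. (i \<bullet> j) * conv f (pd j \<phi>) x)"
    by (rule pd_eqI[OF conv_has_derivative[OF assms(1-3)]])
  also have "\<dots> = (\<Sum>j\<in>Basis. if j = i then conv f (pd j \<phi>) x else 0)"
    using assms(4) by (intro sum.cong) (auto simp: inner_Basis)
  also have "\<dots> = conv f (pd i \<phi>) x" using assms(4) by simp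
  finally show "pd i (conv f \<phi>) x = conv f (pd i \<phi>) x" .
qed

text \<open>With \<open>f\<close> fixed and \<open>\<phi>\<close> ranging over smooth functions of
  bounded support, the convolutions form a class closed under partial derivatives, since
  \<open>pd_conv\<close> moves them onto the kernel.\<close>

lemma conv_smooth:
  assumes f: "integrable lebesgue f" and "smooth \<phi>" "bounded {x. \<phi> x \<noteq> 0}"
  shows "smooth (conv f \<phi>)"
proof (rule smoothI[where F="conv f ` {\<phi>. smooth \<phi> \<and> bounded {x. \<phi> x \<noteq> 0}}"])
  show "conv f \<phi> \<in> conv f ` {\<phi>. smooth \<phi> \<and> bounded {x. \<phi> x \<noteq> 0}}" using assms by auto
  show "g differentiable (at x)" if "g \<in> conv f ` {\<phi>. smooth \<phi> \<and> bounded {x. \<phi> x \<noteq> 0}}" for g x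
    using that conv_has_derivative[OF f] unfolding differentiable_def by blast
  show "pd i g \<in> conv f ` {\<phi>. smooth \<phi> \<and> bounded {x. \<phi> x \<noteq> 0}}"
    if "g \<in> conv f ` {\<phi>. smooth \<phi> \<and> bounded {x. \<phi> x \<noteq> 0}}" "i \<in> Basis" for g i
  proof -
    from that(1) obtain \<psi> where g: "g = conv f \<psi>" and "smooth \<psi>" "bounded {x. \<psi> x \<noteq> 0}" by blast
    with that(2) show ?thesis
      unfolding g by (subst pd_conv[OF f]) (auto intro: smooth_pd pd_bounded_support)
  qed
qed

text \<open>Convolution replaces iterated integration. Against the indicator of a ball one unit
  larger than the support, the convolution of \<open>\<phi>\<close> is constant on the unit ball,
  equal to the integral of \<open>\<phi>\<close>; its derivative at 0 is therefore 0, and by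
  \<open>pd_conv\<close> it is the integral of \<open>pd i \<phi>\<close>.\<close>

lemma integral_pd_eq_0:
  assumes s: "smooth (\<phi> :: 'a::euclidean_space \<Rightarrow> real)" and b: "bounded {x. \<phi> x \<noteq> 0}" and i: "i \<in> Basis"
  shows "(\<integral>x. pd i \<phi> x \<partial>lebesgue) = 0"
proof -
  obtain R where R: "{x. \<phi> x \<noteq> 0} \<subseteq> cball 0 R"
    using bounded_subset_cball_0[OF b] by blast
  let ?f = "indicator (cball 0 (R + 1)) :: 'a \<Rightarrow> real"
  have f: "integrable lebesgue ?f" by (subst lmeasurable_iff_integrable[symmetric]) simp
  have eq: "conv ?f \<psi> x = (\<integral>y. \<psi> y \<partial>lebesgue)"
    if x: "norm x \<le> 1" and psi: "{x. \<psi> x \<noteq> 0} \<subseteq> cball 0 R" "continuous_on UNIV \<psi>" for \<psi> x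
  proof -
    have "?f y * \<psi> (x - y) = \<psi> (x - y)" for y
    proof (cases "y \<in> cball 0 (R + 1)")
      case False
      then have "R < norm (x - y)" using x norm_triangle_ineq4[of x "x - y"] by auto
      then have "\<psi> (x - y) = 0" using psi by force
      then show ?thesis by simp
    qed simp
    then have "conv ?f \<psi> x = (\<integral>y. \<psi> (x - y) \<partial>lebesgue)" unfolding conv_def by (simp only:)
    also have "\<dots> = (\<integral>y. \<psi> y \<partial>lebesgue)"
      using psi by (intro integral_lebesgue_reflect borel_measurable_continuous_onI)
    finally show ?thesis .
  qed
  have "closure {x. \<phi> x \<noteq> 0} \<subseteq> cball 0 R" by (rule closure_minimal[OF R]) simp
  then have "(\<integral>x. pd i \<phi> x \<partial>lebesgue) = conv ?f (pd i \<phi>) 0"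
    using pd_support[of i \<phi>] smooth_continuous[OF smooth_pd[OF s i]] by (subst eq) auto
  also have "\<dots> = pd i (conv ?f \<phi>) 0" by (simp add: pd_conv[OF f s b i])
  also have "\<dots> = 0"
  proof (rule pd_eqI)
    show "(conv ?f \<phi> has_derivative (\<lambda>h. 0)) (at 0)"
    proof (rule has_derivative_transform_within_open[where s="ball 0 1"])
      show "((\<lambda>x. \<integral>y. \<phi> y \<partial>lebesgue) has_derivative (\<lambda>h. 0)) (at (0::'a))" by simp
    qed (use eq[OF _ R smooth_continuous[OF s]] in auto)
  qed
  finally show ?thesis .
qed

section \<open>Convergence of mollifications\<close>

lemma borel_measurable_lebesgueI: "f \<in> borel_measurable borel \<Longrightarrow> f \<in> borel_measurable lebesgue"
  by (rule measurable_completion) simp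

lemma continuous_measurable_lebesgue:
  fixes f :: "'a::euclidean_space \<Rightarrow> real"
  shows "continuous_on UNIV f \<Longrightarrow> f \<in> borel_measurable lebesgue"
  by (intro borel_measurable_lebesgueI borel_measurable_continuous_onI)

text \<open>At each point the integrand is eventually 0, and \<open>\<bar>f x\<bar> ^ p\<close>
  dominates it. Used with \<open>p = 1\<close> for density in L1 and with \<open>p = 2\<close> for
  weak convergence.\<close>

lemma truncation_Lp:
  fixes f :: "'a::euclidean_space \<Rightarrow> real"
  assumes m: "f \<in> borel_measurable lebesgue" and f: "integrable lebesgue (\<lambda>x. \<bar>f x\<bar> ^ p)" and "p > 0"
  shows "(\<lambda>n. \<integral>x. \<bar>f x - max (- real n) (min (real n) (f x))\<bar> ^ p \<partial>lebesgue) \<longlonglongrightarrow> 0"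
proof -
  have "(\<lambda>n. \<integral>x. \<bar>f x - max (- real n) (min (real n) (f x))\<bar> ^ p \<partial>lebesgue) \<longlonglongrightarrow> (\<integral>x. (0::real) \<partial>(lebesgue :: 'a measure))"
  proof (rule integral_dominated_convergence[where w="\<lambda>x. \<bar>f x\<bar> ^ p"])
    show "(\<lambda>x. \<bar>f x - max (- real n) (min (real n) (f x))\<bar> ^ p) \<in> borel_measurable lebesgue" for n
      using m by simp
    show "integrable lebesgue (\<lambda>x. \<bar>f x\<bar> ^ p)" by (rule f)
    show "AE x in lebesgue. norm (\<bar>f x - max (- real n) (min (real n) (f x))\<bar> ^ p) \<le> \<bar>f x\<bar> ^ p" for n
    proof (rule AE_I2)
      fix x
      have "\<bar>f x - max (- real n) (min (real n) (f x))\<bar> \<le> \<bar>f x\<bar>" by (auto simp: max_def min_def)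
      then have "\<bar>f x - max (- real n) (min (real n) (f x))\<bar> ^ p \<le> \<bar>f x\<bar> ^ p"
        by (rule power_mono) simp
      then show "norm (\<bar>f x - max (- real n) (min (real n) (f x))\<bar> ^ p) \<le> \<bar>f x\<bar> ^ p" by simp
    qed
    show "AE x in lebesgue. (\<lambda>n. \<bar>f x - max (- real n) (min (real n) (f x))\<bar> ^ p) \<longlonglongrightarrow> 0"
    proof (rule AE_I2)
      fix x
      have "\<forall>\<^sub>F n in sequentially. \<bar>f x - max (- real n) (min (real n) (f x))\<bar> ^ p = 0"
        using eventually_ge_at_top[of "nat \<lceil>\<bar>f x\<bar>\<rceil>"]
      proof eventually_elim
        case (elim n)
        then have "\<bar>f x\<bar> \<le> real n" by linarith
        then show ?case using \<open>p > 0\<close> by (auto simp: max_def min_def)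
      qed
      then show "(\<lambda>n. \<bar>f x - max (- real n) (min (real n) (f x))\<bar> ^ p) \<longlonglongrightarrow> 0"
        by (rule tendsto_eventually)
    qed
  qed auto
  then show ?thesis by simp
qed

lemma truncation_integrable:
  fixes f :: "'a::euclidean_space \<Rightarrow> real"
  assumes "integrable lebesgue f"
  shows "integrable lebesgue (\<lambda>x. max (- real n) (min (real n) (f x)))"
  by (rule Bochner_Integration.integrable_bound[OF assms])
    (use borel_measurable_integrable[OF assms] in \<open>auto simp: max_def min_def\<close>)

text \<open>Half of \<open>\<delta>\<close> pays for truncating \<open>f\<close> at height
  \<open>k\<close>; the other half pays for replacing the truncation by a continuous function, which
  dominated convergence allows once values and supports are under control.\<close>

lemma L1_dense:
  fixes f :: "'a::euclidean_space \<Rightarrow> real"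
  assumes f: "integrable lebesgue f" and supp: "\<And>x. R < norm x \<Longrightarrow> f x = 0" and "\<delta> > 0"
  obtains g where "continuous_on UNIV g" "\<And>x. R + 1 < norm x \<Longrightarrow> g x = 0"
    "(\<integral>x. \<bar>f x - g x\<bar> \<partial>lebesgue) < \<delta>"
proof -
  have "(\<lambda>n. \<integral>x. \<bar>f x - max (- real n) (min (real n) (f x))\<bar> \<partial>lebesgue) \<longlonglongrightarrow> 0"
    using truncation_Lp[of f 1] f by simp
  then have "\<forall>\<^sub>F n in sequentially.
      (\<integral>x. \<bar>f x - max (- real n) (min (real n) (f x))\<bar> \<partial>lebesgue) < \<delta> / 2"
    by (rule order_tendstoD) (use \<open>\<delta> > 0\<close> in simp)
  then obtain k :: nat where k: "(\<integral>x. \<bar>f x - max (- real k) (min (real k) (f x))\<bar> \<partial>lebesgue) < \<delta> / 2"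
    by (auto simp: eventually_sequentially)
  define T where "T s = max (- real k) (min (real k) s)" for s :: real
  have Tk: "\<bar>T s\<bar> \<le> real k" for s by (auto simp: T_def max_def min_def)
  have [measurable]: "T \<in> borel_measurable borel" unfolding T_def by measurable
  have T_cont: "continuous_on UNIV T" unfolding T_def by (intro continuous_intros)
  note k = k[folded T_def]
  have fm: "f \<in> borel_measurable lebesgue" using f by (rule borel_measurable_integrable)
  \<comment> \<open>\<open>measurable_on\<close> unfolds to almost everywhere convergence of
    continuous functions \<open>g n\<close> to \<open>f\<close>.\<close>
  then have "f measurable_on UNIV"
    by (subst measurable_on_iff_borel_measurable) (auto simp: lebesgue_on_UNIV_eq)
  then obtain N g where N: "negligible N" and g: "\<And>n. continuous_on UNIV (g n)"
    "\<And>x. x \<notin> N \<Longrightarrow> (\<lambda>n. g n x) \<longlonglongrightarrow> f x"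
    unfolding measurable_on_def by auto
  \<comment> \<open>The \<open>g n\<close> come with no bound on size or support. \<open>T\<close>
    bounds them and the continuous factor \<open>\<kappa>\<close> confines them to the ball of
    radius \<open>R + 1\<close>, without changing \<open>T (f x)\<close>, as \<open>f\<close> lives
    in the ball of radius \<open>R\<close>.\<close>
  define \<kappa> :: "'a \<Rightarrow> real" where "\<kappa> x = max 0 (min 1 (R + 1 - norm x))" for x
  have \<kappa>: "0 \<le> \<kappa> x" "\<kappa> x \<le> 1" "R + 1 < norm x \<Longrightarrow> \<kappa> x = 0" "norm x \<le> R \<Longrightarrow> \<kappa> x = 1" for x
    by (auto simp: \<kappa>_def)
  have cont: "continuous_on UNIV (\<lambda>x. T (g n x) * \<kappa> x)" for n
    unfolding \<kappa>_def T_def by (intro continuous_intros g(1))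
  have T\<kappa>: "T (f x) * \<kappa> x = T (f x)" for x
    by (cases "R < norm x") (use supp \<kappa>(4) in \<open>auto simp: T_def\<close>)
  have "(\<lambda>n. \<integral>x. \<bar>T (f x) - T (g n x) * \<kappa> x\<bar> \<partial>lebesgue) \<longlonglongrightarrow> (\<integral>x. (0::real) \<partial>(lebesgue :: 'a measure))"
  proof (rule integral_dominated_convergence[where w="\<lambda>x. indicator (cball 0 (R + 1)) x * (2 * real k)"])
    show "(\<lambda>x. \<bar>T (f x) - T (g n x) * \<kappa> x\<bar>) \<in> borel_measurable lebesgue" for n
      using fm continuous_measurable_lebesgue[OF cont[of n]] by simp
    have "integrable lebesgue (indicator (cball (0::'a) (R + 1)) :: 'a \<Rightarrow> real)"
      by (subst lmeasurable_iff_integrable[symmetric]) simp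
    then show "integrable lebesgue (\<lambda>x. indicator (cball (0::'a) (R + 1)) x * (2 * real k))" by simp
    show "AE x in lebesgue. norm \<bar>T (f x) - T (g n x) * \<kappa> x\<bar> \<le> indicator (cball 0 (R + 1)) x * (2 * real k)" for n
    proof (rule AE_I2)
      fix x
      have a: "\<bar>T (f x) - T (g n x) * \<kappa> x\<bar> = \<bar>T (f x) - T (g n x)\<bar> * \<kappa> x"
        using T\<kappa>[of x] \<kappa>(1)[of x] by (metis abs_mult abs_of_nonneg left_diff_distrib)
      have b: "\<bar>T (f x) - T (g n x)\<bar> \<le> 2 * real k" using Tk[of "f x"] Tk[of "g n x"] by linarith
      show "norm \<bar>T (f x) - T (g n x) * \<kappa> x\<bar> \<le> indicator (cball 0 (R + 1)) x * (2 * real k)"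
      proof (cases "R + 1 < norm x")
        case False
        then show ?thesis unfolding a using b mult_mono[OF b \<kappa>(2)[of x]] \<kappa>(1)[of x] by (simp add: abs_mult)
      qed (unfold a, simp add: \<kappa>)
    qed
    show "AE x in lebesgue. (\<lambda>n. \<bar>T (f x) - T (g n x) * \<kappa> x\<bar>) \<longlonglongrightarrow> 0"
    proof (rule AE_mp[OF AE_not_in[of N]])
      show "N \<in> null_sets lebesgue" using N by (simp add: negligible_iff_null_sets)
      show "AE x in lebesgue. x \<notin> N \<longrightarrow> (\<lambda>n. \<bar>T (f x) - T (g n x) * \<kappa> x\<bar>) \<longlonglongrightarrow> 0"
      proof (intro AE_I2 impI)
        fix x assume "x \<notin> N"
        have "(\<lambda>n. \<bar>T (f x) - T (g n x) * \<kappa> x\<bar>) \<longlonglongrightarrow> \<bar>T (f x) - T (f x) * \<kappa> x\<bar>"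
          by (intro tendsto_intros continuous_on_tendsto_compose[OF T_cont] g(2) \<open>x \<notin> N\<close>) auto
        then show "(\<lambda>n. \<bar>T (f x) - T (g n x) * \<kappa> x\<bar>) \<longlonglongrightarrow> 0" by (simp add: T\<kappa>)
      qed
    qed
  qed auto
  then have "\<forall>\<^sub>F n in sequentially. (\<integral>x. \<bar>T (f x) - T (g n x) * \<kappa> x\<bar> \<partial>lebesgue) < \<delta> / 2"
    by (intro order_tendstoD(2)[where y="0"]) (use \<open>\<delta> > 0\<close> in simp_all)
  then obtain n where n: "(\<integral>x. \<bar>T (f x) - T (g n x) * \<kappa> x\<bar> \<partial>lebesgue) < \<delta> / 2"
    by (auto simp: eventually_sequentially)
  show ?thesis
  proof (rule that[OF cont[of n]])
    show "T (g n x) * \<kappa> x = 0" if "R + 1 < norm x" for x using \<kappa>(3)[OF that] by simp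
    have ig: "integrable lebesgue (\<lambda>x. T (g n x) * \<kappa> x)"
      by (rule integrable_bounded_support[OF cont], rule bounded_subset[of "cball 0 (R + 1)"],
          rule bounded_cball) (use \<kappa>(3) in \<open>force simp: not_less[symmetric]\<close>)
    note iT = truncation_integrable[OF f, of k, folded T_def]
    have "(\<integral>x. \<bar>f x - T (g n x) * \<kappa> x\<bar> \<partial>lebesgue) \<le> (\<integral>x. \<bar>f x - T (f x)\<bar> + \<bar>T (f x) - T (g n x) * \<kappa> x\<bar> \<partial>lebesgue)"
      by (rule Bochner_Integration.integral_mono)
        (use f ig iT in \<open>auto intro!: Bochner_Integration.integrable_add integrable_abs Bochner_Integration.integrable_diff\<close>)
    also have "\<dots> = (\<integral>x. \<bar>f x - T (f x)\<bar> \<partial>lebesgue) + (\<integral>x. \<bar>T (f x) - T (g n x) * \<kappa> x\<bar> \<partial>lebesgue)"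
      by (rule Bochner_Integration.integral_add)
        (use f ig iT in \<open>auto intro!: integrable_abs Bochner_Integration.integrable_diff\<close>)
    also have "\<dots> < \<delta>" using k n by simp
    finally show "(\<integral>x. \<bar>f x - T (g n x) * \<kappa> x\<bar> \<partial>lebesgue) < \<delta>" .
  qed
qed

section \<open>Estimates for convolution with a mollifier\<close>

lemma mollifier_facts:
  assumes "mollifier r \<rho>"
  shows "smooth \<rho>" "0 \<le> \<rho> x" "r \<le> norm x \<Longrightarrow> \<rho> x = 0" "(\<integral>x. \<rho> x \<partial>lebesgue) = 1"
    "continuous_on UNIV \<rho>" "\<rho> \<in> borel_measurable borel" "integrable lebesgue \<rho>"
    "integrable lebesgue (\<lambda>y. \<rho> (x - y))" "(\<integral>y. \<rho> (x - y) \<partial>lebesgue) = 1"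
proof -
  show s: "smooth \<rho>" "0 \<le> \<rho> x" "r \<le> norm x \<Longrightarrow> \<rho> x = 0" "(\<integral>x. \<rho> x \<partial>lebesgue) = 1"
    using assms by (auto simp: mollifier_def)
  show c: "continuous_on UNIV \<rho>" using s(1) by (rule smooth_continuous)
  show m: "\<rho> \<in> borel_measurable borel" using c by (rule borel_measurable_continuous_onI)
  show i: "integrable lebesgue \<rho>" by (rule integrable_bounded_support[OF c mollifier_bounded_support[OF assms]])
  show "integrable lebesgue (\<lambda>y. \<rho> (x - y))" by (rule integrable_lebesgue_reflect[OF m i])
  show "(\<integral>y. \<rho> (x - y) \<partial>lebesgue) = 1" using s(4) by (simp add: integral_lebesgue_reflect[OF m])
qed

lemma mollifier_conv_integrable:
  assumes "mollifier r \<rho>" "integrable lebesgue f"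
  shows "integrable lebesgue (\<lambda>y. f y * \<rho> (x - y))"
  by (rule conv_integrable[OF assms(2) mollifier_facts(5)[OF assms(1)] mollifier_bounded_support[OF assms(1)]])

lemma mollifier_conv_smooth:
  assumes "mollifier r \<rho>" "integrable lebesgue f"
  shows "smooth (conv f \<rho>)"
  by (rule conv_smooth[OF assms(2) mollifier_facts(1)[OF assms(1)] mollifier_bounded_support[OF assms(1)]])

lemma conv_diff:
  assumes "mollifier r \<rho>" "integrable lebesgue f" "integrable lebesgue g"
  shows "conv (\<lambda>x. f x - g x) \<rho> x = conv f \<rho> x - conv g \<rho> x"
  unfolding conv_def left_diff_distrib
  by (rule Bochner_Integration.integral_diff) (rule mollifier_conv_integrable[OF assms(1)], fact)+

text \<open>Young's inequality for a kernel of mass 1: the integrals are exchanged by Tonelli, and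
  the inner integral of the kernel is 1.\<close>

lemma conv_L1_bound:
  fixes f :: "'a::euclidean_space \<Rightarrow> real"
  assumes \<rho>: "mollifier r \<rho>" and f: "integrable lebesgue f"
  shows "integrable lebesgue (conv f \<rho>)"
    and "(\<integral>x. \<bar>conv f \<rho> x\<bar> \<partial>lebesgue) \<le> (\<integral>x. \<bar>f x\<bar> \<partial>lebesgue)"
proof -
  have fm: "f \<in> borel_measurable lebesgue" using f by (rule borel_measurable_integrable)
  \<comment> \<open>Tonelli is applied on \<open>lborel\<close>, where the integrand has to be
    jointly Borel measurable; a Borel representative of \<open>f\<close> leaves the convolution
    unchanged.\<close>
  obtain g where g[measurable]: "g \<in> borel_measurable lborel" and fg: "AE x in lborel. f x = g x"
    using completion_ex_borel_measurable_real[OF fm] by blast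
  have fg': "AE x in lebesgue. f x = g x" using fg by (rule AE_completion)
  have gm: "g \<in> borel_measurable lebesgue" using g by (intro measurable_completion) simp
  have ig: "integrable lebesgue g" by (rule integrable_cong_AE_imp[OF f gm]) (use fg' in \<open>auto elim!: AE_mp\<close>)
  note [measurable] = mollifier_facts(6)[OF \<rho>]
  note m = mollifier_conv_integrable[OF \<rho>]
  have bound: "ennreal \<bar>conv f \<rho> x\<bar> \<le> (\<integral>\<^sup>+y. ennreal \<bar>g y\<bar> * ennreal (\<rho> (x - y)) \<partial>lborel)" for x
  proof -
    have "conv f \<rho> x = conv g \<rho> x" unfolding conv_def
      by (rule integral_cong_AE) (use borel_measurable_integrable[OF m[OF f]] borel_measurable_integrable[OF m[OF ig]] fg' in \<open>auto elim!: AE_mp\<close>)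
    also have "\<dots> = (\<integral>y. g y * \<rho> (x - y) \<partial>lborel)" unfolding conv_def
      by (rule integral_completion) measurable
    finally have eq: "conv f \<rho> x = (\<integral>y. g y * \<rho> (x - y) \<partial>lborel)" .
    have "integrable lborel (\<lambda>y. g y * \<rho> (x - y))"
      using m[OF ig] by (subst (asm) integrable_completion) measurable
    then have "ennreal (norm (\<integral>y. g y * \<rho> (x - y) \<partial>lborel)) \<le> (\<integral>\<^sup>+y. norm (g y * \<rho> (x - y)) \<partial>lborel)"
      by (rule integral_norm_bound_ennreal)
    then show ?thesis
      unfolding eq by (simp add: abs_mult ennreal_mult mollifier_facts(2)[OF \<rho>])
  qed
  have c: "continuous_on UNIV (conv f \<rho>)" by (rule smooth_continuous[OF mollifier_conv_smooth[OF \<rho> f]])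
  have [measurable]: "conv f \<rho> \<in> borel_measurable borel" using c by (rule borel_measurable_continuous_onI)
  have one: "(\<integral>\<^sup>+x. ennreal (\<rho> (x - y)) \<partial>lborel) = 1" for y
  proof -
    have "(\<integral>\<^sup>+x. ennreal (\<rho> (x - y)) \<partial>lborel) = (\<integral>\<^sup>+x. ennreal (\<rho> x) \<partial>distr lborel borel (\<lambda>x. x - y))"
      by (subst nn_integral_distr) auto
    also have "\<dots> = (\<integral>\<^sup>+x. ennreal (\<rho> x) \<partial>lborel)" by (simp add: lborel_distr_translate)
    also have "\<dots> = ennreal (\<integral>x. \<rho> x \<partial>lborel)"
      using mollifier_facts(7)[OF \<rho>] mollifier_facts(2)[OF \<rho>]
      by (intro nn_integral_eq_integral) (auto simp: integrable_completion)
    also have "\<dots> = 1" using mollifier_facts(4)[OF \<rho>] by (simp add: integral_completion)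
    finally show ?thesis .
  qed
  have "(\<integral>\<^sup>+x. ennreal \<bar>conv f \<rho> x\<bar> \<partial>lborel) \<le> (\<integral>\<^sup>+x. (\<integral>\<^sup>+y. ennreal \<bar>g y\<bar> * ennreal (\<rho> (x - y)) \<partial>lborel) \<partial>lborel)"
    by (intro nn_integral_mono bound)
  also have "\<dots> = (\<integral>\<^sup>+y. (\<integral>\<^sup>+x. ennreal \<bar>g y\<bar> * ennreal (\<rho> (x - y)) \<partial>lborel) \<partial>lborel)"
    by (rule lborel_pair.Fubini') measurable
  also have "\<dots> = (\<integral>\<^sup>+y. ennreal \<bar>g y\<bar> \<partial>lborel)"
    by (simp add: nn_integral_cmult one)
  also have "\<dots> = ennreal (\<integral>y. \<bar>g y\<bar> \<partial>lborel)"
    using ig by (intro nn_integral_eq_integral) (auto simp: integrable_completion)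
  also have "(\<integral>y. \<bar>g y\<bar> \<partial>lborel) = (\<integral>y. \<bar>g y\<bar> \<partial>lebesgue)"
    by (rule integral_completion[symmetric]) measurable
  also have "\<dots> = (\<integral>y. \<bar>f y\<bar> \<partial>lebesgue)"
    by (rule integral_cong_AE) (use fm gm fg' in \<open>auto elim!: AE_mp\<close>)
  finally have le: "(\<integral>\<^sup>+x. ennreal \<bar>conv f \<rho> x\<bar> \<partial>lborel) \<le> ennreal (\<integral>y. \<bar>f y\<bar> \<partial>lebesgue)" .
  have il: "integrable lborel (conv f \<rho>)"
    by (rule integrableI_bounded) (use le in \<open>auto intro: le_less_trans\<close>)
  then show "integrable lebesgue (conv f \<rho>)" by (simp add: integrable_completion)
  have "(\<integral>\<^sup>+x. ennreal \<bar>conv f \<rho> x\<bar> \<partial>lborel) = ennreal (\<integral>x. \<bar>conv f \<rho> x\<bar> \<partial>lborel)"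
    using il by (intro nn_integral_eq_integral) auto
  then have "(\<integral>x. \<bar>conv f \<rho> x\<bar> \<partial>lborel) \<le> (\<integral>y. \<bar>f y\<bar> \<partial>lebesgue)"
    using le by (simp add: ennreal_le_iff)
  then show "(\<integral>x. \<bar>conv f \<rho> x\<bar> \<partial>lebesgue) \<le> (\<integral>x. \<bar>f x\<bar> \<partial>lebesgue)"
    by (subst integral_completion) auto
qed

text \<open>Jensen's inequality as a variance: with \<open>m\<close> the mean of \<open>f\<close>
  under the probability density \<open>\<rho> (x - y)\<close>, the mean of
  \<open>(f y - m)\<^sup>2\<close> is nonnegative.\<close>

lemma conv_sq_le:
  fixes f :: "'a::euclidean_space \<Rightarrow> real"
  assumes \<rho>: "mollifier r \<rho>" and f: "integrable lebesgue f" "integrable lebesgue (\<lambda>x. (f x)\<^sup>2)"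
  shows "(conv f \<rho> x)\<^sup>2 \<le> conv (\<lambda>x. (f x)\<^sup>2) \<rho> x"
proof -
  define m where "m = conv f \<rho> x"
  note i = mollifier_conv_integrable[OF \<rho> f(1), of x] mollifier_conv_integrable[OF \<rho> f(2), of x]
    mollifier_facts(8)[OF \<rho>, of x]
  have "0 \<le> (\<integral>y. (f y - m)\<^sup>2 * \<rho> (x - y) \<partial>lebesgue)"
    by (intro Bochner_Integration.integral_nonneg mult_nonneg_nonneg mollifier_facts(2)[OF \<rho>]) auto
  also have "(\<lambda>y. (f y - m)\<^sup>2 * \<rho> (x - y)) =
      (\<lambda>y. (f y)\<^sup>2 * \<rho> (x - y) - 2 * m * (f y * \<rho> (x - y)) + m\<^sup>2 * \<rho> (x - y))"
    by (rule ext) (simp add: power2_diff algebra_simps)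
  also have "(\<integral>y. (f y)\<^sup>2 * \<rho> (x - y) - 2 * m * (f y * \<rho> (x - y)) + m\<^sup>2 * \<rho> (x - y) \<partial>lebesgue) =
      conv (\<lambda>x. (f x)\<^sup>2) \<rho> x - 2 * m * m + m\<^sup>2"
    using i mollifier_facts(9)[OF \<rho>, of x] by (simp add: conv_def m_def)
  finally show ?thesis by (simp add: m_def power2_eq_square)
qed

lemma conv_support:
  assumes \<rho>: "mollifier r \<rho>" and "\<And>y. dist x y < r \<Longrightarrow> f y = 0"
  shows "conv f \<rho> x = 0"
proof -
  have "(\<lambda>y. f y * \<rho> (x - y)) = (\<lambda>y. 0)"
  proof
    fix y show "f y * \<rho> (x - y) = 0" using assms(2)[of y] mollifier_facts(3)[OF \<rho>, of "x - y"] by (cases "dist x y < r") (auto simp: dist_norm)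
  qed
  then show ?thesis by (simp add: conv_def)
qed

text \<open>The convolution averages values of \<open>f\<close> on a ball, so it stays in any
  interval that contains them. It serves both for continuity estimates and, with suitable
  \<open>a\<close> and \<open>e\<close>, for exact values and bounds of cutoffs.\<close>

lemma conv_close:
  assumes \<rho>: "mollifier r \<rho>" and f: "integrable lebesgue f"
    and "\<And>y. dist x y < r \<Longrightarrow> \<bar>f y - a\<bar> \<le> e"
  shows "\<bar>conv f \<rho> x - a\<bar> \<le> e"
proof -
  note i = mollifier_conv_integrable[OF \<rho> f, of x] mollifier_facts(8)[OF \<rho>, of x]
  have eq: "conv f \<rho> x - a = (\<integral>y. (f y - a) * \<rho> (x - y) \<partial>lebesgue)"
    using i mollifier_facts(9)[OF \<rho>, of x] by (simp add: conv_def left_diff_distrib)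
  have "\<bar>\<integral>y. (f y - a) * \<rho> (x - y) \<partial>lebesgue\<bar> \<le> (\<integral>y. \<bar>(f y - a) * \<rho> (x - y)\<bar> \<partial>lebesgue)"
    by (rule integral_abs_bound)
  also have "\<dots> \<le> (\<integral>y. e * \<rho> (x - y) \<partial>lebesgue)"
  proof (rule Bochner_Integration.integral_mono)
    show "integrable lebesgue (\<lambda>y. \<bar>(f y - a) * \<rho> (x - y)\<bar>)"
      using i by (intro integrable_abs) (simp add: left_diff_distrib)
    show "integrable lebesgue (\<lambda>y. e * \<rho> (x - y))" using i by simp
    show "\<bar>(f y - a) * \<rho> (x - y)\<bar> \<le> e * \<rho> (x - y)" for y
    proof (cases "dist x y < r")
      case True
      then show ?thesis using assms(3)[of y] mollifier_facts(2)[OF \<rho>, of "x - y"]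
        by (simp add: abs_mult mult_right_mono)
    next
      case False
      then show ?thesis using mollifier_facts(3)[OF \<rho>, of "x - y"] by (simp add: dist_norm)
    qed
  qed
  also have "\<dots> = e" using mollifier_facts(9)[OF \<rho>, of x] by simp
  finally show ?thesis by (simp add: eq)
qed

text \<open>The error splits through a continuous \<open>g\<close> close to \<open>f\<close> in L1.
  The convolution of \<open>f - g\<close> is no larger than \<open>f - g\<close> in L1, and the
  error for \<open>g\<close> is uniformly small by uniform continuity and confined to a fixed
  ball.\<close>

lemma conv_tendsto_L1:
  fixes f :: "'a::euclidean_space \<Rightarrow> real"
  assumes f: "integrable lebesgue f" and supp: "\<And>x. R < norm x \<Longrightarrow> f x = 0"
    and \<rho>: "\<And>n. mollifier (1 / real (Suc n)) (\<rho> n)"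
  shows "(\<lambda>n. \<integral>x. \<bar>conv f (\<rho> n) x - f x\<bar> \<partial>lebesgue) \<longlonglongrightarrow> 0"
proof (rule LIMSEQ_I)
  fix \<delta> :: real assume "\<delta> > 0"
  obtain g where g: "continuous_on UNIV g" "\<And>x. R + 1 < norm x \<Longrightarrow> g x = 0"
    "(\<integral>x. \<bar>f x - g x\<bar> \<partial>lebesgue) < \<delta> / 4"
    using L1_dense[OF f supp, where \<delta>="\<delta> / 4"] \<open>\<delta> > 0\<close> by auto
  have bg: "bounded {x. g x \<noteq> 0}"
    by (rule bounded_subset[of "cball 0 (R + 1)"], rule bounded_cball)
      (use g(2) in \<open>force simp: not_less[symmetric]\<close>)
  have ig: "integrable lebesgue g" by (rule integrable_bounded_support[OF g(1) bg])
  \<comment> \<open>One unit of radius is spent on the support of \<open>g\<close>, another on the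
    kernels, whose radii are at most 1.\<close>
  let ?B = "cball (0::'a) (R + 2)"
  have iB: "integrable lebesgue (indicator ?B :: 'a \<Rightarrow> real)"
    by (subst lmeasurable_iff_integrable[symmetric]) simp
  define m where "m = measure lebesgue ?B"
  have m: "m \<ge> 0" by (simp add: m_def)
  \<comment> \<open>Makes the uniform error integrate to at most \<open>\<delta> / 4\<close> over
    the ball; the three contributions then stay below \<open>\<delta>\<close>. The added 1 keeps the
    denominator positive.\<close>
  define \<eta> where "\<eta> = \<delta> / (4 * (m + 1))"
  have \<eta>: "\<eta> > 0" using \<open>\<delta> > 0\<close> m by (simp add: \<eta>_def)
  obtain d where d: "d > 0" "\<And>x y. dist y x < d \<Longrightarrow> \<bar>g y - g x\<bar> < \<eta>"
    using bounded_support_uniformly_continuous[OF g(1) bg] \<eta>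
    unfolding uniformly_continuous_on_def dist_real_def by auto
  obtain N where N: "1 / real (Suc N) < d" using nat_approx_posE[OF d(1)] by metis
  have "norm ((\<integral>x. \<bar>conv f (\<rho> n) x - f x\<bar> \<partial>lebesgue) - 0) < \<delta>" if "n \<ge> N" for n
  proof -
    have r: "1 / real (Suc n) \<le> 1 / real (Suc N)" using that by (simp add: frac_le)
    then have rd: "1 / real (Suc n) < d" using N by simp
    have r1: "1 / real (Suc n) \<le> 1" by simp
    have cl: "\<bar>conv g (\<rho> n) x - g x\<bar> \<le> \<eta> * indicator ?B x" for x
    proof (cases "x \<in> ?B")
      case True
      have "\<bar>conv g (\<rho> n) x - g x\<bar> \<le> \<eta>"
      proof (rule conv_close[OF \<rho> ig])
        fix y assume "dist x y < 1 / real (Suc n)"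
        then have "dist y x < d" using rd dist_commute[of x y] by linarith
        then show "\<bar>g y - g x\<bar> \<le> \<eta>" using d(2) by (simp add: less_imp_le)
      qed
      then show ?thesis using True by simp
    next
      case False
      have "conv g (\<rho> n) x = 0"
      proof (rule conv_support[OF \<rho>])
        fix y assume "dist x y < 1 / real (Suc n)"
        then have "dist x y < 1" using r1 by linarith
        then have "R + 1 < norm y" using False norm_triangle_sub[of x y] by (simp add: dist_norm)
        then show "g y = 0" by (rule g(2))
      qed
      moreover have "g x = 0" using False by (intro g(2)) simp
      ultimately show ?thesis using False by simp
    qed
    have ifg: "integrable lebesgue (\<lambda>x. f x - g x)" using f ig by simp
    note c = conv_L1_bound[OF \<rho>[of n] ifg]
    have bd: "\<bar>conv f (\<rho> n) x - f x\<bar> \<le> \<bar>conv (\<lambda>x. f x - g x) (\<rho> n) x\<bar> + \<eta> * indicator ?B x + \<bar>f x - g x\<bar>" for x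
      using cl[of x] unfolding conv_diff[OF \<rho> f ig] by linarith
    have "(\<integral>x. \<bar>conv f (\<rho> n) x - f x\<bar> \<partial>lebesgue) \<le>
        (\<integral>x. \<bar>conv (\<lambda>x. f x - g x) (\<rho> n) x\<bar> + \<eta> * indicator ?B x + \<bar>f x - g x\<bar> \<partial>lebesgue)"
      by (rule Bochner_Integration.integral_mono[OF _ _ bd])
        (use conv_L1_bound(1)[OF \<rho>[of n] f] f ig iB c(1) in \<open>simp_all\<close>)
    also have "\<dots> = (\<integral>x. \<bar>conv (\<lambda>x. f x - g x) (\<rho> n) x\<bar> \<partial>lebesgue) + \<eta> * m + (\<integral>x. \<bar>f x - g x\<bar> \<partial>lebesgue)"
      using iB c(1) ifg by (simp add: m_def)
    also have "\<dots> < \<delta>"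
    proof -
      have "\<eta> * m \<le> \<eta> * (m + 1)" using \<eta> by simp
      moreover have "\<eta> * (m + 1) = \<delta> / 4" using m by (simp add: \<eta>_def field_simps)
      ultimately show ?thesis using c(2) g(3) \<open>\<delta> > 0\<close> by linarith
    qed
    finally show ?thesis by simp
  qed
  then show "\<exists>no. \<forall>n\<ge>no. norm ((\<integral>x. \<bar>conv f (\<rho> n) x - f x\<bar> \<partial>lebesgue) - 0) < \<delta>" by blast
qed

lemma L2_integrable_bounded_support:
  fixes f :: "'a::euclidean_space \<Rightarrow> real"
  assumes f: "f \<in> L2_space UNIV" and supp: "\<And>x. R < norm x \<Longrightarrow> f x = 0"
  shows "integrable lebesgue f"
proof -
  have "integrable lebesgue (indicator (cball (0::'a) R) :: 'a \<Rightarrow> real)"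
    by (subst lmeasurable_iff_integrable[symmetric]) simp
  then have "integrable lebesgue (\<lambda>x. (f x)\<^sup>2 + indicator (cball 0 R) x)"
    using f by (simp add: L2_space_def lebesgue_on_UNIV_eq)
  then show ?thesis
  proof (rule Bochner_Integration.integrable_bound)
    show "f \<in> borel_measurable lebesgue" using f by (simp add: L2_space_def lebesgue_on_UNIV_eq)
    have "\<bar>f x\<bar> \<le> (f x)\<^sup>2 + indicator (cball 0 R) x" for x
    proof (cases "x \<in> cball 0 R")
      case True
      have "2 * \<bar>f x\<bar> * 1 \<le> \<bar>f x\<bar>\<^sup>2 + 1\<^sup>2" by (rule sum_squares_bound)
      then have "\<bar>f x\<bar> \<le> (f x)\<^sup>2 + 1" by simp
      then show ?thesis using True by simp
    qed (use supp in auto)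
    then show "AE x in lebesgue. norm (f x) \<le> norm ((f x)\<^sup>2 + indicator (cball 0 R) x)"
      by (intro AE_I2) (simp add: order_trans[OF _ abs_ge_self])
  qed
qed

text \<open>Pointwise Jensen followed by the L1 bound for the square of \<open>f\<close>.\<close>

lemma conv_L2:
  fixes f :: "'a::euclidean_space \<Rightarrow> real"
  assumes \<rho>: "mollifier r \<rho>" and f: "f \<in> L2_space UNIV" "integrable lebesgue f"
  shows "conv f \<rho> \<in> L2_space UNIV" "L2_inner UNIV (conv f \<rho>) (conv f \<rho>) \<le> L2_inner UNIV f f"
proof -
  have f2: "integrable lebesgue (\<lambda>x. (f x)\<^sup>2)"
    using f by (simp add: L2_space_def lebesgue_on_UNIV_eq)
  note b = conv_L1_bound[OF \<rho> f2]
  note le = conv_sq_le[OF \<rho> f(2) f2]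
  have nn: "0 \<le> conv (\<lambda>x. (f x)\<^sup>2) \<rho> x" for x using le[of x] zero_le_power2 order_trans by blast
  show L: "conv f \<rho> \<in> L2_space UNIV"
    by (rule L2_bounded_by[where h="conv (\<lambda>x. (f x)\<^sup>2) \<rho>"])
      (use conv_L1_bound(1)[OF \<rho> f(2)] b(1) le in \<open>auto simp: lebesgue_on_UNIV_eq\<close>)
  have "L2_inner UNIV (conv f \<rho>) (conv f \<rho>) = (\<integral>x. (conv f \<rho> x)\<^sup>2 \<partial>lebesgue)"
    by (simp add: L2_inner_def lebesgue_on_UNIV_eq power2_eq_square)
  also have "\<dots> \<le> (\<integral>x. \<bar>conv (\<lambda>x. (f x)\<^sup>2) \<rho> x\<bar> \<partial>lebesgue)"
    by (rule Bochner_Integration.integral_mono)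
      (use L b(1) le nn in \<open>auto simp: L2_space_def lebesgue_on_UNIV_eq\<close>)
  also have "\<dots> \<le> (\<integral>x. (f x)\<^sup>2 \<partial>lebesgue)" using b(2) by simp
  also have "\<dots> = L2_inner UNIV f f"
    by (simp add: L2_inner_def lebesgue_on_UNIV_eq power2_eq_square)
  finally show "L2_inner UNIV (conv f \<rho>) (conv f \<rho>) \<le> L2_inner UNIV f f" .
qed

text \<open>Truncating \<open>e\<close> separates the two sources of smallness: the bounded part
  \<open>T k\<close> is paired with the L1 convergence of \<open>w n\<close> to 0, while the
  remainder of \<open>e\<close> is small in L2 and is paired with a bound on \<open>w n\<close> in
  L2 that is uniform in \<open>n\<close>.\<close>

lemma conv_weak_tendsto:
  fixes f e :: "'a::euclidean_space \<Rightarrow> real"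
  assumes f: "f \<in> L2_space UNIV" and supp: "\<And>x. R < norm x \<Longrightarrow> f x = 0"
    and \<rho>: "\<And>n. mollifier (1 / real (Suc n)) (\<rho> n)" and e: "e \<in> L2_space UNIV"
  shows "(\<lambda>n. L2_inner UNIV e (conv f (\<rho> n))) \<longlonglongrightarrow> L2_inner UNIV e f"
proof (rule LIMSEQ_I)
  fix \<delta> :: real assume "\<delta> > 0"
  have fi: "integrable lebesgue f" by (rule L2_integrable_bounded_support[OF f supp])
  define w where "w n x = conv f (\<rho> n) x - f x" for n x
  note c = conv_L2[OF \<rho> f fi]
  have w: "w n \<in> L2_space UNIV" for n unfolding w_def by (rule L2_diff[OF c(1) f])
  define K where "K = 2 * norm_L2 UNIV f"
  have K: "K \<ge> 0" by (simp add: K_def)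
  have wK: "norm_L2 UNIV (w n) \<le> K" for n
  proof (rule power2_le_imp_le[OF _ K])
    let ?g = "conv f (\<rho> n)"
    have "\<bar>L2_inner UNIV ?g f\<bar> \<le> norm_L2 UNIV ?g * norm_L2 UNIV f"
      by (rule L2_Cauchy_Schwarz[OF c(1) f])
    also have "\<dots> \<le> norm_L2 UNIV f * norm_L2 UNIV f"
      using c(2)[of n] by (intro mult_right_mono) (simp_all add: norm_L2_def L2_inner_self_nonneg)
    also have "\<dots> = L2_inner UNIV f f" using norm_L2_sq[of UNIV f] by (simp add: power2_eq_square)
    finally have cs: "\<bar>L2_inner UNIV ?g f\<bar> \<le> L2_inner UNIV f f" .
    have "(norm_L2 UNIV (w n))\<^sup>2 = L2_inner UNIV ?g ?g - 2 * L2_inner UNIV ?g f + L2_inner UNIV f f"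
      using w[of n] unfolding norm_L2_sq w_def
      by (simp add: L2_inner_diff_left L2_inner_diff_right c(1) f L2_inner_commute[of UNIV f "conv f (\<rho> n)"])
    also have "\<dots> \<le> 4 * L2_inner UNIV f f" using c(2)[of n] cs by linarith
    also have "\<dots> = K\<^sup>2" by (simp add: K_def power_mult_distrib norm_L2_sq)
    finally show "(norm_L2 UNIV (w n))\<^sup>2 \<le> K\<^sup>2" .
  qed
  have em: "e \<in> borel_measurable lebesgue" and e2: "integrable lebesgue (\<lambda>x. \<bar>e x\<bar> ^ 2)"
    using e by (simp_all add: L2_space_def lebesgue_on_UNIV_eq)
  define T where "T k x = max (- real k) (min (real k) (e x))" for k :: nat and x
  have "(\<lambda>k. sqrt (\<integral>x. \<bar>e x - T k x\<bar> ^ 2 \<partial>lebesgue)) \<longlonglongrightarrow> sqrt 0"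
    by (intro tendsto_real_sqrt truncation_Lp[OF em e2, folded T_def]) simp
  moreover have "norm_L2 UNIV (\<lambda>x. e x - T k x) = sqrt (\<integral>x. \<bar>e x - T k x\<bar> ^ 2 \<partial>lebesgue)" for k
    by (simp add: norm_L2_def L2_inner_def lebesgue_on_UNIV_eq power2_eq_square)
  ultimately have "(\<lambda>k. norm_L2 UNIV (\<lambda>x. e x - T k x)) \<longlonglongrightarrow> 0" by simp
  then have "\<forall>\<^sub>F k in sequentially. norm_L2 UNIV (\<lambda>x. e x - T k x) < \<delta> / (2 * (K + 1))"
    by (rule order_tendstoD) (use \<open>\<delta> > 0\<close> K in simp)
  \<comment> \<open>The truncation height is fixed before the index \<open>N\<close>, because the L1
    smallness required of \<open>w n\<close> depends on \<open>k\<close>.\<close>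
  then obtain k where k: "norm_L2 UNIV (\<lambda>x. e x - T k x) < \<delta> / (2 * (K + 1))"
    by (auto simp: eventually_sequentially)
  have T: "T k \<in> L2_space UNIV"
    by (rule L2_bounded_by[where h="\<lambda>x. \<bar>e x\<bar> ^ 2"])
      (use em e2 in \<open>auto simp: lebesgue_on_UNIV_eq max_def min_def abs_le_square_iff[symmetric] T_def[abs_def]\<close>)
  have eT: "(\<lambda>x. e x - T k x) \<in> L2_space UNIV" by (rule L2_diff[OF e T])
  have "(\<lambda>n. \<integral>x. \<bar>w n x\<bar> \<partial>lebesgue) \<longlonglongrightarrow> 0"
    unfolding w_def by (rule conv_tendsto_L1[OF fi supp \<rho>])
  then have "\<forall>\<^sub>F n in sequentially. (\<integral>x. \<bar>w n x\<bar> \<partial>lebesgue) < \<delta> / (2 * (real k + 1))"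
    by (rule order_tendstoD) (use \<open>\<delta> > 0\<close> in simp)
  then obtain N where N: "\<And>n. n \<ge> N \<Longrightarrow> (\<integral>x. \<bar>w n x\<bar> \<partial>lebesgue) < \<delta> / (2 * (real k + 1))"
    by (auto simp: eventually_sequentially)
  have "norm (L2_inner UNIV e (conv f (\<rho> n)) - L2_inner UNIV e f) < \<delta>" if "n \<ge> N" for n
  proof -
    have wi: "integrable lebesgue (w n)"
      unfolding w_def using conv_L1_bound(1)[OF \<rho> fi] fi by simp
    have eq1: "L2_inner UNIV e (conv f (\<rho> n)) - L2_inner UNIV e f = L2_inner UNIV e (w n)"
      unfolding w_def by (rule L2_inner_diff_right[OF c(1) f e, symmetric])
    have eq2: "L2_inner UNIV e (w n) = L2_inner UNIV (\<lambda>x. e x - T k x) (w n) + L2_inner UNIV (T k) (w n)"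
      by (simp add: L2_inner_diff_left[OF e T w])
    have le1: "\<bar>L2_inner UNIV (\<lambda>x. e x - T k x) (w n)\<bar> \<le> \<delta> / (2 * (K + 1)) * K"
      by (rule order_trans[OF L2_Cauchy_Schwarz[OF eT w]], intro mult_mono)
        (use k wK K \<open>\<delta> > 0\<close> in auto)
    have le2: "\<delta> / (2 * (K + 1)) * K < \<delta> / 2" using \<open>\<delta> > 0\<close> K by (simp add: field_simps)
    have le3: "\<bar>L2_inner UNIV (T k) (w n)\<bar> \<le> \<delta> / 2"
    proof -
      have "\<bar>L2_inner UNIV (T k) (w n)\<bar> \<le> (\<integral>x. \<bar>T k x * w n x\<bar> \<partial>lebesgue)"
        unfolding L2_inner_def lebesgue_on_UNIV_eq inner_real_def by (rule integral_abs_bound)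
      also have "\<dots> \<le> (\<integral>x. real k * \<bar>w n x\<bar> \<partial>lebesgue)"
      proof (rule Bochner_Integration.integral_mono)
        show "integrable lebesgue (\<lambda>x. \<bar>T k x * w n x\<bar>)"
          using L2_inner_integrable[OF T w] by (intro integrable_abs) (simp add: lebesgue_on_UNIV_eq)
        show "integrable lebesgue (\<lambda>x. real k * \<bar>w n x\<bar>)" using wi by simp
        show "\<bar>T k x * w n x\<bar> \<le> real k * \<bar>w n x\<bar>" for x
          unfolding abs_mult by (rule mult_right_mono) (auto simp: T_def max_def min_def)
      qed
      also have "\<dots> = real k * (\<integral>x. \<bar>w n x\<bar> \<partial>lebesgue)" by simp
      also have "\<dots> \<le> real k * (\<delta> / (2 * (real k + 1)))"
        using N[OF that] by (intro mult_left_mono) auto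
      also have "\<dots> \<le> \<delta> / 2" using \<open>\<delta> > 0\<close> by (simp add: field_simps)
      finally show ?thesis .
    qed
    show ?thesis unfolding eq1 eq2 real_norm_def using le1 le2 le3 by linarith
  qed
  then show "\<exists>no. \<forall>n\<ge>no. norm (L2_inner UNIV e (conv f (\<rho> n)) - L2_inner UNIV e f) < \<delta>" by blast
qed

section \<open>Weak gradients\<close>

definition grad :: "('a::euclidean_space \<Rightarrow> real) \<Rightarrow> 'a \<Rightarrow> 'a" where
  "grad \<phi> x = (\<Sum>i\<in>Basis. pd i \<phi> x *\<^sub>R i)"

lemma grad_component: "i \<in> Basis \<Longrightarrow> grad \<phi> x \<bullet> i = pd i \<phi> x"
  by (simp add: grad_def)

lemma grad_eq_0_iff: "grad \<phi> x = 0 \<longleftrightarrow> (\<forall>i\<in>Basis. pd i \<phi> x = 0)"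
  by (auto simp: euclidean_eq_iff[of "grad \<phi> x"] grad_component)

lemma smooth_has_derivative_grad: "smooth f \<Longrightarrow> (f has_derivative (\<lambda>h. grad f x \<bullet> h)) (at x)"
proof -
  assume "smooth f"
  moreover have "grad f x \<bullet> h = (\<Sum>i\<in>Basis. (h \<bullet> i) * pd i f x)" for h
    by (subst inner_commute) (simp add: grad_def inner_sum_right mult.commute)
  ultimately show ?thesis using smooth_has_derivative[of f x] by simp
qed

lemma test_functions_iff:
  "\<phi> \<in> test_functions U \<longleftrightarrow> smooth \<phi> \<and> bounded {x. \<phi> x \<noteq> 0} \<and> closure {x. \<phi> x \<noteq> 0} \<subseteq> U"
  by (auto simp: test_functions_def smooth_def compact_closure)

lemma has_weak_gradient_iff:
  "has_weak_gradient U u G \<longleftrightarrow>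
    (\<forall>\<phi> \<in> test_functions U. \<forall>i \<in> Basis. L2_inner U u (pd i \<phi>) = - L2_inner U (\<lambda>x. G x \<bullet> i) \<phi>)"
  by (simp add: has_weak_gradient_def L2_inner_def pd_def)

lemma smooth_L2:
  assumes s: "smooth \<phi>" and b: "bounded {x. \<phi> x \<noteq> 0}"
  shows "\<phi> \<in> L2_space UNIV"
proof -
  have "{x. (\<phi> x)\<^sup>2 \<noteq> 0} = {x. \<phi> x \<noteq> 0}" by simp
  then have "integrable lebesgue (\<lambda>x. (\<phi> x)\<^sup>2)"
    using b smooth_continuous[OF s]
    by (intro integrable_bounded_support continuous_on_power) simp_all
  then show ?thesis
    using continuous_measurable_lebesgue[OF smooth_continuous[OF s]]
    by (simp add: L2_space_def lebesgue_on_UNIV_eq)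
qed

lemma L2_sum:
  assumes "finite I" "\<And>i. i \<in> I \<Longrightarrow> f i \<in> L2_space S"
  shows "(\<lambda>x. \<Sum>i\<in>I. f i x) \<in> L2_space S"
  using assms
proof (induction I)
  case empty
  then show ?case by (simp add: L2_space_def)
qed (simp add: L2_add)

lemma smooth_grad_L2:
  assumes s: "smooth \<phi>" and b: "bounded {x. \<phi> x \<noteq> 0}"
  shows "grad \<phi> \<in> L2_space UNIV"
  unfolding grad_def[abs_def]
proof (rule L2_sum)
  fix i :: 'a assume i: "i \<in> Basis"
  show "(\<lambda>x. pd i \<phi> x *\<^sub>R i) \<in> L2_space UNIV"
    by (rule L2_mult_bounded[OF smooth_L2[OF smooth_pd[OF s i] pd_bounded_support[OF b]]]) auto
qed simp

lemma L2_UNIV_restrict: "f \<in> L2_space UNIV \<Longrightarrow> S \<in> sets lebesgue \<Longrightarrow> f \<in> L2_space S"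
  by (rule L2_restrict[where T=UNIV]) auto

lemma test_L2:
  assumes "open U" "\<phi> \<in> test_functions V"
  shows "\<phi> \<in> L2_space U" "grad \<phi> \<in> L2_space U" "i \<in> Basis \<Longrightarrow> pd i \<phi> \<in> L2_space U"
proof -
  have U: "U \<in> sets lebesgue" using assms(1) by simp
  have \<phi>: "smooth \<phi>" "bounded {x. \<phi> x \<noteq> 0}" using assms(2) by (simp_all add: test_functions_iff)
  show "\<phi> \<in> L2_space U" by (rule L2_UNIV_restrict[OF smooth_L2[OF \<phi>] U])
  show "grad \<phi> \<in> L2_space U" by (rule L2_UNIV_restrict[OF smooth_grad_L2[OF \<phi>] U])
  show "pd i \<phi> \<in> L2_space U" if "i \<in> Basis"
    by (rule L2_UNIV_restrict[OF smooth_L2[OF smooth_pd[OF \<phi>(1) that] pd_bounded_support[OF \<phi>(2)]] U])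
qed

lemma test_zero_outside:
  assumes "\<phi> \<in> test_functions U" "x \<notin> U"
  shows "\<phi> x = 0" "pd i \<phi> x = 0" "grad \<phi> x = 0"
  using assms closure_subset[of "{x. \<phi> x \<noteq> 0}"] pd_support[of _ \<phi>]
  by (auto simp: test_functions_iff grad_eq_0_iff)

text \<open>The third assumption packs two conditions into one equivalence: from right to left it
  gives \<open>T \<subseteq> S\<close>, from left to right it makes the integrand vanish on
  \<open>S - T\<close>.\<close>

lemma L2_inner_support:
  assumes "S \<in> sets lebesgue" "T \<in> sets lebesgue" "\<And>x. x \<in> S \<longleftrightarrow> x \<in> T \<or> f x \<bullet> g x = 0 \<and> x \<in> S"
  shows "L2_inner S f g = L2_inner T f g"
  unfolding L2_inner_indicator[OF assms(1)] L2_inner_indicator[OF assms(2)]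
  by (rule Bochner_Integration.integral_cong) (use assms(3) in \<open>auto simp: indicator_def\<close>)

lemma L2_inner_UNIV_support:
  assumes "T \<in> sets lebesgue" "\<And>x. x \<notin> T \<Longrightarrow> f x \<bullet> g x = 0"
  shows "L2_inner UNIV f g = L2_inner T f g"
  by (rule L2_inner_support) (use assms in auto)

lemma smooth_mult_test:
  assumes "smooth \<zeta>" "\<phi> \<in> test_functions U"
  shows "(\<lambda>x. \<zeta> x * \<phi> x) \<in> test_functions U"
proof -
  have sub: "{x. \<zeta> x * \<phi> x \<noteq> 0} \<subseteq> {x. \<phi> x \<noteq> 0}" by auto
  show ?thesis
    using assms smooth_mult[of \<zeta> \<phi>] bounded_subset[OF _ sub] closure_mono[OF sub]
    by (auto simp: test_functions_iff)
qed

text \<open>Integration by parts is the vanishing integral of \<open>pd i\<close> of the product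
  with the test function. Bounded support of \<open>\<psi>\<close> makes both terms integrable
  whatever the growth of \<open>\<phi>\<close>.\<close>

lemma smooth_has_weak_gradient:
  assumes s: "smooth \<phi>" and "open U"
  shows "has_weak_gradient U \<phi> (grad \<phi>)"
  unfolding has_weak_gradient_iff
proof safe
  fix \<psi> and i :: 'a assume psi: "\<psi> \<in> test_functions U" and i: "i \<in> Basis"
  have U: "U \<in> sets lebesgue" using \<open>open U\<close> by simp
  have psi': "smooth \<psi>" "bounded {x. \<psi> x \<noteq> 0}" using psi by (auto simp: test_functions_iff)
  have pr: "smooth (\<lambda>x. \<phi> x * \<psi> x)" "bounded {x. \<phi> x * \<psi> x \<noteq> 0}"
    using smooth_mult_test[OF s psi] by (auto simp: test_functions_iff)
  have b1: "integrable lebesgue (\<lambda>x. \<phi> x * pd i \<psi> x)"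
  proof (rule integrable_bounded_support)
    show "continuous_on UNIV (\<lambda>x. \<phi> x * pd i \<psi> x)"
      by (intro continuous_on_mult smooth_continuous s smooth_pd psi' i)
    show "bounded {x. \<phi> x * pd i \<psi> x \<noteq> 0}"
      by (rule bounded_subset[OF pd_bounded_support[OF psi'(2), of i]]) auto
  qed
  have b2: "integrable lebesgue (\<lambda>x. pd i \<phi> x * \<psi> x)"
  proof (rule integrable_bounded_support)
    show "continuous_on UNIV (\<lambda>x. pd i \<phi> x * \<psi> x)"
      by (intro continuous_on_mult smooth_continuous s smooth_pd psi' i)
    show "bounded {x. pd i \<phi> x * \<psi> x \<noteq> 0}"
      by (rule bounded_subset[OF psi'(2)]) auto
  qed
  have "(\<integral>x. \<phi> x * pd i \<psi> x + pd i \<phi> x * \<psi> x \<partial>lebesgue) = (\<integral>x. pd i (\<lambda>x. \<phi> x * \<psi> x) x \<partial>lebesgue)"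
    by (simp add: pd_mult smooth_differentiable s psi'(1))
  also have "\<dots> = 0" by (rule integral_pd_eq_0[OF pr i])
  finally have "(\<integral>x. \<phi> x * pd i \<psi> x \<partial>lebesgue) + (\<integral>x. pd i \<phi> x * \<psi> x \<partial>lebesgue) = 0"
    using b1 b2 by simp
  then have "L2_inner UNIV \<phi> (pd i \<psi>) = - L2_inner UNIV (pd i \<phi>) \<psi>"
    by (simp add: L2_inner_def lebesgue_on_UNIV_eq)
  moreover have "L2_inner UNIV \<phi> (pd i \<psi>) = L2_inner U \<phi> (pd i \<psi>)"
    by (rule L2_inner_UNIV_support[OF U]) (simp add: test_zero_outside[OF psi])
  moreover have "L2_inner UNIV (pd i \<phi>) \<psi> = L2_inner U (pd i \<phi>) \<psi>"
    by (rule L2_inner_UNIV_support[OF U]) (simp add: test_zero_outside[OF psi])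
  ultimately show "L2_inner U \<phi> (pd i \<psi>) = - L2_inner U (\<lambda>x. grad \<phi> x \<bullet> i) \<psi>"
    by (simp add: grad_component i)
qed

text \<open>The factor \<open>\<zeta>\<close> is moved onto the test function:
  \<open>\<zeta> * \<psi>\<close> is again admissible, and \<open>\<zeta> * pd i \<psi>\<close>
  differs from its derivative by \<open>pd i \<zeta> * \<psi>\<close>.\<close>

lemma mult_has_weak_gradient:
  fixes u :: "'a::euclidean_space \<Rightarrow> real"
  assumes wg: "has_weak_gradient U u G" and u: "u \<in> L2_space U" and G: "G \<in> L2_space U"
    and s: "smooth \<zeta>" and "open U"
  shows "has_weak_gradient U (\<lambda>x. \<zeta> x * u x) (\<lambda>x. \<zeta> x *\<^sub>R G x + u x *\<^sub>R grad \<zeta> x)"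
  unfolding has_weak_gradient_iff
proof safe
  fix \<psi> and i :: 'a assume psi: "\<psi> \<in> test_functions U" and i: "i \<in> Basis"
  have psi': "smooth \<psi>" using psi by (auto simp: test_functions_iff)
  note pr = smooth_mult_test[OF s psi]
  have t2: "(\<lambda>x. pd i \<zeta> x * \<psi> x) \<in> test_functions U"
    by (rule smooth_mult_test[OF smooth_pd[OF s i] psi])
  have pd: "pd i (\<lambda>x. \<zeta> x * \<psi> x) = (\<lambda>x. \<zeta> x * pd i \<psi> x + pd i \<zeta> x * \<psi> x)"
    by (rule ext) (simp add: pd_mult smooth_differentiable s psi')
  have i1: "integrable (lebesgue_on U) (\<lambda>x. u x * pd i (\<lambda>x. \<zeta> x * \<psi> x) x)"
    using L2_inner_integrable[OF u test_L2(3)[OF \<open>open U\<close> pr i]] by simp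
  have i2: "integrable (lebesgue_on U) (\<lambda>x. u x * (pd i \<zeta> x * \<psi> x))"
    using L2_inner_integrable[OF u test_L2(1)[OF \<open>open U\<close> t2]] by simp
  have i3: "integrable (lebesgue_on U) (\<lambda>x. (G x \<bullet> i) * (\<zeta> x * \<psi> x))"
    using L2_inner_integrable[OF L2_component[OF G] test_L2(1)[OF \<open>open U\<close> pr]] by simp
  have "L2_inner U (\<lambda>x. \<zeta> x * u x) (pd i \<psi>) =
      (\<integral>x. u x * pd i (\<lambda>x. \<zeta> x * \<psi> x) x - u x * (pd i \<zeta> x * \<psi> x) \<partial>lebesgue_on U)"
    unfolding L2_inner_def pd by (simp add: algebra_simps)
  also have "\<dots> = L2_inner U u (pd i (\<lambda>x. \<zeta> x * \<psi> x)) - (\<integral>x. u x * (pd i \<zeta> x * \<psi> x) \<partial>lebesgue_on U)"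
    unfolding L2_inner_def inner_real_def by (rule Bochner_Integration.integral_diff[OF i1 i2])
  also have "L2_inner U u (pd i (\<lambda>x. \<zeta> x * \<psi> x)) = - L2_inner U (\<lambda>x. G x \<bullet> i) (\<lambda>x. \<zeta> x * \<psi> x)"
    using wg pr i unfolding has_weak_gradient_iff by blast
  finally have "L2_inner U (\<lambda>x. \<zeta> x * u x) (pd i \<psi>) =
      - ((\<integral>x. (G x \<bullet> i) * (\<zeta> x * \<psi> x) \<partial>lebesgue_on U) + (\<integral>x. u x * (pd i \<zeta> x * \<psi> x) \<partial>lebesgue_on U))"
    by (simp add: L2_inner_def)
  also have "\<dots> = - (\<integral>x. (G x \<bullet> i) * (\<zeta> x * \<psi> x) + u x * (pd i \<zeta> x * \<psi> x) \<partial>lebesgue_on U)"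
    using i2 i3 by simp
  also have "\<dots> = - L2_inner U (\<lambda>x. (\<zeta> x *\<^sub>R G x + u x *\<^sub>R grad \<zeta> x) \<bullet> i) \<psi>"
    unfolding L2_inner_def by (simp add: inner_add_left grad_component i algebra_simps)
  finally show "L2_inner U (\<lambda>x. \<zeta> x * u x) (pd i \<psi>) =
      - L2_inner U (\<lambda>x. (\<zeta> x *\<^sub>R G x + u x *\<^sub>R grad \<zeta> x) \<bullet> i) \<psi>" .
qed

text \<open>A compact subset of an open set keeps a positive distance \<epsilon> from the
  complement, so kernels of radius below \<epsilon> do not push the support out of
  \<open>U\<close>.\<close>

lemma conv_test_function:
  fixes f :: "'a::euclidean_space \<Rightarrow> real"
  assumes "open U" "compact K" "K \<subseteq> U" "\<And>x. x \<notin> K \<Longrightarrow> f x = 0" and f: "integrable lebesgue f"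
  obtains N where "\<And>n \<rho>. n \<ge> N \<Longrightarrow> mollifier (1 / real (Suc n)) \<rho> \<Longrightarrow> conv f \<rho> \<in> test_functions U"
proof -
  obtain \<epsilon> where e: "\<epsilon> > 0" "(\<Union>x\<in>K. cball x \<epsilon>) \<subseteq> U"
    using compact_subset_open_imp_cball_epsilon_subset[OF assms(2,1,3)] by blast
  obtain N where N: "1 / real (Suc N) < \<epsilon>" using nat_approx_posE[OF e(1)] by metis
  \<comment> \<open>The sum of \<open>K\<close> and a closed ball is compact, hence closed, so it
    contains the closure of the support and not just the support.\<close>
  let ?K = "\<Union>x\<in>K. \<Union>y\<in>cball 0 \<epsilon>. {x + y}"
  have K: "compact ?K" by (rule compact_sums'[OF assms(2)]) simp
  have KU: "?K \<subseteq> U" using e(2) by (fastforce simp: dist_norm)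
  have "conv f \<rho> \<in> test_functions U" if n: "n \<ge> N" and \<rho>: "mollifier (1 / real (Suc n)) \<rho>" for n \<rho>
  proof -
    have r: "1 / real (Suc n) \<le> 1 / real (Suc N)" using n by (simp add: frac_le)
    have sub: "{x. conv f \<rho> x \<noteq> 0} \<subseteq> ?K"
    proof
      fix x assume "x \<in> {x. conv f \<rho> x \<noteq> 0}"
      then obtain y where y: "dist x y < 1 / real (Suc n)" "f y \<noteq> 0"
        using conv_support[OF \<rho>, of x f] by blast
      then have "y \<in> K" using assms(4) by blast
      have "norm (x - y) \<le> \<epsilon>" using y(1) r N unfolding dist_norm by linarith
      then have "x - y \<in> cball 0 \<epsilon>" by simp
      moreover have "x = y + (x - y)" by simp
      ultimately show "x \<in> ?K" using \<open>y \<in> K\<close> by blast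
    qed
    have "closure {x. conv f \<rho> x \<noteq> 0} \<subseteq> ?K"
      by (rule closure_minimal[OF sub compact_imp_closed[OF K]])
    then show ?thesis
      using mollifier_conv_smooth[OF \<rho> f] bounded_subset[OF compact_imp_bounded[OF K] sub] KU
      by (auto simp: test_functions_iff)
  qed
  then show ?thesis by (rule that)
qed

section \<open>Uniqueness of the weak gradient\<close>

lemma ex_mollifier_sequence:
  "\<exists>\<rho> :: nat \<Rightarrow> 'a::euclidean_space \<Rightarrow> real. \<forall>n. mollifier (1 / real (Suc n)) (\<rho> n)"
proof (rule choice, rule allI)
  fix n :: nat
  show "\<exists>\<rho> :: 'a \<Rightarrow> real. mollifier (1 / real (Suc n)) \<rho>"
  proof (rule ex_mollifier)
    show "0 < 1 / real (Suc n)" by simp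
    show "\<exists>\<rho> :: 'a \<Rightarrow> real. mollifier (1 / real (Suc n)) \<rho>"
      if "mollifier (1 / real (Suc n)) \<rho>" for \<rho> :: "'a \<Rightarrow> real" using that by blast
  qed
qed

lemma L2_extend:
  fixes f :: "'a::euclidean_space \<Rightarrow> 'b::euclidean_space"
  assumes f: "f \<in> L2_space U" and U: "U \<in> sets lebesgue"
  shows "(\<lambda>x. indicator U x *\<^sub>R f x) \<in> L2_space UNIV"
proof -
  have m: "(\<lambda>x. indicator U x *\<^sub>R f x) \<in> borel_measurable lebesgue"
    using L2_measurable[OF f] U by (subst (asm) borel_measurable_restrict_space_iff) auto
  have "integrable lebesgue (\<lambda>x. indicator U x *\<^sub>R (norm (f x))\<^sup>2)"
    using L2_norm_integrable[OF f] U by (subst (asm) integrable_restrict_space) auto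
  also have "(\<lambda>x. indicator U x *\<^sub>R (norm (f x))\<^sup>2) = (\<lambda>x. (norm (indicator U x *\<^sub>R f x))\<^sup>2)"
    by (auto simp: indicator_def)
  finally show ?thesis using m by (simp add: L2_space_def lebesgue_on_UNIV_eq)
qed

lemma L2_inner_extend:
  assumes "U \<in> sets lebesgue"
  shows "L2_inner UNIV (\<lambda>x. indicator U x *\<^sub>R f x) g = L2_inner U f g"
proof -
  have "L2_inner UNIV (\<lambda>x. indicator U x *\<^sub>R f x) g = L2_inner U (\<lambda>x. indicator U x *\<^sub>R f x) g"
    by (rule L2_inner_UNIV_support[OF assms]) simp
  also have "\<dots> = L2_inner U f g"
    unfolding L2_inner_indicator[OF assms]
    by (rule Bochner_Integration.integral_cong) (auto simp: indicator_def)
  finally show ?thesis .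
qed

text \<open>Testing against mollifications of \<open>H\<close> restricted to compact sets gives \<open>\<integral>\<^bsub>K\<^esub> H\<^sup>2 = 0\<close>.\<close>

lemma test_functions_separate:
  fixes H :: "'a::euclidean_space \<Rightarrow> real"
  assumes "open U" and H: "H \<in> L2_space U" and ortho: "\<And>\<phi>. \<phi> \<in> test_functions U \<Longrightarrow> L2_inner U H \<phi> = 0"
  shows "AE x in lebesgue_on U. H x = 0"
proof -
  have U: "U \<in> sets lebesgue" using \<open>open U\<close> by simp
  define H' where "H' x = indicator U x *\<^sub>R H x" for x
  have H': "H' \<in> L2_space UNIV" unfolding H'_def by (rule L2_extend[OF H U])
  obtain \<rho> :: "nat \<Rightarrow> 'a \<Rightarrow> real" where \<rho>: "\<And>n. mollifier (1 / real (Suc n)) (\<rho> n)"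
    using ex_mollifier_sequence by blast
  have compact: "AE x in lebesgue. x \<in> K \<longrightarrow> H x = 0" if K: "compact K" "K \<subseteq> U" for K
  proof -
    define f where "f x = indicator K x *\<^sub>R H' x" for x
    have Kl: "K \<in> sets lebesgue" using K(1) by (simp add: compact_imp_closed)
    have f: "f \<in> L2_space UNIV" unfolding f_def
      by (rule L2_extend[OF L2_UNIV_restrict[OF H' Kl] Kl])
    obtain R where R: "K \<subseteq> cball 0 R" using bounded_subset_cball_0 compact_imp_bounded K(1) by blast
    have f0: "f x = 0" if "x \<notin> K" for x using that by (simp add: f_def)
    have fR: "f x = 0" if "R < norm x" for x using that R by (intro f0) auto
    have fi: "integrable lebesgue f" by (rule L2_integrable_bounded_support[OF f fR])
    obtain N where N: "\<And>n \<rho>. n \<ge> N \<Longrightarrow> mollifier (1 / real (Suc n)) \<rho> \<Longrightarrow> conv f \<rho> \<in> test_functions U"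
      using conv_test_function[OF \<open>open U\<close> K f0 fi] by blast
    have lim: "(\<lambda>n. L2_inner UNIV H' (conv f (\<rho> n))) \<longlonglongrightarrow> L2_inner UNIV H' f"
      by (rule conv_weak_tendsto[OF f fR \<rho> H'])
    have "L2_inner UNIV H' (conv f (\<rho> n)) = 0" if "n \<ge> N" for n
      unfolding H'_def L2_inner_extend[OF U] by (rule ortho[OF N[OF that \<rho>]])
    then have "(\<lambda>n. L2_inner UNIV H' (conv f (\<rho> n))) \<longlonglongrightarrow> 0"
      by (intro tendsto_eventually) (auto simp: eventually_sequentially)
    then have "L2_inner UNIV H' f = 0" using lim LIMSEQ_unique by blast
    also have "L2_inner UNIV H' f = (\<integral>x. (f x)\<^sup>2 \<partial>lebesgue)"
      unfolding L2_inner_def lebesgue_on_UNIV_eq f_def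
      by (rule Bochner_Integration.integral_cong) (auto simp: power2_eq_square indicator_def)
    finally have "AE x in lebesgue. (f x)\<^sup>2 = 0"
      using f by (subst (asm) integral_nonneg_eq_0_iff_AE) (auto simp: L2_space_def lebesgue_on_UNIV_eq)
    then show ?thesis
    proof (rule AE_mp, intro AE_I2 impI)
      fix x assume "(f x)\<^sup>2 = 0" "x \<in> K"
      then show "H x = 0" using K(2) by (auto simp: f_def H'_def)
    qed
  qed
  \<comment> \<open>Countably many compact sets exhaust \<open>U\<close>, so their exceptional null
    sets combine into one.\<close>
  obtain C :: "nat \<Rightarrow> 'a set" where C: "\<And>n. compact (C n)" "\<And>n. C n \<subseteq> U" "\<Union>(range C) = U"
    using open_Union_compact_subsets[OF \<open>open U\<close>] by metis
  have "AE x in lebesgue. \<forall>n. x \<in> C n \<longrightarrow> H x = 0"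
    unfolding AE_all_countable using compact C by blast
  then have "AE x in lebesgue. x \<in> U \<longrightarrow> H x = 0"
    by (rule AE_mp, intro AE_I2 impI) (use C(3) in blast)
  then show ?thesis using U by (subst AE_restrict_space_iff) auto
qed

text \<open>Each component of the difference annihilates all test functions. This is what makes the
  choice in \<open>weak_gradient\<close> harmless.\<close>

lemma weak_gradient_unique:
  fixes G :: "'a::euclidean_space \<Rightarrow> 'a"
  assumes "open U" "has_weak_gradient U u G" "has_weak_gradient U u G'"
    "G \<in> L2_space U" "G' \<in> L2_space U"
  shows "AE x in lebesgue_on U. G x = G' x"
proof -
  have "AE x in lebesgue_on U. G x \<bullet> i = G' x \<bullet> i" if i: "i \<in> Basis" for i
  proof -
    have "AE x in lebesgue_on U. G x \<bullet> i - G' x \<bullet> i = 0"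
    proof (rule test_functions_separate[OF \<open>open U\<close>])
      show "(\<lambda>x. G x \<bullet> i - G' x \<bullet> i) \<in> L2_space U"
        using assms by (intro L2_diff L2_component)
      fix \<phi> assume \<phi>: "\<phi> \<in> test_functions U"
      have "L2_inner U (\<lambda>x. G x \<bullet> i) \<phi> = L2_inner U (\<lambda>x. G' x \<bullet> i) \<phi>"
        using assms(2,3) \<phi> i unfolding has_weak_gradient_iff by (metis neg_equal_iff_equal)
      then show "L2_inner U (\<lambda>x. G x \<bullet> i - G' x \<bullet> i) \<phi> = 0"
        using assms by (subst L2_inner_diff_left) (auto intro: L2_component test_L2(1)[OF \<open>open U\<close> \<phi>])
    qed
    then show ?thesis by (rule AE_mp) (auto intro!: AE_I2)
  qed
  then have "AE x in lebesgue_on U. \<forall>i\<in>Basis. G x \<bullet> i = G' x \<bullet> i"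
    by (subst AE_finite_all) auto
  then show ?thesis by (rule AE_mp, intro AE_I2 impI) (rule euclidean_eqI, blast)
qed

lemma weak_gradient_H1:
  assumes "u \<in> H1 U"
  shows "weak_gradient U u \<in> L2_space U" "has_weak_gradient U u (weak_gradient U u)"
  using assms someI_ex[of "\<lambda>G. G \<in> L2_space U \<and> has_weak_gradient U u G"]
  by (auto simp: H1_def weak_gradient_def)

text \<open>Lets an explicitly computed candidate stand in for the chosen gradient, up to a null
  set.\<close>

lemma weak_gradient_AE:
  assumes "open U" "u \<in> L2_space U" "G \<in> L2_space U" "has_weak_gradient U u G"
  shows "u \<in> H1 U" "AE x in lebesgue_on U. weak_gradient U u x = G x"
proof -
  show H: "u \<in> H1 U" using assms by (auto simp: H1_def)
  show "AE x in lebesgue_on U. weak_gradient U u x = G x"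
    using weak_gradient_unique[OF assms(1) weak_gradient_H1(2)[OF H] assms(4) weak_gradient_H1(1)[OF H] assms(3)] .
qed

lemma test_H1:
  assumes "open U" "\<phi> \<in> test_functions V"
  shows "\<phi> \<in> H1 U" "AE x in lebesgue_on U. weak_gradient U \<phi> x = grad \<phi> x"
  using weak_gradient_AE[OF assms(1) test_L2(1,2)[OF assms] smooth_has_weak_gradient[OF _ assms(1)]]
    assms(2) by (auto simp: test_functions_iff)

lemma dirichlet_form_test:
  assumes "open U" "u \<in> H1 U" "\<phi> \<in> test_functions V"
  shows "dirichlet_form U u \<phi> = L2_inner U (weak_gradient U u) (grad \<phi>)"
  unfolding dirichlet_form_def
  by (rule L2_inner_cong_AE)
    (use assms test_H1[OF assms(1,3)] test_L2[OF assms(1,3)] in \<open>auto intro: weak_gradient_H1(1)\<close>)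

lemma diff_has_weak_gradient:
  assumes "open U" "u \<in> L2_space U" "v \<in> L2_space U" "G \<in> L2_space U" "F \<in> L2_space U"
    "has_weak_gradient U u G" "has_weak_gradient U v F"
  shows "has_weak_gradient U (\<lambda>x. u x - v x) (\<lambda>x. G x - F x)"
  unfolding has_weak_gradient_iff
proof safe
  fix \<phi> and i :: 'a assume \<phi>: "\<phi> \<in> test_functions U" and i: "i \<in> Basis"
  note t = test_L2[OF assms(1) \<phi>]
  have "L2_inner U (\<lambda>x. u x - v x) (pd i \<phi>) = L2_inner U u (pd i \<phi>) - L2_inner U v (pd i \<phi>)"
    by (rule L2_inner_diff_left[OF assms(2,3) t(3)[OF i]])
  also have "\<dots> = - (L2_inner U (\<lambda>x. G x \<bullet> i) \<phi> - L2_inner U (\<lambda>x. F x \<bullet> i) \<phi>)"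
    using assms(6,7) \<phi> i unfolding has_weak_gradient_iff by simp
  also have "\<dots> = - L2_inner U (\<lambda>x. (G x - F x) \<bullet> i) \<phi>"
    unfolding inner_diff_left
    by (subst L2_inner_diff_left[OF L2_component[OF assms(4)] L2_component[OF assms(5)] t(1)]) simp
  finally show "L2_inner U (\<lambda>x. u x - v x) (pd i \<phi>) = - L2_inner U (\<lambda>x. (G x - F x) \<bullet> i) \<phi>" .
qed

text \<open>The function approximates itself. The zero norm of the difference still takes an
  argument, since the gradient chosen for the zero function is 0 only almost everywhere.\<close>

lemma test_H10:
  assumes "open U" "\<phi> \<in> test_functions U"
  shows "\<phi> \<in> H10 U"
proof -
  have "norm_H1 U (\<lambda>x. \<phi> x - \<phi> x) = 0"
  proof -
    have z: "(\<lambda>x. 0) \<in> L2_space U" by (simp add: L2_space_def)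
    have z2: "(\<lambda>x. 0::'a) \<in> L2_space U" by (simp add: L2_space_def)
    have zw: "has_weak_gradient U (\<lambda>x. 0) (\<lambda>x. 0)" by (simp add: has_weak_gradient_def)
    note w = weak_gradient_AE[OF assms(1) z z2 zw]
    have "L2_inner U (weak_gradient U (\<lambda>x. 0)) (weak_gradient U (\<lambda>x. 0)) = L2_inner U (\<lambda>x. 0::'a) (\<lambda>x. 0)"
      by (rule L2_inner_cong_AE[OF w(2) w(2) weak_gradient_H1(1)[OF w(1)] z2 weak_gradient_H1(1)[OF w(1)] z2])
    then show ?thesis by (simp add: norm_H1_def norm_L2_sq L2_inner_def)
  qed
  then show ?thesis using test_H1(1)[OF assms] assms(2) unfolding H10_def by force
qed

section \<open>Weak approximation by test functions\<close>

lemma smooth_reflect: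
  assumes "smooth \<rho>"
  shows "smooth (\<lambda>y. \<rho> (x - y))" and "pd i (\<lambda>y. \<rho> (x - y)) y = - pd i \<rho> (x - y)"
proof -
  have d: "((\<lambda>y. c * \<phi> (x - y)) has_derivative (\<lambda>h. c * (grad \<phi> (x - y) \<bullet> (- h)))) (at y)"
    if "smooth \<phi>" for \<phi> y and c :: real
  proof -
    have "((\<lambda>y. x - y) has_derivative (\<lambda>h. - h)) (at y)"
      by (auto intro!: derivative_eq_intros)
    from has_derivative_compose[OF this smooth_has_derivative_grad[OF that]]
    show ?thesis by (rule has_derivative_mult_right)
  qed
  have pd: "pd i (\<lambda>y. c * \<phi> (x - y)) y = - c * pd i \<phi> (x - y)" if "smooth \<phi>" for \<phi> y i and c :: real
    using pd_eqI[OF d[OF that], of i] pd_eqI[OF smooth_has_derivative_grad[OF that], of i] by simp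
  \<comment> \<open>The scalar \<open>c\<close> absorbs the sign that every differentiation of the
    reflected argument produces.\<close>
  let ?F = "{\<lambda>y. c * \<phi> (x - y) | c \<phi>. smooth \<phi>}"
  show "smooth (\<lambda>y. \<rho> (x - y))"
  proof (rule smoothI[where F="?F"])
    have "(\<lambda>y. \<rho> (x - y)) = (\<lambda>y. 1 * \<rho> (x - y))" by simp
    then show "(\<lambda>y. \<rho> (x - y)) \<in> ?F" using assms by blast
    show "f differentiable (at y)" if "f \<in> ?F" for f y
      using that d unfolding differentiable_def by blast
    show "pd i f \<in> ?F" if "f \<in> ?F" "i \<in> Basis" for f i
    proof -
      from that(1) obtain c \<phi> where f: "f = (\<lambda>y. c * \<phi> (x - y))" "smooth \<phi>" by blast
      have "pd i f = (\<lambda>y. (- c) * pd i \<phi> (x - y))"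
        unfolding f(1) by (rule ext) (rule pd[OF f(2)])
      then show ?thesis using smooth_pd[OF f(2) that(2)] by blast
    qed
  qed
  show "pd i (\<lambda>y. \<rho> (x - y)) y = - pd i \<rho> (x - y)" using pd[OF assms, of i 1] by simp
qed

text \<open>The definition of weak gradient is applied to the test function
  \<open>\<rho> (x - y)\<close> in the variable \<open>y\<close>. The sign from the reflection
  cancels the sign from integration by parts.\<close>

lemma conv_weak_derivative:
  assumes wg: "has_weak_gradient UNIV z Z" and \<rho>: "mollifier r \<rho>" and i: "i \<in> Basis"
  shows "conv z (pd i \<rho>) x = conv (\<lambda>x. Z x \<bullet> i) \<rho> x"
proof -
  let ?\<psi> = "\<lambda>y. \<rho> (x - y)"
  have s: "smooth ?\<psi>" by (rule smooth_reflect(1)[OF mollifier_facts(1)[OF \<rho>]])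
  have "{y. ?\<psi> y \<noteq> 0} \<subseteq> cball x r"
  proof
    fix y assume y: "y \<in> {y. ?\<psi> y \<noteq> 0}"
    then have "\<not> r \<le> norm (x - y)" using mollifier_facts(3)[OF \<rho>] by blast
    then show "y \<in> cball x r" by (simp add: dist_norm)
  qed
  then have "bounded {y. ?\<psi> y \<noteq> 0}" using bounded_subset bounded_cball by blast
  then have "?\<psi> \<in> test_functions UNIV" using s by (simp add: test_functions_iff)
  then have "L2_inner UNIV z (pd i ?\<psi>) = - L2_inner UNIV (\<lambda>x. Z x \<bullet> i) ?\<psi>"
    using wg i unfolding has_weak_gradient_iff by blast
  moreover have "pd i ?\<psi> = (\<lambda>y. - pd i \<rho> (x - y))"
    by (rule ext) (rule smooth_reflect(2)[OF mollifier_facts(1)[OF \<rho>]])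
  ultimately show ?thesis
    by (simp add: L2_inner_def lebesgue_on_UNIV_eq conv_def)
qed

lemma L2_inner_component_sum:
  assumes E: "E \<in> L2_space S" and F: "F \<in> L2_space S"
  shows "L2_inner S E F = (\<Sum>i\<in>Basis. L2_inner S (\<lambda>x. E x \<bullet> i) (\<lambda>x. F x \<bullet> i))"
proof -
  have "integrable (lebesgue_on S) (\<lambda>x. (E x \<bullet> i) * (F x \<bullet> i))" for i
    using L2_inner_integrable[OF L2_component[OF E, of i] L2_component[OF F, of i]] by simp
  then show ?thesis
    unfolding L2_inner_def by (subst euclidean_inner) (simp add: Bochner_Integration.integral_sum)
qed

text \<open>The gradient of a mollification of \<open>z\<close> is the mollification of
  \<open>Z\<close>, component by component, so one scalar convergence result covers both
  limits.\<close>

lemma weak_test_approximation: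
  fixes z :: "'a::euclidean_space \<Rightarrow> real"
  assumes "open U" "compact K" "K \<subseteq> U"
    and z: "z \<in> L2_space UNIV" "\<And>x. x \<notin> K \<Longrightarrow> z x = 0"
    and Z: "Z \<in> L2_space UNIV" "\<And>x. x \<notin> K \<Longrightarrow> Z x = 0"
    and wg: "has_weak_gradient UNIV z Z"
  obtains \<phi> where "\<And>n::nat. \<phi> n \<in> test_functions U"
    "\<And>e. e \<in> L2_space UNIV \<Longrightarrow> (\<lambda>n. L2_inner UNIV e (\<phi> n)) \<longlonglongrightarrow> L2_inner UNIV e z"
    "\<And>E. E \<in> L2_space UNIV \<Longrightarrow> (\<lambda>n. L2_inner UNIV E (grad (\<phi> n))) \<longlonglongrightarrow> L2_inner UNIV E Z"
proof -
  obtain \<rho> :: "nat \<Rightarrow> 'a \<Rightarrow> real" where \<rho>: "\<And>n. mollifier (1 / real (Suc n)) (\<rho> n)"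
    using ex_mollifier_sequence by blast
  obtain R where R: "K \<subseteq> cball 0 R" using bounded_subset_cball_0 compact_imp_bounded assms(2) by blast
  have zR: "z x = 0" if "R < norm x" for x using that R by (intro z(2)) auto
  have ZR: "Z x \<bullet> i = 0" if "R < norm x" for x i using that R by (subst Z(2)) auto
  have zi: "integrable lebesgue z" by (rule L2_integrable_bounded_support[OF z(1) zR])
  obtain N where N: "\<And>n \<rho>. n \<ge> N \<Longrightarrow> mollifier (1 / real (Suc n)) \<rho> \<Longrightarrow> conv z \<rho> \<in> test_functions U"
    using conv_test_function[OF assms(1-3) z(2) zi] by blast
  show ?thesis
  \<comment> \<open>The shift by \<open>N\<close> drops the indices whose kernels are too wide for
    \<open>U\<close>.\<close>
  proof (rule that[of "\<lambda>n. conv z (\<rho> (n + N))"])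
    show t: "conv z (\<rho> (n + N)) \<in> test_functions U" for n by (rule N[OF _ \<rho>]) simp
    show "(\<lambda>n. L2_inner UNIV e (conv z (\<rho> (n + N)))) \<longlonglongrightarrow> L2_inner UNIV e z" if e: "e \<in> L2_space UNIV" for e
      by (rule LIMSEQ_ignore_initial_segment[OF conv_weak_tendsto[OF z(1) zR \<rho> e]])
    show "(\<lambda>n. L2_inner UNIV E (grad (conv z (\<rho> (n + N))))) \<longlonglongrightarrow> L2_inner UNIV E Z" if E: "E \<in> L2_space UNIV" for E
    proof -
      have c: "grad (conv z (\<rho> n)) x \<bullet> i = conv (\<lambda>x. Z x \<bullet> i) (\<rho> n) x" if i: "i \<in> Basis" for n x i
        using pd_conv[OF zi mollifier_facts(1)[OF \<rho>] mollifier_bounded_support[OF \<rho>] i]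
          conv_weak_derivative[OF wg \<rho> i] by (simp add: grad_component i)
      have eq: "L2_inner UNIV E (grad (conv z (\<rho> (n + N)))) =
          (\<Sum>i\<in>Basis. L2_inner UNIV (\<lambda>x. E x \<bullet> i) (conv (\<lambda>x. Z x \<bullet> i) (\<rho> (n + N))))" for n
        using L2_inner_component_sum[OF E test_L2(2)[OF open_UNIV t]] by (simp add: c)
      have "(\<lambda>n. L2_inner UNIV (\<lambda>x. E x \<bullet> i) (conv (\<lambda>x. Z x \<bullet> i) (\<rho> (n + N)))) \<longlonglongrightarrow>
          L2_inner UNIV (\<lambda>x. E x \<bullet> i) (\<lambda>x. Z x \<bullet> i)" for i
        by (rule LIMSEQ_ignore_initial_segment[OF conv_weak_tendsto[OF L2_component[OF Z(1)] ZR \<rho> L2_component[OF E]]])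
      then show ?thesis
        unfolding eq L2_inner_component_sum[OF E Z(1)] by (intro tendsto_sum)
    qed
  qed
qed

section \<open>Cutoff functions\<close>

text \<open>The segment from \<open>x\<close> to a nearest point of the complement crosses the
  frontier. This links the boundary layer, defined by the distance to the frontier, with the cutoff,
  built from the distance to the complement, which vanishes off \<open>U\<close>.\<close>

lemma infdist_frontier_le:
  fixes U :: "'a::euclidean_space set"
  assumes "open U" "x \<in> U" "- U \<noteq> {}"
  shows "infdist x (frontier U) \<le> infdist x (- U)"
proof -
  obtain y where y: "y \<in> - U" "infdist x (- U) = dist x y"
    using infdist_attains_inf[of "- U" x] assms by (auto simp: closed_Compl)
  have "closed_segment x y \<inter> frontier U \<noteq> {}"
    by (rule connected_Int_frontier) (use assms y in auto)
  then obtain z where z: "z \<in> closed_segment x y" "z \<in> frontier U" by blast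
  have "infdist x (frontier U) \<le> dist x z" using z(2) by (rule infdist_le)
  also have "\<dots> \<le> dist x y" using segment_bound1[OF z(1)] by (simp add: dist_norm norm_minus_commute)
  finally show ?thesis using y(2) by simp
qed

text \<open>After a reflection the convolution is an average of translates of \<open>f\<close>, each
  with the same Lipschitz constant.\<close>

lemma conv_Lipschitz:
  fixes f :: "'a::euclidean_space \<Rightarrow> real"
  assumes \<rho>: "mollifier r \<rho>" and f: "integrable lebesgue f"
    and L: "\<And>x y. \<bar>f x - f y\<bar> \<le> L * norm (x - y)"
  shows "\<bar>conv f \<rho> x - conv f \<rho> y\<bar> \<le> L * norm (x - y)"
proof -
  define d where "d = x - y"
  have Lip: "L-lipschitz_on UNIV f"
    using L L[of 0 "SOME i. i \<in> Basis"] by (intro lipschitz_onI)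
      (auto simp: dist_norm norm_some_Basis intro: order_trans[OF abs_ge_zero])
  have c: "continuous_on UNIV f" by (rule lipschitz_on_continuous_on[OF Lip])
  have [measurable]: "f \<in> borel_measurable borel" using c by (rule borel_measurable_continuous_onI)
  note [measurable] = mollifier_facts(6)[OF \<rho>]
  have eq: "conv f \<rho> a = (\<integral>u. f (a - u) * \<rho> u \<partial>lebesgue)" for a
    using integral_lebesgue_reflect[of "\<lambda>y. f y * \<rho> (a - y)" a] by (simp add: conv_def)
  have int: "integrable lebesgue (\<lambda>u. f (a - u) * \<rho> u)" for a
    using integrable_lebesgue_reflect[OF _ mollifier_conv_integrable[OF \<rho> f, of a], of a] by simp
  have "\<bar>conv f \<rho> x - conv f \<rho> y\<bar> = \<bar>\<integral>u. f (x - u) * \<rho> u - f (y - u) * \<rho> u \<partial>lebesgue\<bar>"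
    using int by (simp add: eq)
  also have "\<dots> \<le> (\<integral>u. \<bar>f (x - u) * \<rho> u - f (y - u) * \<rho> u\<bar> \<partial>lebesgue)"
    by (rule integral_abs_bound)
  also have "\<dots> \<le> (\<integral>u. L * norm (x - y) * \<rho> u \<partial>lebesgue)"
  proof (rule Bochner_Integration.integral_mono)
    show "integrable lebesgue (\<lambda>u. \<bar>f (x - u) * \<rho> u - f (y - u) * \<rho> u\<bar>)"
      using int by (intro integrable_abs Bochner_Integration.integrable_diff)
    show "integrable lebesgue (\<lambda>u. L * norm (x - y) * \<rho> u)"
      using mollifier_facts(7)[OF \<rho>] by simp
    show "\<bar>f (x - u) * \<rho> u - f (y - u) * \<rho> u\<bar> \<le> L * norm (x - y) * \<rho> u" for u
    proof -
      have "\<bar>f (x - u) * \<rho> u - f (y - u) * \<rho> u\<bar> = \<bar>f (x - u) - f (y - u)\<bar> * \<rho> u"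
        using mollifier_facts(2)[OF \<rho>, of u] by (metis abs_mult abs_of_nonneg left_diff_distrib)
      also have "\<dots> \<le> L * norm (x - y) * \<rho> u"
        using L[of "x - u" "y - u"] mollifier_facts(2)[OF \<rho>, of u] by (intro mult_right_mono) simp_all
      finally show ?thesis .
    qed
  qed
  also have "\<dots> = L * norm (x - y)" using mollifier_facts(4)[OF \<rho>] by simp
  finally show ?thesis .
qed

text \<open>The derivative in the direction \<open>h = grad f x\<close> is the square of
  \<open>norm h\<close> and is at most \<open>L * norm h\<close>. When the gradient vanishes, a unit
  step shows \<open>L \<ge> 0\<close>.\<close>

lemma grad_le_Lipschitz:
  fixes f :: "'a::euclidean_space \<Rightarrow> real"
  assumes s: "smooth f" and L: "\<And>x y. \<bar>f x - f y\<bar> \<le> L * norm (x - y)"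
  shows "norm (grad f x) \<le> L"
proof (cases "grad f x = 0")
  case True
  have "0 \<le> L * norm (x - (x + (SOME i. i \<in> Basis)))" by (rule order_trans[OF abs_ge_zero L])
  then show ?thesis using True by (simp add: norm_some_Basis)
next
  case False
  define h where "h = grad f x"
  have l: "((\<lambda>s. x + s *\<^sub>R h) has_derivative (\<lambda>s. s *\<^sub>R h)) (at (0::real))"
    by (auto intro!: derivative_eq_intros)
  have "((\<lambda>s. f (x + s *\<^sub>R h)) has_derivative (\<lambda>s. grad f x \<bullet> (s *\<^sub>R h))) (at 0)"
    using has_derivative_compose[OF l, of f "\<lambda>k. grad f x \<bullet> k"] smooth_has_derivative_grad[OF s, of x] by simp
  then have "((\<lambda>s. f (x + s *\<^sub>R h)) has_real_derivative (grad f x \<bullet> h)) (at 0)"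
    unfolding has_field_derivative_def by (rule has_derivative_eq_rhs) (simp add: fun_eq_iff)
  then have lim: "(\<lambda>s. (f (x + s *\<^sub>R h) - f x) / s) \<midarrow>0\<rightarrow> grad f x \<bullet> h"
    by (simp add: DERIV_def)
  have "grad f x \<bullet> h \<le> L * norm h"
  proof (rule tendsto_upperbound[OF lim])
    have "(f (x + s *\<^sub>R h) - f x) / s \<le> L * norm h" if "s \<noteq> 0" for s
    proof -
      have "\<bar>(f (x + s *\<^sub>R h) - f x) / s\<bar> \<le> L * norm h"
        using L[of "x + s *\<^sub>R h" x] that by (simp add: abs_divide pos_divide_le_eq mult_ac)
      then show ?thesis by linarith
    qed
    then show "\<forall>\<^sub>F s in at 0. (f (x + s *\<^sub>R h) - f x) / s \<le> L * norm h"
      by (simp add: eventually_at_filter)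
  qed simp
  then have "norm h * norm h \<le> L * norm h" by (simp add: h_def dot_square_norm power2_eq_square)
  then show ?thesis using False by (simp add: h_def)
qed

text \<open>The width \<open>t\<close> is divided into quarters: the ramp \<open>f\<close> rises
  between distances \<open>t / 2\<close> and \<open>3 * t / 4\<close> from the complement, hence its
  slope \<open>4 / t\<close>, and the outer quarters are reserved for mollifying at radius
  \<open>t / 4\<close>. The Lipschitz constant survives mollification, which gives the gradient
  bound.\<close>

lemma ex_cutoff:
  fixes U :: "'a::euclidean_space set"
  assumes "open U" "bounded U" "t > 0"
  obtains \<zeta> K where "smooth \<zeta>" "\<And>x. 0 \<le> \<zeta> x" "\<And>x. \<zeta> x \<le> 1" "compact K" "K \<subseteq> U"
    "\<And>x. x \<notin> K \<Longrightarrow> \<zeta> x = 0" "\<And>x. x \<notin> K \<Longrightarrow> grad \<zeta> x = 0"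
    "\<And>x. x \<in> U \<Longrightarrow> t \<le> infdist x (frontier U) \<Longrightarrow> \<zeta> x = 1"
    "\<And>x. x \<in> U \<Longrightarrow> t \<le> infdist x (frontier U) \<Longrightarrow> grad \<zeta> x = 0"
    "\<And>x. norm (grad \<zeta> x) \<le> 4 / t"
proof -
  have ne: "- U \<noteq> {}" using assms(2) not_bounded_UNIV by (metis Compl_empty_eq double_complement)
  define \<delta> where "\<delta> x = infdist x (- U)" for x
  have \<delta>_lip: "\<bar>\<delta> x - \<delta> y\<bar> \<le> norm (x - y)" for x y
    using infdist_triangle_abs[of x "- U" y] by (simp add: \<delta>_def dist_norm)
  have \<delta>_out: "\<delta> x = 0" if "x \<notin> U" for x using that by (simp add: \<delta>_def)
  define f where "f x = max 0 (min 1 (4 / t * \<delta> x - 2))" for x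
  have f_lip: "\<bar>f x - f y\<bar> \<le> 4 / t * norm (x - y)" for x y
  proof -
    have "\<bar>f x - f y\<bar> \<le> \<bar>(4 / t * \<delta> x - 2) - (4 / t * \<delta> y - 2)\<bar>"
      by (auto simp: f_def max_def min_def)
    also have "\<dots> = 4 / t * \<bar>\<delta> x - \<delta> y\<bar>"
    proof -
      have "(4 / t * \<delta> x - 2) - (4 / t * \<delta> y - 2) = 4 / t * (\<delta> x - \<delta> y)" by (simp add: right_diff_distrib)
      then show ?thesis using \<open>t > 0\<close> by (simp only: abs_mult) simp
    qed
    also have "\<dots> \<le> 4 / t * norm (x - y)" using \<delta>_lip \<open>t > 0\<close> by (intro mult_left_mono) simp_all
    finally show ?thesis .
  qed
  have f01: "0 \<le> f x" "f x \<le> 1" for x by (auto simp: f_def)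
  have f0: "f x = 0" if "\<delta> x \<le> t / 2" for x
    using that \<open>t > 0\<close> by (auto simp: f_def field_simps)
  have f1: "f x = 1" if "3 * t / 4 \<le> \<delta> x" for x
    using that \<open>t > 0\<close> by (auto simp: f_def field_simps max_def)
  have cf: "continuous_on UNIV f" unfolding f_def \<delta>_def by (intro continuous_intros)
  have "{x. f x \<noteq> 0} \<subseteq> U" using \<delta>_out f0 \<open>t > 0\<close> by force
  then have bf: "bounded {x. f x \<noteq> 0}" using assms(2) bounded_subset by blast
  have fi: "integrable lebesgue f" by (rule integrable_bounded_support[OF cf bf])
  obtain \<rho> :: "'a \<Rightarrow> real" where \<rho>: "mollifier (t / 4) \<rho>"
    using ex_mollifier[of "t / 4"] \<open>t > 0\<close> by auto
  define \<zeta> where "\<zeta> = conv f \<rho>"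
  have s: "smooth \<zeta>" unfolding \<zeta>_def by (rule mollifier_conv_smooth[OF \<rho> fi])
  \<comment> \<open>Both bounds on \<open>\<zeta>\<close> at once: values in the unit interval lie
    within 1/2 of its midpoint.\<close>
  have half: "\<bar>\<zeta> x - 1/2\<bar> \<le> 1/2" for x
    unfolding \<zeta>_def by (rule conv_close[OF \<rho> fi]) (use f01 in \<open>smt (verit) field_sum_of_halves\<close>)
  have \<zeta>0: "0 \<le> \<zeta> x" and \<zeta>1: "\<zeta> x \<le> 1" for x using half[of x] by (linarith, linarith)
  define K where "K = {x. t / 4 \<le> \<delta> x}"
  have "closed K" unfolding K_def \<delta>_def by (intro closed_Collect_le continuous_intros)
  have KU: "K \<subseteq> U" using \<delta>_out \<open>t > 0\<close> by (force simp: K_def)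
  have K: "compact K" using \<open>closed K\<close> bounded_subset[OF assms(2) KU] by (simp add: compact_eq_bounded_closed)
  have out: "\<zeta> x = 0" if "x \<notin> K" for x
    unfolding \<zeta>_def
  proof (rule conv_support[OF \<rho>])
    fix y assume "dist x y < t / 4"
    then show "f y = 0" using that \<delta>_lip[of x y] by (intro f0) (simp add: K_def dist_norm)
  qed
  then have "closure {x. \<zeta> x \<noteq> 0} \<subseteq> K" by (intro closure_minimal \<open>closed K\<close>) blast
  then have gout: "grad \<zeta> x = 0" if "x \<notin> K" for x
    using that pd_support[of _ \<zeta>] by (auto simp: grad_eq_0_iff)
  have one: "\<zeta> x = 1" if "x \<in> U" "t \<le> infdist x (frontier U)" for x
  proof -
    have "t \<le> \<delta> x" using infdist_frontier_le[OF assms(1) that(1) ne] that(2) by (simp add: \<delta>_def)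
    have "\<bar>\<zeta> x - 1\<bar> \<le> 0"
      unfolding \<zeta>_def
    proof (rule conv_close[OF \<rho> fi])
      fix y assume "dist x y < t / 4"
      then have "f y = 1" using \<open>t \<le> \<delta> x\<close> \<delta>_lip[of x y] by (intro f1) (simp add: dist_norm)
      then show "\<bar>f y - 1\<bar> \<le> 0" by simp
    qed
    then show ?thesis by simp
  qed
  \<comment> \<open>Where \<open>\<zeta>\<close> equals 1 it attains its maximum, so its derivative
    vanishes there; no neighbourhood with value 1 is needed.\<close>
  have gone: "grad \<zeta> x = 0" if "x \<in> U" "t \<le> infdist x (frontier U)" for x
  proof -
    have "(\<lambda>h. grad \<zeta> x \<bullet> h) = (\<lambda>h. 0)"
      by (rule differential_zero_maxmin[of x UNIV, OF _ _ smooth_has_derivative_grad[OF s]])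
        (use one[OF that] \<zeta>1 in auto)
    from fun_cong[OF this, of "grad \<zeta> x"] show ?thesis by simp
  qed
  have lip: "norm (grad \<zeta> x) \<le> 4 / t" for x
    by (rule grad_le_Lipschitz[OF s]) (unfold \<zeta>_def, rule conv_Lipschitz[OF \<rho> fi f_lip])
  show ?thesis
    by (rule that[OF s \<zeta>0 \<zeta>1 K KU out gout one gone lip])
qed

section \<open>Error of the truncated problem\<close>

lemma L2_mult_grad_sum:
  assumes u: "u \<in> L2_space S" and G: "G \<in> L2_space S" and S: "S \<in> sets lebesgue"
    and s: "smooth (\<zeta> :: 'a::euclidean_space \<Rightarrow> real)" and a: "\<And>x. \<bar>\<zeta> x\<bar> \<le> A" and b: "\<And>x. norm (grad \<zeta> x) \<le> B"
  shows "(\<lambda>x. \<zeta> x * u x) \<in> L2_space S" "(\<lambda>x. \<zeta> x *\<^sub>R G x + u x *\<^sub>R grad \<zeta> x) \<in> L2_space S"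
proof -
  have m1: "\<zeta> \<in> borel_measurable (lebesgue_on S)"
    using continuous_measurable_lebesgue[OF smooth_continuous[OF s]] by (rule measurable_restrict_space1)
  have "grad \<zeta> \<in> borel_measurable lebesgue"
    unfolding grad_def[abs_def]
    by (intro borel_measurable_sum borel_measurable_scaleR borel_measurable_const
        continuous_measurable_lebesgue smooth_continuous smooth_pd s)
  then have m2: "grad \<zeta> \<in> borel_measurable (lebesgue_on S)" by (rule measurable_restrict_space1)
  show "(\<lambda>x. \<zeta> x * u x) \<in> L2_space S" using L2_bounded_mult[OF u m1 a] by simp
  show "(\<lambda>x. \<zeta> x *\<^sub>R G x + u x *\<^sub>R grad \<zeta> x) \<in> L2_space S"
    by (intro L2_add L2_bounded_mult[OF G m1 a] L2_mult_bounded[OF u m2 b])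
qed

text \<open>The functional is continuous for the H1 norm and vanishes on test functions, which are
  dense in \<open>H10 U\<close> by definition; hence its value at \<open>u\<close> is at most
  \<open>C * \<epsilon>\<close> for every positive \<epsilon>.\<close>

lemma H10_orthogonal:
  assumes "open U" and e: "e \<in> L2_space U" and E: "E \<in> L2_space U" and u: "u \<in> H10 U"
    and ortho: "\<And>\<phi>. \<phi> \<in> test_functions U \<Longrightarrow> L2_inner U e \<phi> + a * L2_inner U E (grad \<phi>) = 0"
  shows "L2_inner U e u + a * L2_inner U E (weak_gradient U u) = 0"
proof -
  let ?B = "L2_inner U e u + a * L2_inner U E (weak_gradient U u)"
  have u1: "u \<in> H1 U" "u \<in> L2_space U" using u by (auto simp: H10_def H1_def)
  note g = weak_gradient_H1[OF u1(1)]
  define C where "C = norm_L2 U e + \<bar>a\<bar> * norm_L2 U E"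
  have C: "C \<ge> 0" by (simp add: C_def)
  have bound: "\<bar>?B\<bar> \<le> C * \<epsilon>" if "\<epsilon> > 0" for \<epsilon>
  proof -
    obtain \<phi> where \<phi>: "\<phi> \<in> test_functions U" "norm_H1 U (\<lambda>x. u x - \<phi> x) < \<epsilon>"
      using u \<open>\<epsilon> > 0\<close> by (auto simp: H10_def)
    note t = test_L2[OF assms(1) \<phi>(1)]
    let ?d = "\<lambda>x. u x - \<phi> x" and ?D = "\<lambda>x. weak_gradient U u x - grad \<phi> x"
    have d: "?d \<in> L2_space U" and D: "?D \<in> L2_space U" using u1 g t by (auto intro: L2_diff)
    have wd: "has_weak_gradient U ?d ?D"
      by (rule diff_has_weak_gradient[OF assms(1) u1(2) t(1) g(1) t(2) g(2) smooth_has_weak_gradient[OF _ assms(1)]])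
        (use \<phi>(1) in \<open>simp add: test_functions_iff\<close>)
    note w = weak_gradient_AE[OF assms(1) d D wd]
    note W = weak_gradient_H1(1)[OF w(1)]
    \<comment> \<open>\<open>norm_H1\<close> measures the gradient chosen for the difference
      \<open>?d\<close>, which agrees with the difference \<open>?D\<close> of the gradients only
      almost everywhere.\<close>
    have "L2_inner U ?D ?D = L2_inner U (weak_gradient U ?d) (weak_gradient U ?d)"
      by (rule L2_inner_cong_AE[OF _ _ D W D W]) (use w(2) in \<open>auto elim!: AE_mp\<close>)
    then have nD: "norm_L2 U ?D = norm_L2 U (weak_gradient U ?d)" by (simp add: norm_L2_def)
    have le: "norm_L2 U ?d \<le> \<epsilon>" "norm_L2 U ?D \<le> \<epsilon>"
      using \<phi>(2)[unfolded norm_H1_def, folded nD] real_sqrt_sum_squares_ge1[of "norm_L2 U ?d" "norm_L2 U ?D"]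
        real_sqrt_sum_squares_ge2[of "norm_L2 U ?D" "norm_L2 U ?d"]
      by (linarith, linarith)
    have eq: "?B = L2_inner U e ?d + a * L2_inner U E ?D"
      using ortho[OF \<phi>(1)]
      by (simp add: L2_inner_diff_right[OF u1(2) t(1) e] L2_inner_diff_right[OF g(1) t(2) E] right_diff_distrib)
    have "\<bar>L2_inner U e ?d\<bar> \<le> norm_L2 U e * \<epsilon>"
      by (rule order_trans[OF L2_Cauchy_Schwarz[OF e d]]) (simp add: le mult_left_mono)
    moreover have "\<bar>L2_inner U E ?D\<bar> \<le> norm_L2 U E * \<epsilon>"
      by (rule order_trans[OF L2_Cauchy_Schwarz[OF E D]]) (simp add: le mult_left_mono)
    then have "\<bar>a * L2_inner U E ?D\<bar> \<le> \<bar>a\<bar> * (norm_L2 U E * \<epsilon>)"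
      unfolding abs_mult by (rule mult_left_mono) simp
    ultimately show ?thesis unfolding eq C_def by (simp add: algebra_simps)
  qed
  show ?thesis
  proof (rule ccontr)
    assume n: "?B \<noteq> 0"
    then have "\<bar>?B\<bar> \<le> C * (\<bar>?B\<bar> / (C + 1))" using C by (intro bound) simp
    also have "\<dots> < \<bar>?B\<bar>" using n C by (simp add: field_simps)
    finally show False by simp
  qed
qed

text \<open>Orthogonality to \<open>z\<close> passes to the weak limit along test functions, so
  membership of \<open>z\<close> in \<open>H10 U\<close> is never established. Extending
  \<open>e\<close> and \<open>E\<close> by zero turns the pairings over \<open>U\<close> into
  pairings over the whole space.\<close>

lemma compact_support_orthogonal:
  fixes z :: "'a::euclidean_space \<Rightarrow> real"
  assumes "open U" and e: "e \<in> L2_space U" and E: "E \<in> L2_space U"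
    and ortho: "\<And>\<phi>. \<phi> \<in> test_functions U \<Longrightarrow> L2_inner U e \<phi> + a * L2_inner U E (grad \<phi>) = 0"
    and K: "compact K" "K \<subseteq> U"
    and z: "z \<in> L2_space UNIV" "\<And>x. x \<notin> K \<Longrightarrow> z x = 0"
    and Z: "Z \<in> L2_space UNIV" "\<And>x. x \<notin> K \<Longrightarrow> Z x = 0"
    and wg: "has_weak_gradient UNIV z Z"
  shows "L2_inner U e z + a * L2_inner U E Z = 0"
proof -
  have U: "U \<in> sets lebesgue" using \<open>open U\<close> by simp
  obtain \<phi> where \<phi>: "\<And>n::nat. \<phi> n \<in> test_functions U"
    and l1: "\<And>e. e \<in> L2_space UNIV \<Longrightarrow> (\<lambda>n. L2_inner UNIV e (\<phi> n)) \<longlonglongrightarrow> L2_inner UNIV e z"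
    and l2: "\<And>E. E \<in> L2_space UNIV \<Longrightarrow> (\<lambda>n. L2_inner UNIV E (grad (\<phi> n))) \<longlonglongrightarrow> L2_inner UNIV E Z"
    using weak_test_approximation[OF assms(1) K z Z wg] by blast
  have "(\<lambda>n. L2_inner U e (\<phi> n) + a * L2_inner U E (grad (\<phi> n))) \<longlonglongrightarrow> L2_inner U e z + a * L2_inner U E Z"
    using l1[OF L2_extend[OF e U]] l2[OF L2_extend[OF E U]]
    unfolding L2_inner_extend[OF U] by (intro tendsto_add tendsto_mult tendsto_const)
  moreover have "(\<lambda>n. L2_inner U e (\<phi> n) + a * L2_inner U E (grad (\<phi> n))) = (\<lambda>n. 0)"
    using ortho[OF \<phi>] by (rule ext)
  ultimately show ?thesis using LIMSEQ_unique tendsto_const by metis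
qed

text \<open>A best approximation argument: the error is measured against the part of
  \<open>v\<close> that the cutoff removes. Stated for a general bounded open \<open>U\<close>, so
  that the constant 6 is visibly independent of the domain and of \<open>t\<close>.\<close>

lemma truncation_error:
  fixes U :: "'a::euclidean_space set" and v vM \<eta> :: "'a \<Rightarrow> real"
  assumes U: "open U" "bounded U" and D: "D \<in> sets lebesgue" and t: "t > 0"
    and v: "v \<in> H1 UNIV" "\<And>\<phi>. \<phi> \<in> H1 UNIV \<Longrightarrow>
      L2_inner UNIV v \<phi> + t\<^sup>2 * dirichlet_form UNIV v \<phi> = - L2_inner UNIV (ext0 D \<eta>) \<phi>"
    and vM: "vM \<in> H10 U" "\<And>\<phi>. \<phi> \<in> H10 U \<Longrightarrow>
      L2_inner U vM \<phi> + t\<^sup>2 * dirichlet_form U vM \<phi> = - L2_inner D \<eta> \<phi>"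
    and B_def: "B = {x \<in> U. infdist x (frontier U) < t}"
  shows "norm_L2 U (\<lambda>x. v x - vM x) \<le> 6 * (t * norm_L2 B (weak_gradient UNIV v) + norm_L2 B v)"
proof -
  have Ul: "U \<in> sets lebesgue" using U(1) by simp
  have "B = U \<inter> {x. infdist x (frontier U) < t}" by (auto simp: B_def)
  moreover have "open {x. infdist x (frontier U) < t}"
    by (intro open_Collect_less continuous_intros)
  ultimately have "open B" using U(1) by auto
  then have Bl: "B \<in> sets lebesgue" by simp
  have BU: "B \<subseteq> U" by (auto simp: B_def)
  define G where "G = weak_gradient UNIV v"
  define gM where "gM = weak_gradient U vM"
  have vL: "v \<in> L2_space UNIV" using v(1) by (simp add: H1_def)
  have GL: "G \<in> L2_space UNIV" and Gw: "has_weak_gradient UNIV v G"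
    using weak_gradient_H1[OF v(1)] by (simp_all add: G_def)
  have vMH: "vM \<in> H1 U" using vM(1) by (simp add: H10_def)
  have vML: "vM \<in> L2_space U" using vMH by (simp add: H1_def)
  have gML: "gM \<in> L2_space U" using weak_gradient_H1[OF vMH] by (simp add: gM_def)
  note vU = L2_UNIV_restrict[OF vL Ul] and GU = L2_UNIV_restrict[OF GL Ul]
  define e where "e x = v x - vM x" for x
  define E where "E x = G x - gM x" for x
  have e: "e \<in> L2_space U" unfolding e_def by (rule L2_diff[OF vU vML])
  have E: "E \<in> L2_space U" unfolding E_def by (rule L2_diff[OF GU gML])
  \<comment> \<open>A test function of \<open>U\<close> is admissible in both problems, and its
    support lets the integrals over the whole space shrink to \<open>U\<close>; both right-hand
    sides are then the same pairing of \<open>\<eta>\<close> with \<open>\<phi>\<close> on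
    \<open>D\<close>.\<close>
  have ortho: "L2_inner U e \<phi> + t\<^sup>2 * L2_inner U E (grad \<phi>) = 0" if \<phi>: "\<phi> \<in> test_functions U" for \<phi>
  proof -
    note tz = test_zero_outside[OF \<phi>] and tL = test_L2[OF U(1) \<phi>]
    have "L2_inner UNIV v \<phi> + t\<^sup>2 * L2_inner UNIV G (grad \<phi>) = - L2_inner UNIV (ext0 D \<eta>) \<phi>"
      using v(2)[OF test_H1(1)[OF open_UNIV \<phi>]] by (simp add: dirichlet_form_test[OF open_UNIV v(1) \<phi>] G_def)
    moreover have "L2_inner UNIV v \<phi> = L2_inner U v \<phi>"
      by (rule L2_inner_UNIV_support[OF Ul]) (simp add: tz)
    moreover have "L2_inner UNIV G (grad \<phi>) = L2_inner U G (grad \<phi>)"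
      by (rule L2_inner_UNIV_support[OF Ul]) (simp add: tz)
    moreover have "L2_inner UNIV (ext0 D \<eta>) \<phi> = L2_inner D \<eta> \<phi>"
    proof -
      have "ext0 D \<eta> = (\<lambda>x. indicator D x *\<^sub>R \<eta> x)" by (auto simp: ext0_def indicator_def)
      then show ?thesis by (simp only: L2_inner_extend[OF D])
    qed
    moreover have "L2_inner U vM \<phi> + t\<^sup>2 * L2_inner U gM (grad \<phi>) = - L2_inner D \<eta> \<phi>"
      using vM(2)[OF test_H10[OF U(1) \<phi>]] by (simp add: dirichlet_form_test[OF U(1) vMH \<phi>] gM_def)
    moreover have "L2_inner U e \<phi> = L2_inner U v \<phi> - L2_inner U vM \<phi>"
      unfolding e_def by (rule L2_inner_diff_left[OF vU vML tL(1)])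
    moreover have "L2_inner U E (grad \<phi>) = L2_inner U G (grad \<phi>) - L2_inner U gM (grad \<phi>)"
      unfolding E_def by (rule L2_inner_diff_left[OF GU gML tL(2)])
    ultimately show ?thesis by (simp add: right_diff_distrib)
  qed
  have o1: "L2_inner U e vM + t\<^sup>2 * L2_inner U E gM = 0"
    unfolding gM_def by (rule H10_orthogonal[OF U(1) e E vM(1) ortho])
  obtain \<zeta> K where \<zeta>: "smooth \<zeta>" "\<And>x. 0 \<le> \<zeta> x" "\<And>x. \<zeta> x \<le> 1" and K: "compact K" "K \<subseteq> U"
    "\<And>x. x \<notin> K \<Longrightarrow> \<zeta> x = 0" "\<And>x. x \<notin> K \<Longrightarrow> grad \<zeta> x = 0"
    and one: "\<And>x. x \<in> U \<Longrightarrow> t \<le> infdist x (frontier U) \<Longrightarrow> \<zeta> x = 1"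
    "\<And>x. x \<in> U \<Longrightarrow> t \<le> infdist x (frontier U) \<Longrightarrow> grad \<zeta> x = 0"
    and lip: "\<And>x. norm (grad \<zeta> x) \<le> 4 / t"
    using ex_cutoff[OF U t] by blast
  define z where "z x = \<zeta> x * v x" for x
  define Z where "Z x = \<zeta> x *\<^sub>R G x + v x *\<^sub>R grad \<zeta> x" for x
  have \<zeta>a: "\<bar>\<zeta> x\<bar> \<le> 1" for x using \<zeta>(2,3)[of x] by simp
  have UNl: "UNIV \<in> sets (lebesgue :: 'a measure)" by simp
  have zL: "z \<in> L2_space UNIV" and ZL: "Z \<in> L2_space UNIV"
    unfolding z_def Z_def by (rule L2_mult_grad_sum[OF vL GL UNl \<zeta>(1) \<zeta>a lip])+
  have zw: "has_weak_gradient UNIV z Z"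
    unfolding z_def Z_def by (rule mult_has_weak_gradient[OF Gw vL GL \<zeta>(1) open_UNIV])
  have z0: "z x = 0" if "x \<notin> K" for x using K(3)[OF that] by (simp add: z_def)
  have Z0: "Z x = 0" if "x \<notin> K" for x using K(3,4)[OF that] by (simp add: Z_def)
  have o2: "L2_inner U e z + t\<^sup>2 * L2_inner U E Z = 0"
    by (rule compact_support_orthogonal[OF U(1) e E ortho K(1,2) zL z0 ZL Z0 zw])
  note zU = L2_UNIV_restrict[OF zL Ul] and ZU = L2_UNIV_restrict[OF ZL Ul]
  define w where "w x = v x - z x" for x
  define W where "W x = G x - Z x" for x
  have w: "w \<in> L2_space U" unfolding w_def by (rule L2_diff[OF vU zU])
  have W: "W \<in> L2_space U" unfolding W_def by (rule L2_diff[OF GU ZU])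
  \<comment> \<open>Both sides equal the pairing of \<open>e\<close> with \<open>v\<close>: the left
    one by orthogonality to \<open>vM\<close>, the right one by orthogonality to
    \<open>z\<close>.\<close>
  have "L2_inner U e e + t\<^sup>2 * L2_inner U E E = L2_inner U e w + t\<^sup>2 * L2_inner U E W"
  proof -
    have "L2_inner U e e = L2_inner U e v - L2_inner U e vM"
      using L2_inner_diff_right[OF vU vML e] by (simp add: e_def[abs_def])
    moreover have "L2_inner U E E = L2_inner U E G - L2_inner U E gM"
      using L2_inner_diff_right[OF GU gML E] by (simp add: E_def[abs_def])
    moreover have "L2_inner U e w = L2_inner U e v - L2_inner U e z"
      using L2_inner_diff_right[OF vU zU e] by (simp add: w_def[abs_def])
    moreover have "L2_inner U E W = L2_inner U E G - L2_inner U E Z"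
      using L2_inner_diff_right[OF GU ZU E] by (simp add: W_def[abs_def])
    ultimately show ?thesis using o1 o2 by (simp add: right_diff_distrib)
  qed
  \<comment> \<open>Young's inequality lets half of the energy of \<open>e\<close> be absorbed,
    leaving the energy of \<open>w\<close> with constant 1.\<close>
  moreover have "2 * L2_inner U e w \<le> L2_inner U e e + L2_inner U w w"
  proof -
    have "2 * L2_inner U e w \<le> 2 * (norm_L2 U e * norm_L2 U w)"
      using L2_Cauchy_Schwarz[OF e w] by simp
    also have "\<dots> \<le> (norm_L2 U e)\<^sup>2 + (norm_L2 U w)\<^sup>2"
      using sum_squares_bound[of "norm_L2 U e" "norm_L2 U w"] by simp
    finally show ?thesis by (simp add: norm_L2_sq)
  qed
  moreover have "2 * (t\<^sup>2 * L2_inner U E W) \<le> t\<^sup>2 * L2_inner U E E + t\<^sup>2 * L2_inner U W W"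
  proof -
    have "2 * L2_inner U E W \<le> 2 * (norm_L2 U E * norm_L2 U W)"
      using L2_Cauchy_Schwarz[OF E W] by simp
    also have "\<dots> \<le> (norm_L2 U E)\<^sup>2 + (norm_L2 U W)\<^sup>2"
      using sum_squares_bound[of "norm_L2 U E" "norm_L2 U W"] by simp
    finally have "2 * L2_inner U E W \<le> L2_inner U E E + L2_inner U W W" by (simp add: norm_L2_sq)
    then have "t\<^sup>2 * (2 * L2_inner U E W) \<le> t\<^sup>2 * (L2_inner U E E + L2_inner U W W)"
      by (rule mult_left_mono) simp
    then show ?thesis by (simp add: algebra_simps)
  qed
  moreover have "0 \<le> t\<^sup>2 * L2_inner U E E" by (simp add: L2_inner_self_nonneg)
  ultimately have energy: "L2_inner U e e \<le> L2_inner U w w + t\<^sup>2 * L2_inner U W W" by linarith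
  \<comment> \<open>Off the layer \<open>\<zeta>\<close> is 1 and its gradient is 0, so nothing of
    \<open>v\<close> is removed there.\<close>
  have w0: "w x = 0" "W x = 0" if "x \<in> U" "x \<notin> B" for x
    using one[OF that(1)] that by (auto simp: B_def w_def W_def z_def Z_def not_less)
  note vB = L2_UNIV_restrict[OF vL Bl] and GB = L2_UNIV_restrict[OF GL Bl]
  have wB: "w \<in> L2_space B" by (rule L2_restrict[OF w BU Bl Ul])
  have WB: "W \<in> L2_space B" by (rule L2_restrict[OF W BU Bl Ul])
  have "L2_inner U w w = L2_inner B w w" by (rule L2_inner_support[OF Ul Bl]) (use w0 BU in auto)
  also have "\<dots> \<le> L2_inner B v v"
    unfolding L2_inner_def
  proof (rule Bochner_Integration.integral_mono[OF L2_inner_integrable[OF wB wB] L2_inner_integrable[OF vB vB]])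
    fix x
    have "w x = (1 - \<zeta> x) * v x" by (simp add: w_def z_def left_diff_distrib)
    then have "\<bar>w x\<bar> \<le> \<bar>v x\<bar>"
      using \<zeta>(2,3)[of x] by (simp add: abs_mult mult_left_le_one_le)
    then show "w x \<bullet> w x \<le> v x \<bullet> v x" by (simp add: abs_le_square_iff power2_eq_square)
  qed
  finally have b1: "L2_inner U w w \<le> (norm_L2 B v)\<^sup>2" by (simp add: norm_L2_sq)
  have "L2_inner U W W = L2_inner B W W" by (rule L2_inner_support[OF Ul Bl]) (use w0 BU in auto)
  also have "\<dots> \<le> (\<integral>x. 2 * (G x \<bullet> G x) + 32 / t\<^sup>2 * (v x \<bullet> v x) \<partial>lebesgue_on B)"
    unfolding L2_inner_def
  proof (rule Bochner_Integration.integral_mono[OF L2_inner_integrable[OF WB WB]])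
    show "integrable (lebesgue_on B) (\<lambda>x. 2 * (G x \<bullet> G x) + 32 / t\<^sup>2 * (v x \<bullet> v x))"
      using L2_inner_integrable[OF GB GB] L2_inner_integrable[OF vB vB]
      by (intro Bochner_Integration.integrable_add integrable_mult_right)
    fix x
    have Wx: "W x = (1 - \<zeta> x) *\<^sub>R G x - v x *\<^sub>R grad \<zeta> x"
      by (simp add: W_def Z_def scaleR_diff_left)
    have "norm (W x) \<le> norm ((1 - \<zeta> x) *\<^sub>R G x) + norm (v x *\<^sub>R grad \<zeta> x)"
      unfolding Wx by (rule norm_triangle_ineq4)
    also have "\<dots> \<le> norm (G x) + \<bar>v x\<bar> * (4 / t)"
    proof (rule add_mono)
      show "norm ((1 - \<zeta> x) *\<^sub>R G x) \<le> norm (G x)"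
        using \<zeta>(2,3)[of x] by (simp add: mult_left_le_one_le)
      show "norm (v x *\<^sub>R grad \<zeta> x) \<le> \<bar>v x\<bar> * (4 / t)"
        unfolding norm_scaleR by (rule mult_left_mono[OF lip]) simp
    qed
    finally have "(norm (W x))\<^sup>2 \<le> (norm (G x) + \<bar>v x\<bar> * (4 / t))\<^sup>2" by (rule power_mono) simp
    also have "\<dots> \<le> 2 * (norm (G x))\<^sup>2 + 2 * (\<bar>v x\<bar> * (4 / t))\<^sup>2"
      using sum_squares_bound[of "norm (G x)" "\<bar>v x\<bar> * (4 / t)"] unfolding power2_sum by linarith
    also have "2 * (\<bar>v x\<bar> * (4 / t))\<^sup>2 = 32 / t\<^sup>2 * (v x \<bullet> v x)"
      by (simp add: power_mult_distrib power_divide power2_eq_square)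
    finally show "W x \<bullet> W x \<le> 2 * (G x \<bullet> G x) + 32 / t\<^sup>2 * (v x \<bullet> v x)"
      by (simp only: power2_norm_eq_inner)
  qed
  also have "\<dots> = 2 * L2_inner B G G + 32 / t\<^sup>2 * L2_inner B v v"
    using L2_inner_integrable[OF GB GB] L2_inner_integrable[OF vB vB]
    unfolding L2_inner_def by (simp add: Bochner_Integration.integral_add)
  finally have "t\<^sup>2 * L2_inner U W W \<le> t\<^sup>2 * (2 * L2_inner B G G + 32 / t\<^sup>2 * L2_inner B v v)"
    by (rule mult_left_mono) simp
  also have "\<dots> = 2 * (t * norm_L2 B G)\<^sup>2 + 32 * (norm_L2 B v)\<^sup>2"
    using t by (simp add: norm_L2_sq power_mult_distrib field_simps)
  finally have b2: "t\<^sup>2 * L2_inner U W W \<le> 2 * (t * norm_L2 B G)\<^sup>2 + 32 * (norm_L2 B v)\<^sup>2" .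
  \<comment> \<open>The coefficient 33 is 1 from \<open>w\<close> plus 32 from \<open>W\<close>,
    where 32 is twice the square of the 4 in the cutoff slope. Both 33 and 2 are below 36, the
    square of the constant 6.\<close>
  have "(norm_L2 U e)\<^sup>2 \<le> 33 * (norm_L2 B v)\<^sup>2 + 2 * (t * norm_L2 B G)\<^sup>2"
    unfolding norm_L2_sq[of U e] using energy b1 b2 by linarith
  also have "\<dots> \<le> (6 * (t * norm_L2 B G + norm_L2 B v))\<^sup>2"
  proof -
    have p: "0 \<le> (t * norm_L2 B G) * norm_L2 B v" using t by (intro mult_nonneg_nonneg) auto
    have "(6 * (t * norm_L2 B G + norm_L2 B v))\<^sup>2 =
        36 * (t * norm_L2 B G)\<^sup>2 + 36 * (norm_L2 B v)\<^sup>2 + 72 * ((t * norm_L2 B G) * norm_L2 B v)"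
      by (simp add: power_mult_distrib power2_sum algebra_simps)
    then show ?thesis using p zero_le_power2[of "norm_L2 B v"] zero_le_power2[of "t * norm_L2 B G"] by linarith
  qed
  finally have "norm_L2 U e \<le> 6 * (t * norm_L2 B G + norm_L2 B v)"
    by (rule power2_le_imp_le) (use t in \<open>auto intro!: add_nonneg_nonneg mult_nonneg_nonneg\<close>)
  then show ?thesis by (simp add: e_def[abs_def] G_def)
qed

section \<open>Quadrature sums\<close>

text \<open>For the inclusion: the scaling factor \<open>r\<close> is at least 1, so by convexity
  \<open>x\<close> divided by \<open>r\<close> stays on the segment from the origin to
  \<open>x\<close> inside \<open>\<Omega>\<close>.\<close>

lemma trunc_domain_facts:
  fixes \<Omega> :: "'a::euclidean_space set"
  assumes "open \<Omega>" "convex \<Omega>" "bounded \<Omega>" "0 \<in> \<Omega>" "M > 0" "t > 0"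
  shows "open (trunc_domain \<Omega> M t)" "bounded (trunc_domain \<Omega> M t)" "\<Omega> \<subseteq> trunc_domain \<Omega> M t"
proof -
  define r where "r = (if t \<ge> 1 then 1 + t * (1 + M) else 2 + M)"
  have T: "trunc_domain \<Omega> M t = (\<lambda>x. r *\<^sub>R x) ` \<Omega>" by (simp add: trunc_domain_def r_def)
  have r: "r \<ge> 1" using assms(5,6) by (simp add: r_def)
  show "open (trunc_domain \<Omega> M t)" unfolding T using assms(1) r by (intro open_scaling) auto
  show "bounded (trunc_domain \<Omega> M t)" unfolding T using assms(3) by (rule bounded_scaling)
  show "\<Omega> \<subseteq> trunc_domain \<Omega> M t"
  proof
    fix x assume x: "x \<in> \<Omega>"
    have "(1 - 1 / r) *\<^sub>R 0 + (1 / r) *\<^sub>R x \<in> \<Omega>"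
      using r by (intro convexD_alt[OF assms(2,4) x]) simp_all
    then have "(1 / r) *\<^sub>R x \<in> \<Omega>" by simp
    moreover have "x = r *\<^sub>R ((1 / r) *\<^sub>R x)" using r by simp
    ultimately show "x \<in> trunc_domain \<Omega> M t" unfolding T by blast
  qed
qed

text \<open>The range is covered by its nonnegative and nonpositive halves. Both contain 0, which is
  counted twice; this is the slack between the bound and the sharp value
  \<open>(1 + q) / (1 - q)\<close>.\<close>

lemma sum_geometric_int_le:
  fixes q :: real
  assumes q: "0 < q" "q < 1"
  shows "(\<Sum>j = - int a..int b. q ^ nat \<bar>j\<bar>) \<le> 2 / (1 - q)"
proof -
  let ?f = "\<lambda>j::int. q ^ nat \<bar>j\<bar>"
  let ?A = "int ` {..b}" and ?B = "(\<lambda>n. - int n) ` {..a}"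
  have geo: "(\<Sum>n\<le>m. q ^ n) \<le> 1 / (1 - q)" for m :: nat
  proof -
    have "(\<Sum>n\<le>m. q ^ n) \<le> (\<Sum>n. q ^ n)" using q by (intro sum_le_suminf summable_geometric) auto
    then show ?thesis using q by (simp add: suminf_geometric)
  qed
  have "{- int a..int b} \<subseteq> ?A \<union> ?B"
  proof
    fix j assume j: "j \<in> {- int a..int b}"
    show "j \<in> ?A \<union> ?B"
    proof (cases "j \<ge> 0")
      case True
      then have "j = int (nat j)" "nat j \<le> b" using j by auto
      then show ?thesis by blast
    next
      case False
      then have "j = - int (nat (- j))" "nat (- j) \<le> a" using j by auto
      then show ?thesis by blast
    qed
  qed
  then have "sum ?f {- int a..int b} \<le> sum ?f (?A \<union> ?B)"
    using q by (intro sum_mono2) auto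
  also have "\<dots> \<le> sum ?f ?A + sum ?f ?B"
  proof -
    have "0 \<le> sum ?f (?A \<inter> ?B)" using q by (intro sum_nonneg) auto
    then show ?thesis using sum.union_inter[of ?A ?B ?f] by simp
  qed
  also have "sum ?f ?A = (\<Sum>n\<le>b. q ^ n)" by (subst sum.reindex) auto
  also have "sum ?f ?B = (\<Sum>n\<le>a. q ^ n)" by (subst sum.reindex) (auto simp: inj_on_def)
  finally show ?thesis using geo[of a] geo[of b] by simp
qed

text \<open>For \<open>y \<le> 0\<close> the parameter is at least 1, the decay exponent is just
  \<open>c * M\<close>, and equality holds. For \<open>y > 0\<close> the exponent exceeds
  \<open>c * M\<close> by at least \<open>c * M * y / 2\<close>, hence by
  \<open>(s + 1) * y\<close>: the part \<open>s * y\<close> cancels the growing weight, and the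
  remaining \<open>y\<close> exceeds \<open>s * y\<close> because \<open>s < 1\<close>.\<close>

lemma quadrature_weight_le:
  fixes s c M y :: real
  assumes s: "0 < s" "s < 1" and cM: "c * M \<ge> 2 * (s + 1)"
  shows "exp (s * y) * exp (- (max 1 (exp (- y / 2)) * c * M / exp (- y / 2))) \<le> exp (- (c * M)) * exp (- (s * \<bar>y\<bar>))"
proof -
  have "s * y - max 1 (exp (- y / 2)) * c * M / exp (- y / 2) \<le> - (c * M) - s * \<bar>y\<bar>"
  proof (cases "y \<le> 0")
    case True
    then have "max 1 (exp (- y / 2)) = exp (- y / 2)" by simp
    then show ?thesis using True by simp
  next
    case False
    then have m: "max 1 (exp (- y / 2)) = 1" by simp
    have "c * M * (1 + y / 2) \<le> c * M * exp (y / 2)"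
      using cM s exp_ge_add_one_self[of "y / 2"] by (intro mult_left_mono) auto
    moreover have "2 * (s + 1) * (y / 2) \<le> c * M * (y / 2)"
      using False cM by (intro mult_right_mono) auto
    moreover have "s * y \<le> 1 * y" using s False by (intro mult_right_mono) auto
    moreover have "max 1 (exp (- y / 2)) * c * M / exp (- y / 2) = c * M * exp (y / 2)"
    proof -
      have "exp (- y / 2) = inverse (exp (y / 2))" using exp_minus[of "y / 2"] by simp
      then show ?thesis unfolding m by (simp only: divide_inverse inverse_inverse_eq mult_1_left)
    qed
    moreover have "c * M * (1 + y / 2) = c * M + c * M * (y / 2)"
      "2 * (s + 1) * (y / 2) = s * y + y"
      by (simp_all add: algebra_simps)
    moreover have "s * \<bar>y\<bar> = s * y" using False by simp
    ultimately show ?thesis by linarith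
  qed
  then show ?thesis by (simp flip: exp_add)
qed

text \<open>From \<open>exp (s * k) \<ge> 1 + s * k\<close> one gets
  \<open>1 - q \<ge> s * k / (1 + s * k)\<close>, so the factor \<open>k\<close> cancels the
  singularity of the geometric sum as \<open>k\<close> tends to 0.\<close>

lemma step_sum_le:
  fixes s k :: real
  assumes "0 < s" "0 < k"
  shows "k * (\<Sum>j = - int a..int b. exp (- (s * \<bar>of_int j * k\<bar>))) \<le> 2 * (1 + s * k) / s"
proof -
  define q where "q = exp (- (s * k))"
  have q: "0 < q" "q < 1" using assms by (auto simp: q_def)
  have "exp (- (s * \<bar>of_int j * k\<bar>)) = q ^ nat \<bar>j\<bar>" for j :: int
  proof -
    have "of_int \<bar>j\<bar> = real (nat \<bar>j\<bar>)" by simp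
    then have "- (s * \<bar>of_int j * k\<bar>) = real (nat \<bar>j\<bar>) * (- (s * k))"
      using assms by (simp add: abs_mult)
    then show ?thesis unfolding q_def by (simp only: exp_of_nat_mult)
  qed
  then have "k * (\<Sum>j = - int a..int b. exp (- (s * \<bar>of_int j * k\<bar>))) \<le> k * (2 / (1 - q))"
    using sum_geometric_int_le[OF q, of a b] assms by (intro mult_left_mono) simp_all
  also have "\<dots> \<le> 2 * (1 + s * k) / s"
  proof -
    have "q * (1 + s * k) \<le> q * exp (s * k)" using q exp_ge_add_one_self by (intro mult_left_mono) auto
    also have "\<dots> = 1" by (simp add: q_def flip: exp_add)
    finally have "s * k \<le> (1 + s * k) * (1 - q)" by (simp add: algebra_simps)
    then have "k * 2 * s \<le> 2 * (1 + s * k) * (1 - q)" by (simp add: algebra_simps)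
    then show ?thesis using q assms by (simp add: field_simps)
  qed
  finally show ?thesis .
qed

text \<open>\<open>C\<close> is fixed before \<open>k\<close>, \<open>M\<close>, \<open>Nm\<close>
  and \<open>Np\<close> and sees the spacing only through the cap \<open>k0\<close>. The cap enters
  because the index 0 alone contributes \<open>k\<close> to the majorising sum, so that sum is
  bounded uniformly only for spacings in a bounded range.\<close>

theorem theorem6p2:
  fixes D \<Omega> :: "'a::euclidean_space set"
    and v :: "('a \<Rightarrow> real) \<Rightarrow> real \<Rightarrow> 'a \<Rightarrow> real"
    and vM :: "real \<Rightarrow> ('a \<Rightarrow> real) \<Rightarrow> real \<Rightarrow> 'a \<Rightarrow> real"
    and s c C0 k0 :: real
  assumes D: "polygonal_domain D" "bounded D" "lipschitz_boundary D"
    and \<Omega>: "open \<Omega>" "convex \<Omega>" "bounded \<Omega>" "diameter \<Omega> = 1" "D \<subseteq> \<Omega>" "0 \<in> \<Omega>"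
    and v: "\<And>\<eta> t. \<eta> \<in> L2_space D \<Longrightarrow> t > 0 \<Longrightarrow> solves_full D \<eta> t (v (ext0 D \<eta>) t)"
    and vM: "\<And>M \<eta> t. M > 0 \<Longrightarrow> \<eta> \<in> L2_space D \<Longrightarrow> t > 0 \<Longrightarrow>
               solves_trunc D \<Omega> M \<eta> t (vM M (ext0 D \<eta>) t)"
    and decay: "c > 0" "C0 > 0" "decay_estimate D \<Omega> v c C0"
    and s: "0 < s" "s < 1"
    and k0: "k0 > 0"
  shows "\<exists>C>0. \<forall>k M. \<forall>Nm Np :: nat.
           0 < k \<and> k \<le> k0 \<and> 0 < Nm \<and> 0 < Np \<and> M > 2 * (s + 1) / c \<longrightarrow>
           (\<forall>\<eta> \<in> L2_space D. \<forall>\<theta> \<in> L2_space D.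
              \<bar>quad_form D v s k Nm Np \<eta> \<theta> - quad_form D (vM M) s k Nm Np \<eta> \<theta>\<bar>
              \<le> C * exp (- (c * M)) * norm_L2 D \<eta> * norm_L2 D \<theta>)"
proof -
  have Dl: "D \<in> sets lebesgue" using D(1) by (auto simp: polygonal_domain_def)
  define cs where "cs = 2 * sin (pi * s) / pi"
  have "cs > 0" using s by (simp add: cs_def sin_gt_zero)
  \<comment> \<open>The factors are the quadrature prefactor, the constant of
    \<open>truncation_error\<close> times that of the decay estimate, and the bound of
    \<open>step_sum_le\<close> at the largest spacing.\<close>
  define C where "C = cs / 2 * (6 * C0) * (2 * (1 + s * k0) / s)"
  have "C > 0" using \<open>cs > 0\<close> decay(2) s k0 by (simp add: C_def add_pos_pos)
  moreover have "\<bar>quad_form D v s k Nm Np \<eta> \<theta> - quad_form D (vM M) s k Nm Np \<eta> \<theta>\<bar>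
      \<le> C * exp (- (c * M)) * norm_L2 D \<eta> * norm_L2 D \<theta>"
    if k: "0 < k" "k \<le> k0" and M: "M > 2 * (s + 1) / c" and \<eta>: "\<eta> \<in> L2_space D" and \<theta>: "\<theta> \<in> L2_space D"
    for k M Nm Np \<eta> \<theta>
  proof -
    have cM: "c * M \<ge> 2 * (s + 1)" using M decay(1) by (simp add: pos_divide_less_eq mult.commute)
    have "0 < 2 * (s + 1) / c" using s decay(1) by simp
    then have "M > 0" using M by linarith
    define N where "N = norm_L2 D \<eta> * norm_L2 D \<theta>"
    have N: "N \<ge> 0" by (simp add: N_def)
    let ?\<tau> = "\<lambda>j::int. exp (- (of_int j * k) / 2)"
    let ?d = "\<lambda>t x. v (ext0 D \<eta>) t x - vM M (ext0 D \<eta>) t x"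
    have termwise: "\<bar>L2_inner D (?d t) \<theta>\<bar> \<le> 6 * C0 * exp (- (max 1 t * c * M / t)) * N"
      and diff: "L2_inner D (w_op D v \<eta> t) \<theta> - L2_inner D (w_op D (vM M) \<eta> t) \<theta> = L2_inner D (?d t) \<theta>"
      if t: "t > 0" for t
    proof -
      let ?U = "trunc_domain \<Omega> M t" and ?v = "v (ext0 D \<eta>) t" and ?u = "vM M (ext0 D \<eta>) t"
      note U = trunc_domain_facts[OF \<Omega>(1,2,3,6) \<open>M > 0\<close> t]
      have Ul: "?U \<in> sets lebesgue" using U(1) by simp
      have DU: "D \<subseteq> ?U" using \<Omega>(5) U(3) by blast
      note sv = v[OF \<eta> t, unfolded solves_full_def] and su = vM[OF \<open>M > 0\<close> \<eta> t, unfolded solves_trunc_def]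
      have vL: "?v \<in> L2_space UNIV" using sv by (simp add: H1_def)
      have uL: "?u \<in> L2_space ?U" using su by (simp add: H10_def H1_def)
      have vD: "?v \<in> L2_space D" by (rule L2_UNIV_restrict[OF vL Dl])
      have uD: "?u \<in> L2_space D" by (rule L2_restrict[OF uL DU Dl Ul])
      have "ext0 D \<eta> = (\<lambda>x. indicator D x *\<^sub>R \<eta> x)" by (auto simp: ext0_def indicator_def)
      then have eD: "ext0 D \<eta> \<in> L2_space D"
        using L2_UNIV_restrict[OF L2_extend[OF \<eta> Dl] Dl] by simp
      show "L2_inner D (w_op D v \<eta> t) \<theta> - L2_inner D (w_op D (vM M) \<eta> t) \<theta> = L2_inner D (?d t) \<theta>"
        unfolding w_op_def
        by (simp add: L2_inner_add_left[OF eD vD \<theta>] L2_inner_add_left[OF eD uD \<theta>] L2_inner_diff_left[OF vD uD \<theta>])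
      \<comment> \<open>The forms only see \<open>D\<close>, which lies in \<open>\<Omega>\<close>
        and so in every truncated domain; the error on \<open>D\<close> is bounded by the error on
        the whole truncated domain.\<close>
      have "norm_L2 D (?d t) \<le> norm_L2 ?U (?d t)"
        by (rule norm_L2_mono_set[OF L2_diff[OF L2_UNIV_restrict[OF vL Ul] uL] DU Dl Ul])
      also have "\<dots> \<le> 6 * (t * norm_L2 (boundary_layer \<Omega> M t) (weak_gradient UNIV ?v) + norm_L2 (boundary_layer \<Omega> M t) ?v)"
        by (rule truncation_error[OF U(1,2) Dl t]) (use sv su in \<open>simp_all add: boundary_layer_def\<close>)
      also have "\<dots> \<le> 6 * (C0 * exp (- (max 1 t * c * M / t)) * norm_L2 D \<eta>)"
        using decay(3) \<open>M > 0\<close> t \<eta> unfolding decay_estimate_def by (intro mult_left_mono) simp_all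
      finally have dn: "norm_L2 D (?d t) \<le> 6 * (C0 * exp (- (max 1 t * c * M / t)) * norm_L2 D \<eta>)" .
      have "\<bar>L2_inner D (?d t) \<theta>\<bar> \<le> norm_L2 D (?d t) * norm_L2 D \<theta>"
        by (rule L2_Cauchy_Schwarz[OF L2_diff[OF vD uD] \<theta>])
      also have "\<dots> \<le> 6 * (C0 * exp (- (max 1 t * c * M / t)) * norm_L2 D \<eta>) * norm_L2 D \<theta>"
        by (rule mult_right_mono[OF dn]) simp
      finally show "\<bar>L2_inner D (?d t) \<theta>\<bar> \<le> 6 * C0 * exp (- (max 1 t * c * M / t)) * N"
        by (simp add: N_def mult_ac)
    qed
    have "quad_form D v s k Nm Np \<eta> \<theta> - quad_form D (vM M) s k Nm Np \<eta> \<theta> =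
        cs * k / 2 * (\<Sum>j = - int Nm..int Np. exp (s * (of_int j * k)) *
          (L2_inner D (w_op D v \<eta> (?\<tau> j)) \<theta> - L2_inner D (w_op D (vM M) \<eta> (?\<tau> j)) \<theta>))"
      by (simp add: quad_form_def Let_def cs_def right_diff_distrib sum_subtractf)
    also have "\<dots> = cs * k / 2 * (\<Sum>j = - int Nm..int Np. exp (s * (of_int j * k)) * L2_inner D (?d (?\<tau> j)) \<theta>)"
      by (simp only: diff[OF exp_gt_zero])
    finally have eq: "quad_form D v s k Nm Np \<eta> \<theta> - quad_form D (vM M) s k Nm Np \<eta> \<theta> =
        cs * k / 2 * (\<Sum>j = - int Nm..int Np. exp (s * (of_int j * k)) * L2_inner D (?d (?\<tau> j)) \<theta>)" .
    have "\<bar>\<Sum>j = - int Nm..int Np. exp (s * (of_int j * k)) * L2_inner D (?d (?\<tau> j)) \<theta>\<bar> \<le>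
        (\<Sum>j = - int Nm..int Np. 6 * C0 * N * exp (- (c * M)) * exp (- (s * \<bar>of_int j * k\<bar>)))"
    proof (rule order_trans[OF sum_abs], rule sum_mono)
      fix j :: int
      let ?y = "of_int j * k"
      have "\<bar>exp (s * ?y) * L2_inner D (?d (?\<tau> j)) \<theta>\<bar> \<le>
          exp (s * ?y) * (6 * C0 * exp (- (max 1 (?\<tau> j) * c * M / ?\<tau> j)) * N)"
        unfolding abs_mult abs_exp_cancel by (rule mult_left_mono[OF termwise]) simp_all
      also have "\<dots> = 6 * C0 * N * (exp (s * ?y) * exp (- (max 1 (?\<tau> j) * c * M / ?\<tau> j)))"
        by (simp only: mult_ac)
      also have "\<dots> \<le> 6 * C0 * N * (exp (- (c * M)) * exp (- (s * \<bar>?y\<bar>)))"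
        by (rule mult_left_mono[OF quadrature_weight_le[OF s cM]]) (use N decay(2) in simp)
      finally show "\<bar>exp (s * ?y) * L2_inner D (?d (?\<tau> j)) \<theta>\<bar> \<le>
          6 * C0 * N * exp (- (c * M)) * exp (- (s * \<bar>?y\<bar>))"
        by (simp only: mult.assoc)
    qed
    also have "\<dots> = 6 * C0 * N * exp (- (c * M)) * (\<Sum>j = - int Nm..int Np. exp (- (s * \<bar>of_int j * k\<bar>)))"
      by (simp only: sum_distrib_left)
    finally have sum_le: "\<bar>\<Sum>j = - int Nm..int Np. exp (s * (of_int j * k)) * L2_inner D (?d (?\<tau> j)) \<theta>\<bar> \<le>
        6 * C0 * N * exp (- (c * M)) * (\<Sum>j = - int Nm..int Np. exp (- (s * \<bar>of_int j * k\<bar>)))" .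
    have "\<bar>quad_form D v s k Nm Np \<eta> \<theta> - quad_form D (vM M) s k Nm Np \<eta> \<theta>\<bar> =
        cs * k / 2 * \<bar>\<Sum>j = - int Nm..int Np. exp (s * (of_int j * k)) * L2_inner D (?d (?\<tau> j)) \<theta>\<bar>"
      unfolding eq abs_mult using \<open>cs > 0\<close> k(1) by simp
    also have "\<dots> \<le> cs * k / 2 * (6 * C0 * N * exp (- (c * M)) * (\<Sum>j = - int Nm..int Np. exp (- (s * \<bar>of_int j * k\<bar>))))"
      by (rule mult_left_mono[OF sum_le]) (use \<open>cs > 0\<close> k(1) in simp)
    also have "\<dots> = cs / 2 * (6 * C0) * N * exp (- (c * M)) * (k * (\<Sum>j = - int Nm..int Np. exp (- (s * \<bar>of_int j * k\<bar>))))"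
      by simp
    also have "\<dots> \<le> cs / 2 * (6 * C0) * N * exp (- (c * M)) * (2 * (1 + s * k0) / s)"
    proof (rule mult_left_mono)
      have "2 * (1 + s * k) / s \<le> 2 * (1 + s * k0) / s"
        using k(2) s by (intro divide_right_mono) auto
      then show "k * (\<Sum>j = - int Nm..int Np. exp (- (s * \<bar>of_int j * k\<bar>))) \<le> 2 * (1 + s * k0) / s"
        using step_sum_le[OF s(1) k(1), of Nm Np] by linarith
      show "0 \<le> cs / 2 * (6 * C0) * N * exp (- (c * M))" using \<open>cs > 0\<close> decay(2) N by simp
    qed
    also have "\<dots> = C * exp (- (c * M)) * norm_L2 D \<eta> * norm_L2 D \<theta>"
      by (simp only: C_def N_def mult_ac)
    finally show ?thesis .
  qed
  ultimately show ?thesis by blast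
qed

end
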